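(* There exists a constant $C>0$ such that for every integer $N>10$ and every weight $w$ on $\mathbb{R}^2$, with $W=\mathfrak{M}_{\Sigma_N}\mathfrak{M}_{\mathcal{Q}}w$ (i.e. $W=\mathfrak{M}_{\Sigma_N}(\mathfrak{M}_{\mathcal{Q}}w)$), $$ \sup_{t>0}\,t\,w(\{x\in\mathbb{R}^2:\ \mathfrak{M}_{\Sigma_N}f(x)>t\})^{1/2} \le C(\log N)^{1/2}\,\|f\|_{L^2(\mathbb{R}^2,W)} $$ holds for all $f\in L^2(\mathbb{R}^2,W)$. The constant $C$ does not depend on $w$ and $f$ (nor on $N$).
   Context: A weight on $\mathbb{R}^2$ is a non-negative locally integrable function on $\mathbb{R}^2$. For a measurable set $E$, $w(E)=\int_E w(x)\,dx$, $|E|$ is the Lebesgue measure of $E$, and $\mathbf{1}_E$ is its characteristic function. $L^2(\mathbb{R}^2,W)$ is the weighted Lebesgue space with $\|f\|_{L^2(\mathbb{R}^2,W)}=\left(\int_{\mathbb{R}^2}|f(x)|^2W(x)\,dx\right)^{1/2}$. $\mathcal{Q}$ is the set of all cubes (squares) in $\mathbb{R}^2$, with sides not necessarily parallel to the axes. The Hardy-Littlewood maximal operator is $$\mathfrak{M}_{\mathcal{Q}}f(x)=\sup_{Q\in\mathcal{Q}}\mathbf{1}_Q(x)\frac{1}{|Q|}\int_Q|f(y)|\,dy .$$ For a set $\Sigma\subset S^1$ of unit vectors in $\mathbb{R}^2$, $\mathcal{B}_{\Sigma}$ is the set of all rectangles in $\mathbb{R}^2$ whose longest side is parallel to some vector in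 $\Sigma$, and the directional maximal operator associated with $\Sigma$ is $$\mathfrak{M}_{\Sigma}f(x)=\sup_{R\in\mathcal{B}_{\Sigma}}\mathbf{1}_R(x)\frac{1}{|R|}\int_R|f(y)|\,dy .$$ For an integer $N$, $$\Sigma_N=\left\{\left(\cos\frac{2\pi j}{N},\ \sin\frac{2\pi j}{N}\right):\ j=0,1,\ldots,N-1\right\}$$ is the set of $N$ uniformly spread directions on the circle. The formulas for the maximal operators are used for arbitrary measurable functions (e.g. $\mathfrak{M}_{\mathcal{Q}}w$, with values in $[0,\infty]$); integrals of non-negative functions take values in $[0,\infty]$, with the convention $0\cdot\infty=0$. *)

theory Defs
  imports "HOL-Analysis.Analysis"
begin

definition weight :: "(real^2 \<Rightarrow> real) \<Rightarrow> bool" where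
  "weight w \<longleftrightarrow> (\<forall>x. 0 \<le> w x) \<and> (\<forall>K. compact K \<longrightarrow> set_integrable lebesgue K w)"

definition weight_measure :: "(real^2 \<Rightarrow> real) \<Rightarrow> (real^2) set \<Rightarrow> ennreal" where
  "weight_measure w E = (\<integral>\<^sup>+ x\<in>E. ennreal (w x) \<partial>lebesgue)"

text \<open>
  The closed rectangle with a vertex \<open>p\<close> and sides of length \<open>a\<close> and \<open>b\<close> parallel to the vectors
  \<open>u\<close> and \<open>v\<close>, which are orthonormal wherever this is used.
\<close>
definition rectangle :: "real^2 \<Rightarrow> real^2 \<Rightarrow> real^2 \<Rightarrow> real \<Rightarrow> real \<Rightarrow> (real^2) set" where
  "rectangle p u v a b = {p + s *\<^sub>R u + t *\<^sub>R v | s t. s \<in> {0..a} \<and> t \<in> {0..b}}"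

definition orthonormal_pair :: "real^2 \<Rightarrow> real^2 \<Rightarrow> bool" where
  "orthonormal_pair u v \<longleftrightarrow> norm u = 1 \<and> norm v = 1 \<and> u \<bullet> v = 0"

definition cubes :: "(real^2) set set" where
  "cubes = {rectangle p u v a a | p u v a. orthonormal_pair u v \<and> 0 < a}"

text \<open>
  The side of length \<open>a \<ge> b\<close> is a longest one; since \<open>a = b\<close> is allowed, a square qualifies as soon
  as one of its sides is parallel to a vector in \<open>\<Sigma>\<close>.
\<close>
definition directional_rectangles :: "(real^2) set \<Rightarrow> (real^2) set set" where
  "directional_rectangles \<Sigma> = {rectangle p u v a b | p u v a b.
     orthonormal_pair u v \<and> 0 < b \<and> b \<le> a \<and> (\<exists>e\<in>\<Sigma>. \<exists>c. u = c *\<^sub>R e)}"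

text \<open>
  Maximal operators act on \<open>[0, \<infinity>]\<close>-valued functions \<open>g\<close>, which play the role of \<open>|f|\<close>; thus they
  can be iterated. In \<^typ>\<open>ennreal\<close> one has \<open>0 * \<infinity> = 0\<close>.
\<close>
definition maximal_operator :: "(real^2) set set \<Rightarrow> (real^2 \<Rightarrow> ennreal) \<Rightarrow> real^2 \<Rightarrow> ennreal" where
  "maximal_operator \<B> g x =
     (SUP R\<in>\<B>. indicator R x * ((1 / emeasure lebesgue R) * (\<integral>\<^sup>+ y\<in>R. g y \<partial>lebesgue)))"

definition hl_maximal :: "(real^2 \<Rightarrow> ennreal) \<Rightarrow> real^2 \<Rightarrow> ennreal" where
  "hl_maximal = maximal_operator cubes"

definition directional_maximal :: "(real^2) set \<Rightarrow> (real^2 \<Rightarrow> ennreal) \<Rightarrow> real^2 \<Rightarrow> ennreal" where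
  "directional_maximal \<Sigma> = maximal_operator (directional_rectangles \<Sigma>)"

definition uniform_directions :: "nat \<Rightarrow> (real^2) set" where
  "uniform_directions N =
     {vector [cos (2 * pi * real j / real N), sin (2 * pi * real j / real N)] | j. j < N}"

definition ennreal_sqrt :: "ennreal \<Rightarrow> ennreal" where
  "ennreal_sqrt a = (if a = \<infinity> then \<infinity> else ennreal (sqrt (enn2real a)))"

definition weighted_L2_norm :: "(real^2 \<Rightarrow> ennreal) \<Rightarrow> (real^2 \<Rightarrow> complex) \<Rightarrow> ennreal" where
  "weighted_L2_norm W f = ennreal_sqrt (\<integral>\<^sup>+ x. (ennreal (norm (f x)))\<^sup>2 * W x \<partial>lebesgue)"

definition weighted_L2 :: "(real^2 \<Rightarrow> ennreal) \<Rightarrow> (real^2 \<Rightarrow> complex) set" where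
  "weighted_L2 W = {f \<in> borel_measurable lebesgue. weighted_L2_norm W f < \<infinity>}"

end

(*
  Fix finitely many rectangles R_i on which |f| has average > t, with sides 2 a_i >= 2 b_i. Let V_i
  be the average of M_Q w over the lengthening of R_i by the factor 8 in the long direction; then
  V_i <= W on R_i, and for b_i <= h <= 16 a_i the rectangle with half sides 8 a_i and h around R_i
  has w-measure O(h a_i V_i).

  Going through the rectangles in the order of decreasing a_i, select R_j unless the sum of
  min(V_j,V_k) |R_j Int R_k| over the already selected k exceeds 2 L V_j |R_j|, where L ~ log N.
  For the selected family put X = sum V_k |R_k|. Duality and the selection rule bound X by
  C L t^(-2) times the integral of f^2 W, so it remains to bound the w-measure of all R_i by C X.

  A rejected R_j either meets mostly selected rectangles parallel to it, and these R_j are handled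
  by a Vitali covering with balls of radius 3 b_j; or it meets mostly selected rectangles at an
  angle of at least d = 1/N. In the second case R_j may be replaced by P_j, twice as long and of
  half width b_j + d a_j: sliding along the longer rectangle R_k shows that the density of R_k in
  P_j is comparable to that in R_j. The kernel min(s,t) being positive definite, the Cauchy-Schwarz
  inequality bounds the w-measure of these R_j by X and a quadratic form in the P_j alone. The
  rectangles P_j have eccentricity at most N, hence only O(log N) dyadic scales enter that form.
*)
theory Submission
  imports Defs
begin

text \<open>The factor \<open>L\<close> must be paid only once, in the duality step. Let
  \<open>Y\<close> be the w-measure of the rectangles rejected for transversal overlap. The
  rejection rule bounds \<open>L * Y\<close> by a constant times a mixed form between the fattened
  and the selected rectangles. The form on the selected ones is O(\<open>L * X\<close>), the form on
  the fattened ones O(\<open>L * Y\<close>). Thus \<open>L * Y\<close> is compared with the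
  geometric mean of \<open>L * X\<close> and \<open>L * Y\<close>; all powers of \<open>L\<close>
  cancel and \<open>Y\<close> is O(\<open>X\<close>). The weight min(V_j, V_k) serves both ends: in
  the duality step one has V_j V_k <= W min(V_j, V_k) on the overlap, and in the form of the
  fattened rectangles the minimum may be replaced by the value of the shorter one. Parallel overlaps
  need their own argument because the eccentricity of R_j is unbounded: widening R_j to P_j would
  dilute a thin parallel R_k, as sliding along R_k then never leaves R_j sideways. The lengthening
  by 8 makes room for every R_j whose P_j meets P_k with a_j <= a_k, and the rectangle so obtained
  still competes in the supremum that defines W.\<close>

section \<open>Rectangles in the plane\<close>

text \<open>In contrast to \<^const>\<open>rectangle\<close>, here \<open>c\<close> is the centre and \<open>a\<close>, \<open>b\<close> are half side lengths.\<close>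
definition hrect :: "real^2 \<Rightarrow> real^2 \<Rightarrow> real^2 \<Rightarrow> real \<Rightarrow> real \<Rightarrow> (real^2) set" where
  "hrect c u v a b = {x. \<bar>(x - c) \<bullet> u\<bar> \<le> a \<and> \<bar>(x - c) \<bullet> v\<bar> \<le> b}"

lemma mem_hrect: "x \<in> hrect c u v a b \<longleftrightarrow> \<bar>(x - c) \<bullet> u\<bar> \<le> a \<and> \<bar>(x - c) \<bullet> v\<bar> \<le> b"
  by (simp add: hrect_def)

lemma orthonormal_pairD:
  assumes "orthonormal_pair u v"
  shows "u \<bullet> u = 1" "v \<bullet> v = 1" "u \<bullet> v = 0" "v \<bullet> u = 0" "norm u = 1" "norm v = 1"
  using assms by (auto simp: orthonormal_pair_def norm_eq_1 inner_commute)

text \<open>In the plane, v is u turned by a right angle up to the sign \<open>e\<close>, the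
  determinant of the pair. After this substitution the identity is polynomial.\<close>

lemma orthonormal_inner:
  assumes o: "orthonormal_pair u v"
  shows "x \<bullet> y = (x \<bullet> u) * (y \<bullet> u) + (x \<bullet> v) * (y \<bullet> v)"
proof -
  define e where "e = u$1 * v$2 - u$2 * v$1"
  have eqs: "u$1 * u$1 + u$2 * u$2 = 1" "v$1 * v$1 + v$2 * v$2 = 1" "u$1 * v$1 + u$2 * v$2 = 0"
    using orthonormal_pairD(1-3)[OF o] by (simp_all add: inner_vec_def sum_2)
  have v1: "v$1 = - (e * u$2)" unfolding e_def using eqs(1,3) by algebra
  have v2: "v$2 = e * u$1" unfolding e_def using eqs(1,3) by algebra
  have ee: "e * e = 1" using eqs(1,2) unfolding v1 v2 by algebra
  show ?thesis
    unfolding inner_vec_def sum_2 inner_real_def v1 v2 using ee eqs(1) by algebra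
qed

lemma orthonormal_norm:
  assumes o: "orthonormal_pair u v"
  shows "(norm x)\<^sup>2 = (x \<bullet> u)\<^sup>2 + (x \<bullet> v)\<^sup>2"
  using orthonormal_inner[OF o, of x x] by (subst power2_norm_eq_inner) (simp add: power2_eq_square)

lemma orthonormal_expansion:
  assumes o: "orthonormal_pair u v"
  shows "x = (x \<bullet> u) *\<^sub>R u + (x \<bullet> v) *\<^sub>R v"
proof -
  have "(x - ((x \<bullet> u) *\<^sub>R u + (x \<bullet> v) *\<^sub>R v)) \<bullet> y = 0" for y
    using orthonormal_inner[OF o, of x y]
    by (simp add: inner_diff_left inner_add_left inner_commute[of y])
  from this[of "x - ((x \<bullet> u) *\<^sub>R u + (x \<bullet> v) *\<^sub>R v)"] show ?thesis by simp
qed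

lemma hrect_uminus: "hrect c (- u) v a b = hrect c u v a b" "hrect c u (- v) a b = hrect c u v a b"
  by (auto simp: hrect_def)

lemma hrect_mono: "a \<le> a' \<Longrightarrow> b \<le> b' \<Longrightarrow> hrect c u v a b \<subseteq> hrect c u v a' b'"
  by (auto simp: hrect_def)

lemma closed_hrect: "closed (hrect c u v a b)"
  unfolding hrect_def by (intro closed_Collect_conj closed_Collect_le continuous_intros)

lemma hrect_borel [measurable, simp]: "hrect c u v a b \<in> sets borel"
  using closed_hrect by (rule borel_closed)

lemma hrect_eq_image:
  assumes o: "orthonormal_pair u v"
  shows "hrect c u v a b = (\<lambda>x::real^2. c + (x$1 *\<^sub>R u + x$2 *\<^sub>R v)) ` cbox (vector [-a,-b]) (vector [a,b])"
    (is "_ = ?f ` ?B")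
proof (intro set_eqI iffI)
  fix x assume x: "x \<in> hrect c u v a b"
  have "x = ?f (vector [(x - c) \<bullet> u, (x - c) \<bullet> v])"
    using orthonormal_expansion[OF o, of "x - c"] by (simp add: algebra_simps)
  moreover have "(vector [(x - c) \<bullet> u, (x - c) \<bullet> v] :: real^2) \<in> ?B"
    using x by (auto simp: mem_hrect mem_box_cart forall_2 abs_le_iff)
  ultimately show "x \<in> ?f ` ?B" by blast
next
  fix x assume "x \<in> ?f ` ?B"
  then obtain y where y: "y \<in> ?B" and x: "x = ?f y" by blast
  have "(x - c) \<bullet> u = y$1" "(x - c) \<bullet> v = y$2"
    by (simp_all add: x inner_add_left orthonormal_pairD[OF o])
  then show "x \<in> hrect c u v a b"
    using y by (simp add: mem_hrect mem_box_cart forall_2 abs_le_iff)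
qed

lemma emeasure_hrect:
  assumes o: "orthonormal_pair u v" and ab: "0 \<le> a" "0 \<le> b"
  shows "emeasure lborel (hrect c u v a b) = ennreal (4 * a * b)"
proof -
  let ?g = "\<lambda>x::real^2. x$1 *\<^sub>R u + x$2 *\<^sub>R v"
  let ?B = "cbox (vector [-a,-b]) (vector [a,b]) :: (real^2) set"
  have lin: "linear ?g" by (intro linearI) (simp_all add: algebra_simps)
  have orth: "orthogonal_transformation ?g"
    unfolding orthogonal_transformation_def
  proof (intro conjI allI lin)
    fix x y
    show "?g x \<bullet> ?g y = x \<bullet> y"
      by (simp add: inner_add_left inner_add_right orthonormal_pairD[OF o]) (simp add: inner_vec_def sum_2)
  qed
  have eq: "hrect c u v a b = (+) c ` (?g ` ?B)"
    by (simp add: hrect_eq_image[OF o] image_image)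
  have B: "?B \<in> lmeasurable" by (rule lmeasurable_cbox)
  have gB: "?g ` ?B \<in> lmeasurable" by (rule measurable_orthogonal_image[OF orth B])
  have "measure lebesgue (hrect c u v a b) = measure lebesgue ?B"
    using measure_orthogonal_image[OF orth B] by (simp add: eq measure_translation)
  also have "\<dots> = 4 * a * b"
  proof -
    have "0 \<in> ?B" using ab by (simp add: mem_box_cart forall_2)
    then have "measure lborel ?B = 4 * a * b" by (subst content_cbox_cart) (auto simp: UNIV_2)
    then show ?thesis by simp
  qed
  finally have "measure lebesgue (hrect c u v a b) = 4 * a * b" .
  moreover have "hrect c u v a b \<in> lmeasurable"
    unfolding eq using gB by (rule measurable_translation)
  ultimately have "emeasure lebesgue (hrect c u v a b) = ennreal (4 * a * b)"
    using emeasure_eq_measure2 by metis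
  then show ?thesis by (simp add: emeasure_completion main_part_sets)
qed

section \<open>Sliding a set along a direction\<close>

lemma nn_integral_translation:
  fixes f :: "'a::euclidean_space \<Rightarrow> ennreal"
  assumes [measurable]: "f \<in> borel_measurable borel"
  shows "(\<integral>\<^sup>+z. f (z + c) \<partial>lborel) = (\<integral>\<^sup>+z. f z \<partial>lborel)"
proof -
  have "(\<integral>\<^sup>+z. f z \<partial>lborel) = (\<integral>\<^sup>+z. f z \<partial>(distr lborel borel ((+) c)))"
    by (simp add: lborel_distr_plus)
  also have "\<dots> = (\<integral>\<^sup>+z. f (c + z) \<partial>lborel)"
    by (subst nn_integral_distr) auto
  finally show ?thesis by (simp add: add.commute)
qed

text \<open>
  Slide \<open>A\<close> inside \<open>Z\<close> along \<open>e\<close>: a point of \<open>Z\<close> is covered during a time of at most \<open>2 b / |e \<bullet> v|\<close>,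
  because \<open>A\<close> lies in a strip of width \<open>2 b\<close>.
\<close>
lemma emeasure_sliding:
  fixes A Z :: "(real^2) set"
  assumes [measurable]: "A \<in> sets borel" "Z \<in> sets borel"
    and T: "0 \<le> T" and sl: "\<And>x t. x \<in> A \<Longrightarrow> 0 \<le> t \<Longrightarrow> t \<le> T \<Longrightarrow> x + t *\<^sub>R e \<in> Z"
    and strip: "\<And>x. x \<in> A \<Longrightarrow> \<bar>(x - c) \<bullet> v\<bar> \<le> b" and ev: "e \<bullet> v \<noteq> 0" and b: "0 \<le> b"
  shows "ennreal T * emeasure lborel A \<le> ennreal (2 * b / \<bar>e \<bullet> v\<bar>) * emeasure lborel Z"
proof -
  have "ennreal T * emeasure lborel A = (\<integral>\<^sup>+t. indicator {0..T} t * emeasure lborel A \<partial>lborel)"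
    using T by (simp add: nn_integral_multc)
  also have "\<dots> = (\<integral>\<^sup>+t. (\<integral>\<^sup>+z. indicator {0..T} t * indicator A (z + (- t *\<^sub>R e)) \<partial>lborel) \<partial>lborel)"
  proof (intro nn_integral_cong)
    fix t :: real
    have "(\<integral>\<^sup>+z. indicator {0..T} t * indicator A (z + (- t *\<^sub>R e)) \<partial>lborel)
        = indicator {0..T} t * (\<integral>\<^sup>+z. indicator A (z + (- t *\<^sub>R e)) \<partial>lborel)"
      by (intro nn_integral_cmult) measurable
    also have "(\<integral>\<^sup>+z. indicator A (z + (- t *\<^sub>R e)) \<partial>lborel) = emeasure lborel A"
      by (subst nn_integral_translation) auto
    finally show "indicator {0..T} t * emeasure lborel A =
      (\<integral>\<^sup>+z. indicator {0..T} t * indicator A (z + (- t *\<^sub>R e)) \<partial>lborel)" by simp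
  qed
  also have "\<dots> = (\<integral>\<^sup>+z. (\<integral>\<^sup>+t. indicator {0..T} t * indicator A (z + (- t *\<^sub>R e)) \<partial>lborel) \<partial>lborel)"
    by (intro lborel_pair.Fubini') measurable
  also have "\<dots> \<le> (\<integral>\<^sup>+z. ennreal (2 * b / \<bar>e \<bullet> v\<bar>) * indicator Z z \<partial>lborel)"
  proof (intro nn_integral_mono)
    fix z :: "real^2"
    \<comment> \<open>\<open>?m\<close> is the time t at which \<open>z - t *\<^sub>R e\<close>
      crosses the middle line of the strip, and \<open>?r\<close> is half the time it spends in the
      strip.\<close>
    let ?m = "((z - c) \<bullet> v) / (e \<bullet> v)" and ?r = "b / \<bar>e \<bullet> v\<bar>"
    have le: "indicator {0..T} t * indicator A (z + (- t *\<^sub>R e)) \<le> (indicator Z z * indicator {?m - ?r..?m + ?r} t :: ennreal)" for t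
    proof (cases "t \<in> {0..T} \<and> z + (- t *\<^sub>R e) \<in> A")
      case True
      then have "z \<in> Z" using sl[of "z + (- t *\<^sub>R e)" t] by simp
      moreover have "\<bar>?m - t\<bar> \<le> ?r"
      proof -
        have "\<bar>(z - c) \<bullet> v - t * (e \<bullet> v)\<bar> \<le> b"
          using strip[of "z + (- t *\<^sub>R e)"] True by (simp add: inner_diff_left inner_add_left)
        moreover have "?m - t = ((z - c) \<bullet> v - t * (e \<bullet> v)) / (e \<bullet> v)" using ev by (simp add: field_simps)
        ultimately show ?thesis using ev by (simp add: divide_right_mono abs_divide)
      qed
      ultimately show ?thesis using True by (auto simp: abs_le_iff indicator_def)
    qed (auto simp: indicator_def)
    have "(\<integral>\<^sup>+t. indicator {0..T} t * indicator A (z + (- t *\<^sub>R e)) \<partial>lborel)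
        \<le> (\<integral>\<^sup>+t. indicator Z z * indicator {?m - ?r..?m + ?r} t \<partial>lborel)"
      by (intro nn_integral_mono le)
    also have "\<dots> = indicator Z z * ennreal (2 * ?r)"
      using b by (subst nn_integral_cmult) (auto simp: field_simps)
    finally show "(\<integral>\<^sup>+t. indicator {0..T} t * indicator A (z + (- t *\<^sub>R e)) \<partial>lborel) \<le> ennreal (2 * b / \<bar>e \<bullet> v\<bar>) * indicator Z z"
      by (simp add: mult.commute)
  qed
  also have "\<dots> = ennreal (2 * b / \<bar>e \<bullet> v\<bar>) * emeasure lborel Z"
    by (simp add: nn_integral_cmult)
  finally show ?thesis .
qed

section \<open>Areas of rectangles and of their intersections\<close>

abbreviation area :: "(real^2) set \<Rightarrow> real" where
  "area A \<equiv> measure lborel A"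

lemma area_hrect:
  assumes "orthonormal_pair u v" "0 \<le> a" "0 \<le> b"
  shows "area (hrect c u v a b) = 4 * a * b"
  using emeasure_hrect[OF assms] assms by (simp add: measure_def)

lemma emeasure_hrect_finite:
  assumes "orthonormal_pair u v"
  shows "emeasure lborel (hrect c u v a b) < \<infinity>"
proof -
  have "emeasure lborel (hrect c u v a b) \<le> emeasure lborel (hrect c u v \<bar>a\<bar> \<bar>b\<bar>)"
    by (intro emeasure_mono hrect_mono) auto
  also have "\<dots> < \<infinity>" using assms by (simp add: emeasure_hrect)
  finally show ?thesis .
qed

lemma area_mono_hrect:
  assumes "A \<subseteq> hrect c u v a b" "A \<in> sets borel" "orthonormal_pair u v" "0 \<le> a" "0 \<le> b"
  shows "area A \<le> 4 * a * b"
  using assms measure_mono_fmeasurable[of A "hrect c u v a b" lborel] emeasure_hrect_finite[of u v c a b]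
  by (simp add: area_hrect fmeasurable_def)

lemma area_mono:
  assumes "A \<subseteq> B" "B \<subseteq> hrect c u v a b" "A \<in> sets borel" "B \<in> sets borel" "orthonormal_pair u v"
  shows "area A \<le> area B"
proof (rule measure_mono_fmeasurable)
  have "emeasure lborel B \<le> emeasure lborel (hrect c u v a b)"
    using assms by (intro emeasure_mono) auto
  then show "B \<in> fmeasurable lborel"
    using emeasure_hrect_finite[OF assms(5), of c a b] assms(4) by (auto simp: fmeasurable_def)
qed (use assms in auto)

text \<open>Real-valued form of the sliding estimate. Multiplying by |e \<bullet> v| instead of
  dividing admits sliding parallel to the strip; the rectangle around Z ensures that the areas are
  finite.\<close>

lemma area_sliding:
  fixes A Z :: "(real^2) set"
  assumes A: "A \<in> sets borel" and Z: "Z \<in> sets borel" "Z \<subseteq> hrect c1 u1 v1 a1 b1" "orthonormal_pair u1 v1"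
    and T: "0 \<le> T" and sl: "\<And>x t. x \<in> A \<Longrightarrow> 0 \<le> t \<Longrightarrow> t \<le> T \<Longrightarrow> x + t *\<^sub>R e \<in> Z"
    and strip: "\<And>x. x \<in> A \<Longrightarrow> \<bar>(x - c) \<bullet> v\<bar> \<le> b" and b: "0 \<le> b"
  shows "T * \<bar>e \<bullet> v\<bar> * area A \<le> 2 * b * area Z"
proof (cases "e \<bullet> v = 0")
  case False
  have fin: "emeasure lborel Z < \<infinity>"
    using emeasure_mono[of Z "hrect c1 u1 v1 a1 b1" lborel] emeasure_hrect_finite[OF Z(3), of c1 a1 b1] Z by auto
  have "A \<subseteq> Z" using sl[of _ 0] T by auto
  then have finA: "emeasure lborel A < \<infinity>" using emeasure_mono[of A Z lborel] fin Z(1) by auto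
  have eA: "emeasure lborel A = ennreal (area A)" and eZ: "emeasure lborel Z = ennreal (area Z)"
    using fin finA by (auto intro!: emeasure_eq_ennreal_measure)
  have "ennreal T * ennreal (area A) \<le> ennreal (2 * b / \<bar>e \<bullet> v\<bar>) * ennreal (area Z)"
    using emeasure_sliding[OF A Z(1) T sl strip False b] unfolding eA eZ by blast
  then have "ennreal (T * area A) \<le> ennreal (2 * b / \<bar>e \<bullet> v\<bar> * area Z)"
    using T b by (metis ennreal_mult measure_nonneg divide_nonneg_nonneg abs_ge_zero mult_nonneg_nonneg zero_le_numeral)
  then have "T * area A \<le> 2 * b / \<bar>e \<bullet> v\<bar> * area Z"
    using b by (simp add: ennreal_le_iff)
  then show ?thesis using False by (simp add: field_simps)
qed (use b in simp)

text \<open>Slide the intersection along u through the whole length 2 a. It stays in a rectangle of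
  twice the length, shifted by a so that it reaches from -a to 3 a, while it started in the strip of
  half width b' across v'.\<close>

lemma area_inter_slab:
  assumes o: "orthonormal_pair u v" and a: "0 \<le> a" "0 \<le> b" "0 \<le> b'"
  shows "area (hrect c u v a b \<inter> hrect c' u' v' a' b') * (a * \<bar>u \<bullet> v'\<bar>) \<le> 2 * b' * (4 * a * b)"
proof -
  have "(2 * a) * \<bar>u \<bullet> v'\<bar> * area (hrect c u v a b \<inter> hrect c' u' v' a' b') \<le> 2 * b' * area (hrect (c + a *\<^sub>R u) u v (2 * a) b)"
  proof (rule area_sliding[where c=c' and ?c1.0="c + a *\<^sub>R u" and ?u1.0=u and ?v1.0=v and ?a1.0="2*a" and ?b1.0=b])
    fix x t assume "x \<in> hrect c u v a b \<inter> hrect c' u' v' a' b'" "0 \<le> t" "t \<le> 2 * a"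
    then show "x + t *\<^sub>R u \<in> hrect (c + a *\<^sub>R u) u v (2 * a) b"
      by (auto simp: mem_hrect inner_diff_left inner_add_left orthonormal_pairD[OF o])
  qed (use o a in \<open>auto simp: mem_hrect\<close>)
  also have "\<dots> = 2 * b' * (8 * a * b)" using o a by (simp add: area_hrect)
  finally show ?thesis by (simp add: mult_ac)
qed

lemma hrect_swap: "hrect c u v a b = hrect c v u b a"
  by (auto simp: hrect_def)

lemma orthonormal_pair_swap: "orthonormal_pair u v \<Longrightarrow> orthonormal_pair v u"
  by (auto simp: orthonormal_pair_def inner_commute)

lemma orthonormal_pair_uminus: "orthonormal_pair u v \<Longrightarrow> orthonormal_pair (- u) v"
  by (auto simp: orthonormal_pair_def)

lemma orthonormal_abs_inner_le:
  assumes "orthonormal_pair u v" "orthonormal_pair u' v'"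
  shows "\<bar>u \<bullet> u'\<bar> \<le> 1" "\<bar>u \<bullet> v'\<bar> \<le> 1" "\<bar>v \<bullet> u'\<bar> \<le> 1" "\<bar>v \<bullet> v'\<bar> \<le> 1"
  using assms Cauchy_Schwarz_ineq2[of u u'] Cauchy_Schwarz_ineq2[of u v'] Cauchy_Schwarz_ineq2[of v u'] Cauchy_Schwarz_ineq2[of v v']
  by (auto simp: orthonormal_pair_def)

text \<open>When the rectangles meet, the bracket is comparable to the extent of their union in the
  direction v'. So the share of the second rectangle in the first is at most about the ratio of b'
  to that extent. The constant is 1 + 2 * 2 + 2 * 4, one summand for each term of the
  bracket.\<close>

lemma area_inter_le:
  assumes o: "orthonormal_pair u v" and o': "orthonormal_pair u' v'"
    and a: "0 \<le> b" "b \<le> a" "0 \<le> b'"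
  shows "area (hrect c u v a b \<inter> hrect c' u' v' a' b') * (b' + 2 * (a * \<bar>u \<bullet> v'\<bar> + b)) \<le> 13 * b' * (4 * a * b)"
proof -
  define m where "m = area (hrect c u v a b \<inter> hrect c' u' v' a' b')"
  have m0: "0 \<le> m" by (simp add: m_def)
  have 1: "m \<le> 4 * a * b" unfolding m_def by (rule area_mono_hrect[OF _ _ o]) (use a in auto)
  then have 1: "m * b' \<le> b' * (4 * a * b)" using a by (simp add: mult_left_mono mult.commute)
  have 2: "m * (a * \<bar>u \<bullet> v'\<bar>) \<le> 2 * b' * (4 * a * b)"
    unfolding m_def by (rule area_inter_slab[OF o]) (use a in auto)
  have "m * (b * \<bar>v \<bullet> v'\<bar>) \<le> 2 * b' * (4 * b * a)"
    unfolding m_def hrect_swap[of c u] by (rule area_inter_slab[OF orthonormal_pair_swap[OF o]]) (use a in auto)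
  then have 3: "m * (b * \<bar>v \<bullet> v'\<bar>) \<le> 2 * b' * (4 * a * b)" by (simp add: mult_ac)
  have "(u \<bullet> v')\<^sup>2 + (v \<bullet> v')\<^sup>2 = 1"
    using orthonormal_norm[OF o, of v'] orthonormal_pairD(6)[OF o'] by (simp add: inner_commute)
  \<comment> \<open>The unit vector v' has a component of size at least 1/2 along v or along u. In
    the first case sliding along v handles the term \<open>b\<close>; in the second, sliding along u
    does, because \<open>b \<le> a\<close>.\<close>
  have "1/2 \<le> \<bar>v \<bullet> v'\<bar> \<or> 1/2 \<le> \<bar>u \<bullet> v'\<bar>"
  proof (rule ccontr)
    assume "\<not> ?thesis"
    then have "(u \<bullet> v')\<^sup>2 < (1/2)\<^sup>2" "(v \<bullet> v')\<^sup>2 < (1/2)\<^sup>2"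
      by (auto intro!: abs_square_less_1 simp: abs_less_iff power2_strict_mono)
    then show False using \<open>(u \<bullet> v')\<^sup>2 + (v \<bullet> v')\<^sup>2 = 1\<close> by (simp add: power2_eq_square)
  qed
  then have 4: "m * b \<le> 4 * b' * (4 * a * b)"
  proof
    assume "1/2 \<le> \<bar>v \<bullet> v'\<bar>"
    then have "(m * b) * (1/2) \<le> (m * b) * \<bar>v \<bullet> v'\<bar>" using m0 a by (intro mult_left_mono) auto
    then show ?thesis using 3 by (simp add: mult_ac)
  next
    assume "1/2 \<le> \<bar>u \<bullet> v'\<bar>"
    then have "(m * a) * (1/2) \<le> (m * a) * \<bar>u \<bullet> v'\<bar>" using m0 a by (intro mult_left_mono) auto
    moreover have "m * b \<le> m * a" using m0 a by (intro mult_left_mono) auto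
    ultimately show ?thesis using 2 by (simp add: mult_ac)
  qed
  have "m * (b' + 2 * (a * \<bar>u \<bullet> v'\<bar> + b)) = m * b' + 2 * (m * (a * \<bar>u \<bullet> v'\<bar>)) + 2 * (m * b)"
    by (simp add: algebra_simps)
  also have "\<dots> \<le> 13 * b' * (4 * a * b)" using 1 2 4 by (simp add: mult_ac)
  finally show ?thesis unfolding m_def .
qed

text \<open>Meant for a rectangle (a0, b0) and its fattening (a1, b1): if the fattening meets
  another rectangle at z, each point x of the original lies in an enlarged copy of that other
  rectangle. Going from z to x moves at most a0 + a1 along u, and only the component of u across the
  other rectangle widens it by that much.\<close>

lemma hrect_point_bounds:
  assumes o: "orthonormal_pair u v" and o': "orthonormal_pair u' v'"
    and x: "x \<in> hrect c u v a0 b0" and z: "z \<in> hrect c u v a1 b1" "z \<in> hrect c' u' v' a' b'"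
  shows "\<bar>(x - c') \<bullet> v'\<bar> \<le> b' + ((a0 + a1) * \<bar>u \<bullet> v'\<bar> + (b0 + b1))"
    and "\<bar>(x - c') \<bullet> u'\<bar> \<le> a' + ((a0 + a1) + (b0 + b1))"
proof -
  define p q where "p = (x - z) \<bullet> u" and "q = (x - z) \<bullet> v"
  have pq: "\<bar>p\<bar> \<le> a0 + a1" "\<bar>q\<bar> \<le> b0 + b1"
    using x z(1) by (auto simp: mem_hrect p_def q_def inner_diff_left)
  have e: "(x - c') \<bullet> y = (z - c') \<bullet> y + p * (u \<bullet> y) + q * (v \<bullet> y)" for y
    using orthonormal_inner[OF o, of "x - z" y]
    by (simp add: p_def q_def inner_diff_left inner_commute[of y])
  have b: "\<bar>p * s + q * t\<bar> \<le> (a0 + a1) * \<bar>s\<bar> + (b0 + b1)" if "\<bar>t\<bar> \<le> 1" for s t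
  proof -
    have "\<bar>p * s\<bar> \<le> (a0 + a1) * \<bar>s\<bar>" using pq by (simp add: abs_mult mult_right_mono)
    moreover have "\<bar>q\<bar> * \<bar>t\<bar> \<le> (b0 + b1) * 1" using pq that by (intro mult_mono) auto
    moreover have "\<bar>p * s + q * t\<bar> \<le> \<bar>p * s\<bar> + \<bar>q\<bar> * \<bar>t\<bar>"
      using abs_triangle_ineq[of "p * s" "q * t"] by (simp only: abs_mult)
    ultimately show ?thesis by (smt (verit))
  qed
  show "\<bar>(x - c') \<bullet> v'\<bar> \<le> b' + ((a0 + a1) * \<bar>u \<bullet> v'\<bar> + (b0 + b1))"
    using b[of "v \<bullet> v'" "u \<bullet> v'"] orthonormal_abs_inner_le[OF o o'] z(2) unfolding e mem_hrect by (smt (verit))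
  have "(a0 + a1) * \<bar>u \<bullet> u'\<bar> \<le> (a0 + a1) * 1"
    using orthonormal_abs_inner_le[OF o o'] pq by (intro mult_left_mono) auto
  then show "\<bar>(x - c') \<bullet> u'\<bar> \<le> a' + ((a0 + a1) + (b0 + b1))"
    using b[of "v \<bullet> u'" "u \<bullet> u'"] orthonormal_abs_inner_le[OF o o'] z(2) unfolding e mem_hrect by (smt (verit))
qed

text \<open>Points in the rear half of the longer rectangle can move forward along u' by a' without
  leaving it. The sliding time \<open>?T\<close> is chosen so that the displacement across the short
  rectangle is exactly d a; the lower bound on |u' \<bullet> v| keeps this time below a, so that
  length 2 a suffices.\<close>

lemma area_inter_fat_half:
  assumes o: "orthonormal_pair u v" and o': "orthonormal_pair u' v'"
    and ab: "0 < b" "b \<le> a" "a \<le> a'" "0 < d" "d \<le> \<bar>u' \<bullet> v\<bar>"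
  shows "d * a * area {x \<in> hrect c u v a b \<inter> hrect c' u' v' a' b'. (x - c') \<bullet> u' \<le> 0}
     \<le> 2 * b * area (hrect c' u' v' a' b' \<inter> hrect c u v (2 * a) (b + d * a))"
proof -
  define s where "s = \<bar>u' \<bullet> v\<bar>"
  have s: "0 < s" "d \<le> s" using ab by (auto simp: s_def)
  let ?T = "d * a / s"
  have T: "0 \<le> ?T" "?T \<le> a" using s ab by (auto simp: field_simps)
  have "?T * \<bar>u' \<bullet> v\<bar> * area {x \<in> hrect c u v a b \<inter> hrect c' u' v' a' b'. (x - c') \<bullet> u' \<le> 0}
     \<le> 2 * b * area (hrect c' u' v' a' b' \<inter> hrect c u v (2 * a) (b + d * a))"
  proof (rule area_sliding[where c=c and ?c1.0=c' and ?u1.0=u' and ?v1.0=v' and ?a1.0=a' and ?b1.0=b'])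
    fix x t
    assume x: "x \<in> {x \<in> hrect c u v a b \<inter> hrect c' u' v' a' b'. (x - c') \<bullet> u' \<le> 0}" and t: "0 \<le> t" "t \<le> ?T"
    have "t * \<bar>u' \<bullet> u\<bar> \<le> a * 1"
      using orthonormal_abs_inner_le[OF o' o] t T by (intro mult_mono) auto
    then have tu: "\<bar>t * (u' \<bullet> u)\<bar> \<le> a" using t by (simp add: abs_mult)
    have "t * s \<le> ?T * s" using t s by (intro mult_right_mono) auto
    then have tv: "\<bar>t * (u' \<bullet> v)\<bar> \<le> d * a" using t s by (simp add: abs_mult s_def)
    have "t \<le> a'" using t T ab by linarith
    with x t tu tv show "x + t *\<^sub>R u' \<in> hrect c' u' v' a' b' \<inter> hrect c u v (2 * a) (b + d * a)"
      by (auto simp: mem_hrect inner_diff_left inner_add_left orthonormal_pairD[OF o'])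
  next
    have "{x. (x - c') \<bullet> u' \<le> 0} \<in> sets borel"
      by (intro borel_closed closed_Collect_le continuous_intros)
    moreover have "{x \<in> hrect c u v a b \<inter> hrect c' u' v' a' b'. (x - c') \<bullet> u' \<le> 0} = hrect c u v a b \<inter> hrect c' u' v' a' b' \<inter> {x. (x - c') \<bullet> u' \<le> 0}"
      by auto
    ultimately show "{x \<in> hrect c u v a b \<inter> hrect c' u' v' a' b'. (x - c') \<bullet> u' \<le> 0} \<in> sets borel"
      by simp
  qed (use T ab o' in \<open>auto simp: mem_hrect\<close>)
  moreover have "?T * \<bar>u' \<bullet> v\<bar> = d * a" using s by (simp add: s_def)
  ultimately show ?thesis by (simp only:)
qed

text \<open>The front half is the rear half for -u'. If d a \<le> b, fattening at most doubles the
  width and inclusion is enough; otherwise b + d a is at most 2 d a and the two halves are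
  added.\<close>

lemma area_inter_fat:
  assumes o: "orthonormal_pair u v" and o': "orthonormal_pair u' v'"
    and ab: "0 < b" "b \<le> a" "a \<le> a'" "0 < d" "d \<le> \<bar>u' \<bullet> v\<bar>"
  shows "area (hrect c u v a b \<inter> hrect c' u' v' a' b') * (2 * (b + d * a)) 
     \<le> 16 * b * area (hrect c' u' v' a' b' \<inter> hrect c u v (2 * a) (b + d * a))"
proof -
  let ?A = "hrect c u v a b \<inter> hrect c' u' v' a' b'" and ?Z = "hrect c' u' v' a' b' \<inter> hrect c u v (2 * a) (b + d * a)"
  have sub: "?A \<subseteq> ?Z" using hrect_mono[of a "2*a" b "b + d * a" c u v] ab by auto
  show ?thesis
  proof (cases "d * a \<le> b")
    case True
    have "area ?A \<le> area ?Z" using sub by (rule area_mono[where c=c' and u=u' and v=v' and a=a' and b=b']) (use o' in auto)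
    then have "area ?A * (2 * (b + d * a)) \<le> area ?Z * (4 * b)"
      by (rule mult_mono) (use True ab in auto)
    also have "\<dots> \<le> 16 * b * area ?Z" using ab by simp
    finally show ?thesis .
  next
    case False
    let ?H = "{x \<in> hrect c u v a b \<inter> hrect c' u' v' a' b'. (x - c') \<bullet> u' \<le> 0}"
    let ?H' = "{x \<in> hrect c u v a b \<inter> hrect c' (- u') v' a' b'. (x - c') \<bullet> (- u') \<le> 0}"
    have 1: "d * a * area ?H \<le> 2 * b * area ?Z" by (rule area_inter_fat_half[OF o o' ab])
    have 2: "d * a * area ?H' \<le> 2 * b * area ?Z"
      using area_inter_fat_half[OF o orthonormal_pair_uminus[OF o'] ab(1-4), of c c' b'] ab(5) by (simp add: hrect_uminus)
    have m: "?H \<in> sets borel" "?H' \<in> sets borel"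
    proof -
      have "{x. (x - c') \<bullet> y \<le> 0} \<in> sets borel" for y
        by (intro borel_closed closed_Collect_le continuous_intros)
      then have "hrect c u v a b \<inter> hrect c' y v' a' b' \<inter> {x. (x - c') \<bullet> y \<le> 0} \<in> sets borel" for y by simp
      moreover have "hrect c u v a b \<inter> hrect c' y v' a' b' \<inter> {x. (x - c') \<bullet> y \<le> 0} = {x \<in> hrect c u v a b \<inter> hrect c' y v' a' b'. (x - c') \<bullet> y \<le> 0}" for y
        by auto
      ultimately have "{x \<in> hrect c u v a b \<inter> hrect c' y v' a' b'. (x - c') \<bullet> y \<le> 0} \<in> sets borel" for y
        by simp
      then show "?H \<in> sets borel" "?H' \<in> sets borel" by blast+
    qed
    have "area ?A \<le> area (?H \<union> ?H')"
      by (rule area_mono[where c=c and u=u and v=v and a=a and b=b]) (use o m in \<open>auto simp: hrect_uminus\<close>)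
    also have "\<dots> \<le> area ?H + area ?H'"
      by (rule measure_Un_le) (use m in auto)
    finally have "(d * a) * area ?A \<le> (d * a) * (area ?H + area ?H')"
      using ab by (intro mult_left_mono) auto
    also have "\<dots> \<le> 4 * b * area ?Z" using 1 2 by (simp add: algebra_simps)
    finally have 3: "(d * a) * area ?A \<le> 4 * b * area ?Z" .
    have "area ?A * (2 * (b + d * a)) \<le> area ?A * (4 * (d * a))"
      using False by (intro mult_left_mono) (simp_all add: not_le mult.commute)
    also have "\<dots> = 4 * ((d * a) * area ?A)" by simp
    also have "\<dots> \<le> 16 * b * area ?Z" using 3 by (simp add: mult_ac)
    finally show ?thesis .
  qed
qed

text \<open>The cross section [lo, hi] of two parallel strips is the same everywhere along u. Hence
  the cross section of the intersection (enclosed in the rectangle around \<open>y1\<close>)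
  reappears at the height of any x in the first rectangle, cut to length 2 b (the rectangle around
  \<open>y2\<close>). A share of the first rectangle thus becomes a comparable share of a ball
  around each of its points.\<close>

lemma area_inter_parallel:
  assumes o: "orthonormal_pair u v" and ab: "0 < b" "b \<le> a" "a \<le> a'" "0 \<le> b'"
    and x: "x \<in> hrect c u v a b"
  shows "b * area (hrect c u v a b \<inter> hrect c' u v a' b') \<le> a * area (hrect c' u v (8 * a') b' \<inter> cball x (3 * b))"
proof (cases "hrect c u v a b \<inter> hrect c' u v a' b' = {}")
  case True
  then show ?thesis using ab by simp
next
  case False
  define lo hi where "lo = max (c \<bullet> v - b) (c' \<bullet> v - b')" and "hi = min (c \<bullet> v + b) (c' \<bullet> v + b')"
  define l m where "l = (hi - lo) / 2" and "m = (hi + lo) / 2"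
  obtain z where z: "z \<in> hrect c u v a b" "z \<in> hrect c' u v a' b'" using False by auto
  have lohi: "lo \<le> hi" using z by (auto simp: lo_def hi_def mem_hrect inner_diff_left)
  have cc: "\<bar>c \<bullet> u - c' \<bullet> u\<bar> \<le> a + a'" using z by (auto simp: mem_hrect inner_diff_left)
  define y1 y2 where "y1 = (c \<bullet> u) *\<^sub>R u + m *\<^sub>R v" and "y2 = (x \<bullet> u) *\<^sub>R u + m *\<^sub>R v"
  have y: "y1 \<bullet> u = c \<bullet> u" "y1 \<bullet> v = m" "y2 \<bullet> u = x \<bullet> u" "y2 \<bullet> v = m"
    by (simp_all add: y1_def y2_def inner_add_left orthonormal_pairD[OF o])
  have "area (hrect c u v a b \<inter> hrect c' u v a' b') \<le> 4 * a * l"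
  proof (rule area_mono_hrect[OF _ _ o])
    show "hrect c u v a b \<inter> hrect c' u v a' b' \<subseteq> hrect y1 u v a l"
      by (auto simp: mem_hrect inner_diff_left y l_def m_def lo_def hi_def abs_le_iff field_simps)
  qed (use ab lohi in \<open>auto simp: l_def\<close>)
  then have "b * area (hrect c u v a b \<inter> hrect c' u v a' b') \<le> b * (4 * a * l)"
    using ab by (intro mult_left_mono) auto
  also have "\<dots> = a * area (hrect y2 u v b l)"
    using ab lohi by (simp add: area_hrect[OF o] l_def)
  also have "\<dots> \<le> a * area (hrect c' u v (8 * a') b' \<inter> cball x (3 * b))"
  proof (intro mult_left_mono area_mono[OF _ _ _ _ o, of _ _ c' "8*a'" b'] subsetI)
    fix p assume p: "p \<in> hrect y2 u v b l"
    have pu: "\<bar>p \<bullet> u - x \<bullet> u\<bar> \<le> b" using p by (auto simp: mem_hrect inner_diff_left y)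
    have pv: "lo \<le> p \<bullet> v" "p \<bullet> v \<le> hi" using p by (auto simp: mem_hrect inner_diff_left y l_def m_def abs_le_iff field_simps)
    have pv': "\<bar>p \<bullet> v - x \<bullet> v\<bar> \<le> 2 * b" using pv x by (auto simp: lo_def hi_def mem_hrect inner_diff_left abs_le_iff)
    have "norm (p - x) \<le> \<bar>(p - x) \<bullet> u\<bar> + \<bar>(p - x) \<bullet> v\<bar>"
      using norm_triangle_ineq[of "((p-x) \<bullet> u) *\<^sub>R u" "((p-x) \<bullet> v) *\<^sub>R v"] orthonormal_expansion[OF o, of "p - x"]
      by (simp add: orthonormal_pairD[OF o])
    then have "p \<in> cball x (3 * b)" using pu pv' by (simp add: dist_norm norm_minus_commute inner_diff_left)
    moreover have "p \<in> hrect c' u v (8 * a') b'"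
      using pu pv x cc ab by (auto simp: mem_hrect inner_diff_left lo_def hi_def abs_le_iff)
    ultimately show "p \<in> hrect c' u v (8 * a') b' \<inter> cball x (3 * b)" by simp
  qed (use ab in auto)
  finally show ?thesis .
qed

text \<open>Double counting over pairs (x, y) with x in the thin rectangle and y in the square of
  half side 2 h around x. Each y in the thick rectangle is seen from a set of x of area at least h
  b, and each x sees w-mass at most 16 h^2 G(x).\<close>

lemma weighted_strip:
  fixes w G :: "real^2 \<Rightarrow> ennreal"
  assumes [measurable]: "w \<in> borel_measurable borel" "G \<in> borel_measurable borel"
    and o: "orthonormal_pair u v" and h: "0 < b" "b \<le> h" "h \<le> 16 * a"
    and G: "\<And>x. (\<integral>\<^sup>+y\<in>hrect x u v (2 * h) (2 * h). w y \<partial>lborel) \<le> ennreal (16 * h\<^sup>2) * G x"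
  shows "ennreal b * (\<integral>\<^sup>+y\<in>hrect c u v (8 * a) h. w y \<partial>lborel)
    \<le> ennreal (16 * h) * (\<integral>\<^sup>+x\<in>hrect c u v (8 * a) b. G x \<partial>lborel)"
proof -
  let ?R = "hrect c u v (8 * a) b" and ?T = "hrect c u v (8 * a) h"
  define D where "D = {(x, y). x \<in> ?R \<and> y \<in> hrect x u v (2 * h) (2 * h)}"
  have "closed D"
    unfolding D_def mem_hrect case_prod_beta
    by (intro closed_Collect_conj closed_Collect_le continuous_intros)
  then have Dm: "D \<in> sets (borel \<Otimes>\<^sub>M borel)" unfolding borel_prod by (rule borel_closed)
  have [measurable]: "(\<lambda>(x, y). indicator D (x, y) * w y) \<in> borel_measurable (lborel \<Otimes>\<^sub>M lborel)"
    using Dm by measurable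
  have "ennreal (h * b) * (\<integral>\<^sup>+y\<in>?T. w y \<partial>lborel) = (\<integral>\<^sup>+y. ennreal (h * b) * (w y * indicator ?T y) \<partial>lborel)"
    by (simp add: nn_integral_cmult)
  also have "\<dots> \<le> (\<integral>\<^sup>+y. (\<integral>\<^sup>+x. indicator D (x, y) * w y \<partial>lborel) \<partial>lborel)"
  proof (intro nn_integral_mono)
    fix y
    show "ennreal (h * b) * (w y * indicator ?T y) \<le> (\<integral>\<^sup>+x. indicator D (x, y) * w y \<partial>lborel)"
    proof (cases "y \<in> ?T")
      case True
      define q where "q = (y - c) \<bullet> u"
      \<comment> \<open>The small rectangle of area h b around z is pushed from y towards the middle
        of the long side. It then stays inside the thin rectangle even if y is close to an end;
        overshooting on the other side is excluded by \<open>h \<le> 16 * a\<close>.\<close>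
      define e :: real where "e = (if q \<ge> 0 then 1 else - 1)"
      define z where "z = c + (q - e * h / 4) *\<^sub>R u"
      have z: "z \<bullet> u = c \<bullet> u + q - e * h / 4" "z \<bullet> v = c \<bullet> v"
        by (simp_all add: z_def inner_add_left orthonormal_pairD[OF o])
      have q: "\<bar>q\<bar> \<le> 8 * a" using True by (auto simp: mem_hrect q_def)
      have yu: "y \<bullet> u = c \<bullet> u + q" by (simp add: q_def inner_diff_left)
      have sub: "hrect z u v (h / 4) b \<subseteq> {x. (x, y) \<in> D}"
      proof
        fix x assume x: "x \<in> hrect z u v (h / 4) b"
        have xu: "\<bar>x \<bullet> u - (c \<bullet> u + q - e * h / 4)\<bar> \<le> h / 4" and xv: "\<bar>x \<bullet> v - c \<bullet> v\<bar> \<le> b"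
          using x by (auto simp: mem_hrect inner_diff_left z)
        have xu': "c \<bullet> u + q - e * h / 4 - h / 4 \<le> x \<bullet> u" "x \<bullet> u \<le> c \<bullet> u + q - e * h / 4 + h / 4"
          using xu unfolding abs_le_iff by linarith+
        have "\<bar>x \<bullet> u - c \<bullet> u\<bar> \<le> 8 * a"
          using xu' q h by (cases "q \<ge> 0") (simp_all add: e_def abs_le_iff)
        moreover have "\<bar>y \<bullet> u - x \<bullet> u\<bar> \<le> 2 * h"
          using xu' h unfolding yu by (cases "q \<ge> 0") (simp_all add: e_def abs_le_iff)
        moreover have "\<bar>y \<bullet> v - x \<bullet> v\<bar> \<le> 2 * h"
          using xv h True by (auto simp: mem_hrect inner_diff_left)
        ultimately show "x \<in> {x. (x, y) \<in> D}"
          using xv by (auto simp: D_def mem_hrect inner_diff_left)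
      qed
      have "ennreal (h * b) * w y = emeasure lborel (hrect z u v (h / 4) b) * w y"
        using h by (simp add: emeasure_hrect[OF o])
      also have "\<dots> = (\<integral>\<^sup>+x. indicator (hrect z u v (h / 4) b) x * w y \<partial>lborel)"
        by (simp add: nn_integral_multc)
      also have "\<dots> \<le> (\<integral>\<^sup>+x. indicator D (x, y) * w y \<partial>lborel)"
        using sub by (intro nn_integral_mono mult_right_mono) (auto simp: indicator_def)
      finally show ?thesis using True by simp
    qed simp
  qed
  also have "\<dots> = (\<integral>\<^sup>+x. (\<integral>\<^sup>+y. indicator D (x, y) * w y \<partial>lborel) \<partial>lborel)"
    by (rule lborel_pair.Fubini') measurable
  also have "\<dots> \<le> (\<integral>\<^sup>+x. ennreal (16 * h\<^sup>2) * (G x * indicator ?R x) \<partial>lborel)"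
  proof (intro nn_integral_mono)
    fix x
    have "(\<integral>\<^sup>+y. indicator D (x, y) * w y \<partial>lborel) = (\<integral>\<^sup>+y. indicator ?R x * (w y * indicator (hrect x u v (2 * h) (2 * h)) y) \<partial>lborel)"
      by (intro nn_integral_cong) (auto simp: D_def indicator_def)
    also have "\<dots> = indicator ?R x * (\<integral>\<^sup>+y\<in>hrect x u v (2 * h) (2 * h). w y \<partial>lborel)"
      by (rule nn_integral_cmult) measurable
    also have "\<dots> \<le> indicator ?R x * (ennreal (16 * h\<^sup>2) * G x)"
      by (intro mult_left_mono G) auto
    finally show "(\<integral>\<^sup>+y. indicator D (x, y) * w y \<partial>lborel) \<le> ennreal (16 * h\<^sup>2) * (G x * indicator ?R x)"
      by (simp add: mult_ac)
  qed
  also have "\<dots> = ennreal (16 * h\<^sup>2) * (\<integral>\<^sup>+x\<in>?R. G x \<partial>lborel)"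
    by (rule nn_integral_cmult) measurable
  finally have "ennreal (1 / h) * (ennreal (h * b) * (\<integral>\<^sup>+y\<in>?T. w y \<partial>lborel))
     \<le> ennreal (1 / h) * (ennreal (16 * h\<^sup>2) * (\<integral>\<^sup>+x\<in>?R. G x \<partial>lborel))"
    by (intro mult_left_mono) auto
  then show ?thesis
    using h by (simp add: mult.assoc[symmetric] ennreal_mult'[symmetric] power2_eq_square)
qed

section \<open>Selection, positive definiteness and covering\<close>

lemma greedy_selection:
  fixes a :: "'i \<Rightarrow> real" and kap :: "'i \<Rightarrow> 'i \<Rightarrow> real" and T :: "'i \<Rightarrow> real"
  assumes "finite I" and sym: "\<And>j k. kap j k = kap k j" and nn: "\<And>j k. 0 \<le> kap j k"
  shows "\<exists>S\<subseteq>I. (\<Sum>j\<in>S. \<Sum>k\<in>S. kap j k) \<le> (\<Sum>j\<in>S. 2 * T j + kap j j)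
     \<and> (\<forall>j\<in>I - S. T j < (\<Sum>k\<in>{k \<in> S. a j \<le> a k}. kap j k))"
  using \<open>finite I\<close>
proof (induction I rule: finite_ranking_induct[where f = "\<lambda>i. - a i"])
  case empty
  then show ?case by auto
next
  case (insert x I)
  then obtain S where S: "S \<subseteq> I" "(\<Sum>j\<in>S. \<Sum>k\<in>S. kap j k) \<le> (\<Sum>j\<in>S. 2 * T j + kap j j)"
    and rej: "\<And>j. j \<in> I - S \<Longrightarrow> T j < (\<Sum>k\<in>{k \<in> S. a j \<le> a k}. kap j k)"
    by blast
  have finS: "finite S" using S(1) insert.hyps(1) finite_subset by auto
  consider "x \<in> S" | "x \<notin> S" "(\<Sum>k\<in>S. kap x k) \<le> T x" | "x \<notin> S" "T x < (\<Sum>k\<in>S. kap x k)"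
    by fastforce
  then show ?case
  proof cases
    case 1
    then have "insert x I = I" using S by auto
    then show ?thesis using S rej by auto
  next
    case 2
    have "(\<Sum>j\<in>insert x S. \<Sum>k\<in>insert x S. kap j k)
        = kap x x + (\<Sum>k\<in>S. kap x k) + (\<Sum>j\<in>S. kap j x) + (\<Sum>j\<in>S. \<Sum>k\<in>S. kap j k)"
      using finS 2(1) by (simp add: sum.distrib)
    also have "(\<Sum>j\<in>S. kap j x) = (\<Sum>k\<in>S. kap x k)" using sym by simp
    finally have "(\<Sum>j\<in>insert x S. \<Sum>k\<in>insert x S. kap j k) \<le> (\<Sum>j\<in>insert x S. 2 * T j + kap j j)"
      using 2 S(2) finS by simp
    moreover have "T j < (\<Sum>k\<in>{k \<in> insert x S. a j \<le> a k}. kap j k)" if "j \<in> insert x I - insert x S" for j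
    proof -
      have "T j < (\<Sum>k\<in>{k \<in> S. a j \<le> a k}. kap j k)" using that rej by auto
      also have "\<dots> \<le> (\<Sum>k\<in>{k \<in> insert x S. a j \<le> a k}. kap j k)"
        using finS nn by (intro sum_mono2) auto
      finally show ?thesis .
    qed
    ultimately show ?thesis using S(1) by (intro exI[of _ "insert x S"]) auto
  next
    case 3
    have "{k \<in> S. a x \<le> a k} = S" using S(1) insert.hyps(2) by force
    then show ?thesis using 3 S rej by (intro exI[of _ S]) auto
  qed
qed

section \<open>Cauchy-Schwarz for sums of indicators\<close>

lemma integral_sum_indicator_prod:
  fixes x :: "'i \<Rightarrow> real" and y :: "'j \<Rightarrow> real"
  assumes "finite J" "finite K"
    and S: "\<And>j. j \<in> J \<Longrightarrow> S j \<in> fmeasurable M" and T: "\<And>k. k \<in> K \<Longrightarrow> T k \<in> fmeasurable M"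
  shows "has_bochner_integral M (\<lambda>p. (\<Sum>j\<in>J. x j * indicator (S j) p) * (\<Sum>k\<in>K. y k * indicator (T k) p))
    (\<Sum>j\<in>J. \<Sum>k\<in>K. x j * y k * measure M (S j \<inter> T k))"
proof -
  have "has_bochner_integral M (\<lambda>p. \<Sum>j\<in>J. \<Sum>k\<in>K. x j * y k * indicator (S j \<inter> T k) p)
    (\<Sum>j\<in>J. \<Sum>k\<in>K. x j * y k * measure M (S j \<inter> T k))"
  proof (intro has_bochner_integral_sum)
    fix j k assume jk: "j \<in> J" "k \<in> K"
    have "S j \<inter> T k \<in> fmeasurable M" using S[OF jk(1)] T[OF jk(2)] by (simp add: fmeasurable_Int_fmeasurable fmeasurableD)
    then have "has_bochner_integral M (indicator (S j \<inter> T k)) (measure M (S j \<inter> T k))"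
      by (intro has_bochner_integral_real_indicator) (auto simp: fmeasurable_def)
    then show "has_bochner_integral M (\<lambda>p. x j * y k * indicator (S j \<inter> T k) p) (x j * y k * measure M (S j \<inter> T k))"
      by (intro has_bochner_integral_mult_right) auto
  qed
  then show ?thesis
    by (simp add: sum_product indicator_inter_arith mult_ac)
qed

text \<open>Cauchy-Schwarz with a free parameter, from 2 f g \<le> lam g^2 + f^2 / lam. A suitable
  \<open>lam\<close> later allows one of the two forms to be absorbed, without square roots.\<close>

lemma sum_indicator_amgm:
  fixes x :: "'i \<Rightarrow> real" and y :: "'j \<Rightarrow> real"
  assumes fin: "finite J" "finite K" and lam: "0 < lam"
    and S: "\<And>j. j \<in> J \<Longrightarrow> S j \<in> fmeasurable M" and T: "\<And>k. k \<in> K \<Longrightarrow> T k \<in> fmeasurable M"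
  shows "2 * (\<Sum>j\<in>J. \<Sum>k\<in>K. x j * y k * measure M (S j \<inter> T k))
     \<le> lam * (\<Sum>j\<in>K. \<Sum>k\<in>K. y j * y k * measure M (T j \<inter> T k))
       + (\<Sum>j\<in>J. \<Sum>k\<in>J. x j * x k * measure M (S j \<inter> S k)) / lam"
proof -
  let ?f = "\<lambda>p. \<Sum>j\<in>J. x j * indicator (S j) p" and ?g = "\<lambda>p. \<Sum>k\<in>K. y k * indicator (T k) p"
  note fg = integral_sum_indicator_prod[OF fin S T, where x=x and y=y]
  note gg = integral_sum_indicator_prod[OF fin(2) fin(2) T T, where x=y and y=y]
  note ff = integral_sum_indicator_prod[OF fin(1) fin(1) S S, where x=x and y=x]
  have "(\<integral>p. 2 * (?f p * ?g p) \<partial>M) \<le> (\<integral>p. lam * (?g p * ?g p) + (?f p * ?f p) / lam \<partial>M)"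
  proof (rule integral_mono)
    have "2 * (f * g) \<le> lam * (g * g) + (f * f) / lam" for f g :: real
    proof -
      have "lam * (g * g) + (f * f) / lam - 2 * (f * g) = (lam * g - f)\<^sup>2 / lam"
        using lam by (simp add: power2_eq_square field_simps)
      also have "\<dots> \<ge> 0" using lam by simp
      finally show ?thesis by simp
    qed
    then show "2 * (?f p * ?g p) \<le> lam * (?g p * ?g p) + (?f p * ?f p) / lam" for p .
  qed (use fg gg ff in \<open>auto intro!: Bochner_Integration.integrable_add integrable_mult_right simp: has_bochner_integral_iff\<close>)
  then show ?thesis
    using fg gg ff by (simp add: has_bochner_integral_iff)
qed

text \<open>The kernel \<open>min s t\<close> is positive definite because it is the length of \<open>{0..s} \<inter> {0..t}\<close>.\<close>
lemma min_kernel_amgm: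
  fixes x :: "'i \<Rightarrow> real" and y :: "'j \<Rightarrow> real" and A :: "'i \<Rightarrow> (real^2) set" and B :: "'j \<Rightarrow> (real^2) set"
  assumes fin: "finite J" "finite K" and lam: "0 < lam"
    and A: "\<And>j. j \<in> J \<Longrightarrow> A j \<in> fmeasurable lborel" and B: "\<And>k. k \<in> K \<Longrightarrow> B k \<in> fmeasurable lborel"
    and s: "\<And>j. j \<in> J \<Longrightarrow> 0 \<le> s j" and t: "\<And>k. k \<in> K \<Longrightarrow> 0 \<le> t k"
  shows "2 * (\<Sum>j\<in>J. \<Sum>k\<in>K. x j * y k * (min (s j) (t k) * area (A j \<inter> B k)))
     \<le> lam * (\<Sum>j\<in>K. \<Sum>k\<in>K. y j * y k * (min (t j) (t k) * area (B j \<inter> B k)))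
       + (\<Sum>j\<in>J. \<Sum>k\<in>J. x j * x k * (min (s j) (s k) * area (A j \<inter> A k))) / lam"
proof -
  let ?M = "lborel \<Otimes>\<^sub>M lborel :: ((real^2) \<times> real) measure"
  have m: "measure ?M (X \<times> {0..p} \<inter> Y \<times> {0..q}) = min p q * area (X \<inter> Y)"
    if "X \<in> fmeasurable lborel" "Y \<in> fmeasurable lborel" "0 \<le> p" "0 \<le> q" for X Y and p q :: real
  proof -
    have eq: "X \<times> {0..p} \<inter> Y \<times> {0..q} = (X \<inter> Y) \<times> {0..min p q}" by auto
    have XY: "X \<inter> Y \<in> fmeasurable lborel"
      by (rule fmeasurable_Int_fmeasurable) (use that in \<open>auto simp: fmeasurable_def\<close>)
    have "emeasure ?M ((X \<inter> Y) \<times> {0..min p q}) = emeasure lborel (X \<inter> Y) * emeasure lborel {0..min p q}"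
      by (rule lborel.emeasure_pair_measure_Times) (use XY in \<open>auto simp: fmeasurable_def\<close>)
    also have "\<dots> = ennreal (area (X \<inter> Y)) * ennreal (min p q)"
      using that XY by (simp add: emeasure_eq_measure2)
    also have "\<dots> = ennreal (min p q * area (X \<inter> Y))"
      using that by (subst ennreal_mult[symmetric]) (auto simp: mult.commute)
    finally show ?thesis using that by (simp add: eq measure_def)
  qed
  have f: "X \<times> {0..p} \<in> fmeasurable ?M" if "X \<in> fmeasurable lborel" for X :: "(real^2) set" and p :: real
  proof -
    have "emeasure ?M (X \<times> {0..p}) = emeasure lborel X * emeasure lborel {0..p}"
      by (rule lborel.emeasure_pair_measure_Times) (use that in \<open>auto simp: fmeasurable_def\<close>)
    also have "emeasure lborel {0..p} = ennreal (max 0 p)" by (cases "0 \<le> p") (auto simp: max_def)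
    also have "emeasure lborel X * \<dots> < \<infinity>" using that by (auto simp: fmeasurable_def ennreal_mult_less_top)
    finally show ?thesis using that by (auto simp: fmeasurable_def intro!: pair_measureI)
  qed
  show ?thesis
    using sum_indicator_amgm[OF fin lam, where S="\<lambda>j. A j \<times> {0..s j}" and M="?M" and T="\<lambda>k. B k \<times> {0..t k}" and x=x and y=y]
      f A B m s t by simp
qed

section \<open>Disjoint pieces and Vitali coverings\<close>

lemma disjoint_refinement:
  fixes R :: "'i \<Rightarrow> 'a set"
  assumes "finite J" "\<And>j. j \<in> J \<Longrightarrow> R j \<in> sets M"
  shows "\<exists>E. (\<forall>j\<in>J. E j \<subseteq> R j \<and> E j \<in> sets M) \<and> disjoint_family_on E J \<and> (\<Union>j\<in>J. E j) = (\<Union>j\<in>J. R j)"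
  using assms
proof (induction J)
  case empty
  then show ?case by (auto simp: disjoint_family_on_def)
next
  case (insert x J)
  then obtain E where E: "\<forall>j\<in>J. E j \<subseteq> R j \<and> E j \<in> sets M" "disjoint_family_on E J" "(\<Union>j\<in>J. E j) = (\<Union>j\<in>J. R j)"
    by auto
  let ?E = "E(x := R x - (\<Union>j\<in>J. R j))"
  have "(\<Union>j\<in>J. R j) \<in> sets M" using insert by (intro sets.finite_UN) auto
  then have "\<forall>j\<in>insert x J. ?E j \<subseteq> R j \<and> ?E j \<in> sets M" using E insert.prems insert.hyps by auto
  moreover have "disjoint_family_on ?E (insert x J)"
    using E insert.hyps unfolding disjoint_family_on_def by auto
  moreover have eq: "(\<Union>j\<in>J. ?E j) = (\<Union>j\<in>J. E j)" using insert.hyps by (intro SUP_cong) auto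
  have "(\<Union>j\<in>insert x J. ?E j) = (\<Union>j\<in>insert x J. R j)"
    unfolding UN_insert eq E(3) by auto
  ultimately show ?case by blast
qed

text \<open>The dilated balls are measured by \<mu> and the disjoint ones by \<nu>; hypothesis
  \<open>b\<close> takes the place of a doubling property. The common bound B on the radii is what
  the covering lemma asks for.\<close>

lemma vitali_measure_bound:
  fixes \<mu> \<nu> :: "('a::euclidean_space) measure"
  assumes sets: "sets \<mu> = sets borel" "sets \<nu> = sets borel" and E: "E \<in> sets borel"
    and r: "\<And>x. x \<in> E \<Longrightarrow> 0 < r x \<and> r x \<le> B"
    and b: "\<And>x. x \<in> E \<Longrightarrow> emeasure \<mu> (cball x (5 * r x)) \<le> c * emeasure \<nu> (cball x (r x))"
  shows "emeasure \<mu> E \<le> c * emeasure \<nu> UNIV"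
proof -
  have cov: "E \<subseteq> (\<Union>x\<in>E. cball x (r x))" using r by force
  obtain C where C: "countable C" "C \<subseteq> E"
    "pairwise (\<lambda>i j. disjnt (cball i (r i)) (cball j (r j))) C" "E \<subseteq> (\<Union>i\<in>C. cball i (5 * r i))"
    by (rule Vitali_covering_lemma_cballs[OF cov r])
  have cb: "cball x \<rho> \<in> sets \<mu>" "cball x \<rho> \<in> sets \<nu>" for x \<rho> using sets by auto
  have disj: "disjoint_family_on (\<lambda>i. cball i (r i)) C"
    using C(3) unfolding disjoint_family_on_def pairwise_def disjnt_def by auto
  have "emeasure \<mu> E \<le> emeasure \<mu> (\<Union>i\<in>C. cball i (5 * r i))"
    using C cb by (intro emeasure_mono sets.countable_UN'') auto
  also have "\<dots> \<le> (\<integral>\<^sup>+i. emeasure \<mu> (cball i (5 * r i)) \<partial>count_space C)"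
  proof -
    have m: "(\<Union>i\<in>C. cball i (5 * r i)) \<in> sets \<mu>"
      using C cb by (intro sets.countable_UN'') auto
    have "emeasure \<mu> (\<Union>i\<in>C. cball i (5 * r i)) = (\<integral>\<^sup>+x. indicator (\<Union>i\<in>C. cball i (5 * r i)) x \<partial>\<mu>)"
      using m by simp
    also have "\<dots> \<le> (\<integral>\<^sup>+x. (\<integral>\<^sup>+i. indicator (cball i (5 * r i)) x \<partial>count_space C) \<partial>\<mu>)"
    proof (intro nn_integral_mono)
      fix x
      show "indicator (\<Union>i\<in>C. cball i (5 * r i)) x \<le> (\<integral>\<^sup>+i. (indicator (cball i (5 * r i)) x :: ennreal) \<partial>count_space C)"
      proof (cases "x \<in> (\<Union>i\<in>C. cball i (5 * r i))")
        case True
        then obtain i where i: "i \<in> C" "x \<in> cball i (5 * r i)" by blast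
        have "(indicator (cball i (5 * r i)) x :: ennreal) \<le> (\<integral>\<^sup>+i. indicator (cball i (5 * r i)) x \<partial>count_space C)"
          using i(1) by (rule nn_integral_ge_point)
        then show ?thesis using i by (simp add: indicator_def)
      qed simp
    qed
    also have "\<dots> = (\<integral>\<^sup>+i. (\<integral>\<^sup>+x. indicator (cball i (5 * r i)) x \<partial>\<mu>) \<partial>count_space C)"
      using C cb by (intro nn_integral_count_space_nn_integral) auto
    also have "\<dots> = (\<integral>\<^sup>+i. emeasure \<mu> (cball i (5 * r i)) \<partial>count_space C)"
      using cb by simp
    finally show ?thesis .
  qed
  also have "\<dots> \<le> (\<integral>\<^sup>+i. c * emeasure \<nu> (cball i (r i)) \<partial>count_space C)"
    using C b by (intro nn_integral_mono) auto
  also have "\<dots> = c * (\<integral>\<^sup>+i. emeasure \<nu> (cball i (r i)) \<partial>count_space C)"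
    by (rule nn_integral_cmult) auto
  also have "(\<integral>\<^sup>+i. emeasure \<nu> (cball i (r i)) \<partial>count_space C) = emeasure \<nu> (\<Union>i\<in>C. cball i (r i))"
    using C cb disj by (intro emeasure_UN_countable[symmetric]) auto
  also have "c * \<dots> \<le> c * emeasure \<nu> UNIV"
    using emeasure_space[of \<nu> "\<Union>i\<in>C. cball i (r i)"] sets_eq_imp_space_eq[OF sets(2)]
    by (intro mult_left_mono) auto
  finally show ?thesis .
qed

section \<open>Finite families of rectangles\<close>

text \<open>In the plane, u determines v up to sign, and signs do not change a centred
  rectangle.\<close>

lemma hrect_parallel:
  assumes o: "orthonormal_pair u v" and o': "orthonormal_pair u' v'" and p: "u' = u \<or> u' = - u"
  shows "hrect c u' v' a b = hrect c u v a b"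
proof -
  have "\<bar>x \<bullet> v'\<bar> = \<bar>x \<bullet> v\<bar>" for x
  proof -
    have "(x \<bullet> u')\<^sup>2 = (x \<bullet> u)\<^sup>2" using p by auto
    then have "(x \<bullet> v')\<^sup>2 = (x \<bullet> v)\<^sup>2" using orthonormal_norm[OF o, of x] orthonormal_norm[OF o', of x] by linarith
    then show ?thesis by (simp add: power2_eq_iff abs_eq_iff)
  qed
  moreover have "\<bar>x \<bullet> u'\<bar> = \<bar>x \<bullet> u\<bar>" for x using p by auto
  ultimately show ?thesis by (simp add: hrect_def)
qed

lemma cball_subset_hrect:
  assumes o: "orthonormal_pair u v"
  shows "cball x r \<subseteq> hrect x u v r r"
proof
  fix y assume "y \<in> cball x r"
  then have "norm (y - x) \<le> r" by (simp add: dist_norm norm_minus_commute)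
  then show "y \<in> hrect x u v r r"
    using Cauchy_Schwarz_ineq2[of "y - x" u] Cauchy_Schwarz_ineq2[of "y - x" v]
    by (auto simp: mem_hrect orthonormal_pairD[OF o])
qed

lemma dyadic_scale:
  fixes x :: real
  assumes "1 \<le> x" "x \<le> 2 ^ n"
  shows "\<exists>m\<le>n. 2 ^ m \<le> x \<and> x < 2 ^ Suc m"
  using assms
proof (induction n)
  case (Suc n)
  show ?case
  proof (cases "x \<le> 2 ^ n")
    case True
    then show ?thesis using Suc by (meson le_SucI)
  next
    case False
    show ?thesis
    proof (cases "x = 2 ^ Suc n")
      case True
      then show ?thesis by (intro exI[of _ "Suc n"]) simp
    next
      case 2: False
      then show ?thesis using False Suc.prems by (intro exI[of _ n]) auto
    qed
  qed
qed auto

lemma ennreal_cancel_left: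
  assumes "0 < k" "ennreal k * A \<le> ennreal k * B"
  shows "A \<le> B"
proof -
  have "ennreal (1 / k) * (ennreal k * A) \<le> ennreal (1 / k) * (ennreal k * B)"
    using assms(2) by (rule mult_left_mono) auto
  moreover have "ennreal (1 / k) * ennreal k = 1"
    using assms(1) by (subst ennreal_mult[symmetric]) auto
  ultimately show ?thesis by (simp add: mult.assoc[symmetric])
qed

lemma sum_UN_le:
  fixes f :: "'a \<Rightarrow> real"
  assumes "finite M" "\<And>m. m \<in> M \<Longrightarrow> finite (D m)" "\<And>m x. m \<in> M \<Longrightarrow> x \<in> D m \<Longrightarrow> 0 \<le> f x"
  shows "sum f (\<Union>m\<in>M. D m) \<le> (\<Sum>m\<in>M. sum f (D m))"
  using assms
proof (induction M)
  case (insert m M)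
  have "sum f (D m \<union> (\<Union>m\<in>M. D m)) + sum f (D m \<inter> (\<Union>m\<in>M. D m)) = sum f (D m) + sum f (\<Union>m\<in>M. D m)"
    using insert by (intro sum.union_inter) auto
  moreover have "0 \<le> sum f (D m \<inter> (\<Union>m\<in>M. D m))" using insert by (intro sum_nonneg) auto
  moreover have "sum f (\<Union>m\<in>M. D m) \<le> (\<Sum>m\<in>M. sum f (D m))"
    by (rule insert.IH) (use insert.prems in auto)
  ultimately show ?case using insert.hyps by simp
qed simp

text \<open>\<open>G\<close> stands for the Hardy-Littlewood maximal function of w and enters only
  through \<open>cube\<close>, so Borel versions can be used. \<open>V i\<close> is the average of G
  over the eightfold lengthening of the i-th rectangle. \<open>separated\<close> is the dichotomy of
  directions, later applied with d = 1/N. \<open>n\<close> counts dyadic scales: widths occurring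
  around a fattened rectangle differ from its own width by a factor of at most 8 / d.\<close>

locale rectangle_family =
  fixes I :: "'i set" and c u v :: "'i \<Rightarrow> real^2" and a b V :: "'i \<Rightarrow> real"
    and w G :: "real^2 \<Rightarrow> ennreal" and d :: real and n :: nat
  assumes fin: "finite I"
    and w_borel [measurable]: "w \<in> borel_measurable borel"
    and G_borel [measurable]: "G \<in> borel_measurable borel"
    and on: "\<And>i. i \<in> I \<Longrightarrow> orthonormal_pair (u i) (v i)"
    and b_pos: "\<And>i. i \<in> I \<Longrightarrow> 0 < b i" and b_le_a: "\<And>i. i \<in> I \<Longrightarrow> b i \<le> a i"
    and V_nonneg: "\<And>i. i \<in> I \<Longrightarrow> 0 \<le> V i"
    and separated: "\<And>i k. i \<in> I \<Longrightarrow> k \<in> I \<Longrightarrow> u k = u i \<or> u k = - u i \<or> d \<le> \<bar>u k \<bullet> v i\<bar>"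
    and d_pos: "0 < d" and d_le: "d \<le> 1 / 10" and n: "8 / d \<le> 2 ^ n"
    and cube: "\<And>x y p q r. orthonormal_pair p q \<Longrightarrow> 0 < r \<Longrightarrow> y \<in> hrect x p q r r \<Longrightarrow>
      (\<integral>\<^sup>+z\<in>hrect x p q r r. w z \<partial>lborel) \<le> ennreal (4 * r\<^sup>2) * G y"
    and V: "\<And>i. i \<in> I \<Longrightarrow>
      (\<integral>\<^sup>+x\<in>hrect (c i) (u i) (v i) (8 * a i) (b i). G x \<partial>lborel) = ennreal (32 * a i * b i * V i)"
begin

section \<open>Weighted measure of the rectangles of the family\<close>

definition "wM = density lborel w"

lemma sets_wM [simp]: "sets wM = sets borel"
  by (simp add: wM_def)

lemma emeasure_wM: "A \<in> sets borel \<Longrightarrow> emeasure wM A = (\<integral>\<^sup>+x\<in>A. w x \<partial>lborel)"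
  by (simp add: wM_def emeasure_density)

abbreviation "R i \<equiv> hrect (c i) (u i) (v i) (a i) (b i)"
definition "B i = b i + d * a i"
abbreviation "P i \<equiv> hrect (c i) (u i) (v i) (2 * a i) (B i)"
abbreviation "L \<equiv> real (Suc n)"

lemma a_pos: "i \<in> I \<Longrightarrow> 0 < a i"
  using b_pos b_le_a by fastforce

lemma B_bounds:
  assumes "i \<in> I"
  shows "b i \<le> B i" "0 < B i" "B i \<le> 11 / 10 * a i" "d * a i \<le> B i"
proof -
  have "0 \<le> d * a i" using d_pos a_pos[OF assms] by simp
  then show "b i \<le> B i" "0 < B i" "d * a i \<le> B i" using b_pos[OF assms] by (auto simp: B_def)
  have "d * a i \<le> 1 / 10 * a i" using d_le a_pos[OF assms] by (intro mult_right_mono) auto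
  then show "B i \<le> 11 / 10 * a i" using b_le_a[OF assms] by (simp add: B_def)
qed

lemma area_R: "i \<in> I \<Longrightarrow> area (R i) = 4 * a i * b i"
  using a_pos b_pos by (intro area_hrect on) (auto simp: less_imp_le)

lemma area_P: "i \<in> I \<Longrightarrow> area (P i) = 8 * a i * B i"
  using a_pos[of i] B_bounds[of i] on[of i] by (simp add: area_hrect)

text \<open>The case h = b i controls the rectangle itself; larger h are needed for the dyadic
  strips around it. The constant is 16 * 32, where 32 comes from the normalisation of V.\<close>

lemma strip:
  assumes i: "i \<in> I" and h: "b i \<le> h" "h \<le> 16 * a i"
  shows "emeasure wM (hrect (c i) (u i) (v i) (8 * a i) h) \<le> ennreal (512 * h * a i * V i)"
proof -
  have h0: "0 < h" using b_pos[OF i] h by simp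
  have "ennreal (b i) * (\<integral>\<^sup>+y\<in>hrect (c i) (u i) (v i) (8 * a i) h. w y \<partial>lborel)
    \<le> ennreal (16 * h) * (\<integral>\<^sup>+x\<in>hrect (c i) (u i) (v i) (8 * a i) (b i). G x \<partial>lborel)"
  proof (rule weighted_strip[OF w_borel G_borel on[OF i] b_pos[OF i] h])
    fix x
    show "(\<integral>\<^sup>+y\<in>hrect x (u i) (v i) (2 * h) (2 * h). w y \<partial>lborel) \<le> ennreal (16 * h\<^sup>2) * G x"
      using cube[OF on[OF i], of "2 * h" x x] h0 by (simp add: mem_hrect power2_eq_square)
  qed
  also have "\<dots> = ennreal (16 * h) * ennreal (32 * a i * b i * V i)" by (simp add: V[OF i])
  also have "\<dots> = ennreal (b i) * ennreal (512 * h * a i * V i)"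
    using h0 a_pos[OF i] b_pos[OF i] V_nonneg[OF i]
    by (subst (1 2) ennreal_mult[symmetric]) (auto simp: mult_ac)
  finally show ?thesis
    using ennreal_cancel_left[OF b_pos[OF i]] by (simp add: emeasure_wM)
qed

lemma emeasure_R:
  assumes i: "i \<in> I"
  shows "emeasure wM (R i) \<le> ennreal (128 * (V i * area (R i)))"
proof -
  have "emeasure wM (R i) \<le> emeasure wM (hrect (c i) (u i) (v i) (8 * a i) (b i))"
    using a_pos[OF i] by (intro emeasure_mono hrect_mono) auto
  also have "\<dots> \<le> ennreal (512 * b i * a i * V i)"
    using b_le_a[OF i] a_pos[OF i] by (intro strip i) auto
  finally show ?thesis by (simp add: area_R[OF i] mult_ac)
qed

lemma emeasure_R_finite:
  assumes "i \<in> I" "E \<subseteq> R i"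
  shows "emeasure wM E < \<infinity>"
proof -
  have "emeasure wM E \<le> emeasure wM (R i)" using assms by (intro emeasure_mono) auto
  also have "\<dots> < \<infinity>" using emeasure_R[OF assms(1)] by (simp add: order_le_less_trans)
  finally show ?thesis .
qed

section \<open>Overlaps of the fattened rectangles\<close>

lemma sum_measure_le:
  assumes J: "J \<subseteq> I" and E: "\<And>j. j \<in> J \<Longrightarrow> E j \<subseteq> R j \<and> E j \<in> sets borel" and disj: "disjoint_family_on E J"
    and F: "(\<Union>j\<in>J. E j) \<subseteq> F" "F \<in> sets borel" and F_le: "emeasure wM F \<le> ennreal k" "0 \<le> k"
  shows "(\<Sum>j\<in>J. measure wM (E j)) \<le> k"
proof -
  have fJ: "finite J" using J fin finite_subset by auto
  have "emeasure wM (E j) = ennreal (measure wM (E j))" if "j \<in> J" for j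
    using emeasure_R_finite[of j "E j"] J E that by (intro emeasure_eq_ennreal_measure) (auto simp: less_top)
  then have "ennreal (\<Sum>j\<in>J. measure wM (E j)) = (\<Sum>j\<in>J. emeasure wM (E j))"
    by simp
  also have "\<dots> = emeasure wM (\<Union>j\<in>J. E j)"
    using E disj fJ by (intro sum_emeasure) auto
  also have "\<dots> \<le> emeasure wM F" using F by (intro emeasure_mono) auto
  also have "\<dots> \<le> ennreal k" by (rule F_le)
  finally show ?thesis using F_le(2) by (simp add: ennreal_le_iff)
qed

text \<open>Sort the j by the dyadic size of H j / B k. At scale 2^m the share of P k in P j is
  O(2^-m), while the disjoint pieces E j lie in a strip around P k of half width O(2^m B k), whose
  w-measure is O(2^m V k |P k|). Each scale therefore contributes O(V k |P k|), and fattening limits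
  the number of scales to L.\<close>

lemma fat_column:
  assumes J: "J \<subseteq> I" and E: "\<And>j. j \<in> J \<Longrightarrow> E j \<subseteq> R j \<and> E j \<in> sets borel" and disj: "disjoint_family_on E J"
    and k: "k \<in> I"
  shows "(\<Sum>j\<in>{j \<in> J. a j \<le> a k}. measure wM (E j) * (area (P j \<inter> P k) / area (P j)))
    \<le> 1664 * L * (V k * area (P k))"
proof -
  define q where "q j = a j * \<bar>u j \<bullet> v k\<bar>" for j
  \<comment> \<open>\<open>H j\<close> is the bracket of \<open>area_inter_le\<close> for the pair P
    j, P k. It also bounds the distance across v k from the centre of P k to any point of E j,
    because 3 q j + b j + B j is at most 4 q j + 2 B j. Along u k the distance is at most (2 + 3 + 1
    + 11/10) a k, which explains the factor 8.\<close>
  define H where "H j = B k + 2 * (2 * q j + B j)" for j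
  define Jk where "Jk = {j \<in> J. a j \<le> a k \<and> P j \<inter> P k \<noteq> {}}"
  define D where "D m = {j \<in> Jk. 2 ^ m * B k \<le> H j \<and> H j < 2 ^ Suc m * B k}" for m :: nat
  have fJ: "finite J" using J fin finite_subset by auto
  have fD: "finite (D m)" and DJ: "D m \<subseteq> J" for m using fJ by (auto simp: D_def Jk_def)
  have Hb: "B k \<le> H j" "H j \<le> 73 / 10 * a k" if "j \<in> Jk" for j
  proof -
    have j: "j \<in> I" "a j \<le> a k" using that J by (auto simp: Jk_def)
    have s: "q j \<le> a j" "0 \<le> q j"
      unfolding q_def using orthonormal_abs_inner_le[OF on[OF j(1)] on[OF k]] a_pos[OF j(1)] by (auto intro!: mult_left_le)
    show "B k \<le> H j" unfolding H_def using s B_bounds(2)[OF j(1)] by argo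
    show "H j \<le> 73 / 10 * a k" unfolding H_def using s B_bounds(3)[OF j(1)] B_bounds(3)[OF k] j(2) by argo
  qed
  have point: "E j \<subseteq> hrect (c k) (u k) (v k) (8 * a k) (H j)" if "j \<in> Jk" for j
  proof
    fix x assume "x \<in> E j"
    have j: "j \<in> I" "a j \<le> a k" using that J by (auto simp: Jk_def)
    then have x: "x \<in> R j" using \<open>x \<in> E j\<close> E that by (auto simp: Jk_def)
    have "P j \<inter> P k \<noteq> {}" using that by (simp add: Jk_def)
    then obtain z where z: "z \<in> P j" "z \<in> P k" by blast
    have "0 \<le> q j" using a_pos[OF j(1)] by (simp add: q_def)
    moreover have "\<bar>(x - c k) \<bullet> v k\<bar> \<le> B k + (3 * q j + (b j + B j))"
      using hrect_point_bounds(1)[OF on[OF j(1)] on[OF k] x z] by (simp add: q_def)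
    moreover have "\<bar>(x - c k) \<bullet> u k\<bar> \<le> 2 * a k + ((a j + 2 * a j) + (b j + B j))"
      using hrect_point_bounds(2)[OF on[OF j(1)] on[OF k] x z] .
    ultimately show "x \<in> hrect (c k) (u k) (v k) (8 * a k) (H j)"
      using B_bounds(1-3)[OF j(1)] B_bounds(1-3)[OF k] j b_le_a[OF j(1)] a_pos[OF k]
      unfolding mem_hrect H_def by argo
  qed
  have term_le: "measure wM (E j) * (area (P j \<inter> P k) / area (P j)) \<le> measure wM (E j) * (13 * B k / H j)" if "j \<in> Jk" for j
  proof -
    have j: "j \<in> I" "a j \<le> a k" using that J by (auto simp: Jk_def)
    have "area (P j \<inter> P k) * (B k + 2 * ((2 * a j) * \<bar>u j \<bullet> v k\<bar> + B j)) \<le> 13 * B k * (4 * (2 * a j) * B j)"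
      by (rule area_inter_le[OF on[OF j(1)] on[OF k]]) (use B_bounds[OF j(1)] B_bounds[OF k] a_pos[OF j(1)] in auto)
    then have "area (P j \<inter> P k) * H j \<le> 13 * B k * area (P j)"
      using area_P[OF j(1)] by (simp add: H_def q_def mult_ac)
    moreover have "0 < area (P j)" using area_P[OF j(1)] a_pos[OF j(1)] B_bounds[OF j(1)] by simp
    moreover have "0 < H j" using Hb[OF that] B_bounds(2)[OF k] by linarith
    ultimately have "area (P j \<inter> P k) / area (P j) \<le> 13 * B k / H j" by (simp add: field_simps)
    then show ?thesis by (intro mult_left_mono) auto
  qed
  have scale: "(\<Sum>j\<in>D m. measure wM (E j) * (13 * B k / H j)) \<le> 1664 * (V k * area (P k))" for m
  proof (cases "D m = {}")
    case True
    then show ?thesis using V_nonneg[OF k] by simp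
  next
    case False
    then obtain j0 where j0: "j0 \<in> D m" by blast
    define p where "p = 2 ^ m * B k"
    let ?h = "2 * p"
    have Dp: "p \<le> H j" "H j \<le> ?h" "j \<in> Jk" if "j \<in> D m" for j
      using that by (auto simp: D_def p_def mult.assoc less_imp_le)
    \<comment> \<open>The scale is nonempty, so its strip has half width at most 2 * 73/10 times a
      k, within the range up to 16 a k that \<open>strip\<close> permits.\<close>
    have "p \<le> 73 / 10 * a k" using Dp[OF j0] Hb(2)[of j0] by linarith
    then have h: "?h \<le> 16 * a k" using a_pos[OF k] by linarith
    have "1 * B k \<le> p" unfolding p_def using B_bounds[OF k] by (intro mult_right_mono) auto
    then have bh: "b k \<le> ?h" and p0: "0 < p" using B_bounds(1,2)[OF k] by linarith+
    have "(\<Sum>j\<in>D m. measure wM (E j) * (13 * B k / H j)) \<le> (\<Sum>j\<in>D m. measure wM (E j) * (13 / 2 ^ m))"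
    proof (intro sum_mono mult_left_mono)
      fix j assume "j \<in> D m"
      have "13 * B k / H j \<le> 13 * B k / p"
        using Dp(1)[OF \<open>j \<in> D m\<close>] p0 B_bounds(2)[OF k] by (intro divide_left_mono mult_pos_pos) auto
      also have "\<dots> = 13 / 2 ^ m" using B_bounds(2)[OF k] by (simp add: p_def)
      finally show "13 * B k / H j \<le> 13 / 2 ^ m" .
    qed auto
    also have "\<dots> = (\<Sum>j\<in>D m. measure wM (E j)) * (13 / 2 ^ m)" by (rule sum_distrib_right[symmetric])
    also have "\<dots> \<le> (512 * ?h * a k * V k) * (13 / 2 ^ m)"
    proof (intro mult_right_mono)
      show "(\<Sum>j\<in>D m. measure wM (E j)) \<le> 512 * ?h * a k * V k"
      proof (rule sum_measure_le)
        show "D m \<subseteq> I" using DJ J by blast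
        show "disjoint_family_on E (D m)" using disj DJ by (rule disjoint_family_on_mono[rotated])
        show "(\<Union>j\<in>D m. E j) \<subseteq> hrect (c k) (u k) (v k) (8 * a k) ?h"
        proof (rule UN_least)
          fix j assume j: "j \<in> D m"
          then have "E j \<subseteq> hrect (c k) (u k) (v k) (8 * a k) (H j)" by (intro point Dp(3))
          also have "\<dots> \<subseteq> hrect (c k) (u k) (v k) (8 * a k) ?h" using Dp(2)[OF j] by (intro hrect_mono) auto
          finally show "E j \<subseteq> hrect (c k) (u k) (v k) (8 * a k) ?h" .
        qed
        show "emeasure wM (hrect (c k) (u k) (v k) (8 * a k) ?h) \<le> ennreal (512 * ?h * a k * V k)"
          by (rule strip[OF k bh h])
        show "0 \<le> 512 * ?h * a k * V k" using p0 a_pos[OF k] V_nonneg[OF k] by simp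
      qed (use E DJ in auto)
    qed simp
    also have "\<dots> = 1664 * (V k * area (P k))" unfolding area_P[OF k] p_def by (simp add: field_simps)
    finally show ?thesis .
  qed
  have "(\<Sum>j\<in>{j \<in> J. a j \<le> a k}. measure wM (E j) * (area (P j \<inter> P k) / area (P j)))
     = (\<Sum>j\<in>Jk. measure wM (E j) * (area (P j \<inter> P k) / area (P j)))"
    using fJ by (intro sum.mono_neutral_right) (auto simp: Jk_def)
  also have "\<dots> \<le> (\<Sum>j\<in>Jk. measure wM (E j) * (13 * B k / H j))"
    by (intro sum_mono term_le)
  also have "\<dots> \<le> (\<Sum>j\<in>(\<Union>m\<in>{..n}. D m). measure wM (E j) * (13 * B k / H j))"
  proof (rule sum_mono2)
    show "Jk \<subseteq> (\<Union>m\<in>{..n}. D m)"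
    proof
      fix j assume j: "j \<in> Jk"
      \<comment> \<open>Here the fattening pays off: B k is at least d a k, whereas b k could be
        arbitrarily small.\<close>
      have "H j / B k \<le> 8 * a k / (d * a k)"
        using Hb[OF j] B_bounds[OF k] a_pos[OF k] d_pos by (intro frac_le) auto
      also have "\<dots> \<le> 2 ^ n" using n a_pos[OF k] by simp
      finally have "H j / B k \<le> 2 ^ n" .
      moreover have "1 \<le> H j / B k" using Hb[OF j] B_bounds[OF k] by simp
      ultimately obtain m where "m \<le> n" "2 ^ m \<le> H j / B k" "H j / B k < 2 ^ Suc m"
        using dyadic_scale by metis
      then have "j \<in> D m" using j B_bounds(2)[OF k] unfolding D_def by (simp add: pos_le_divide_eq pos_divide_less_eq)
      then show "j \<in> (\<Union>m\<in>{..n}. D m)" using \<open>m \<le> n\<close> by blast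
    qed
    fix j assume "j \<in> (\<Union>m\<in>{..n}. D m) - Jk"
    then show "0 \<le> measure wM (E j) * (13 * B k / H j)" by (auto simp: D_def)
  qed (use fD in auto)
  also have "\<dots> \<le> (\<Sum>m\<le>n. \<Sum>j\<in>D m. measure wM (E j) * (13 * B k / H j))"
  proof (rule sum_UN_le)
    fix m j assume "j \<in> D m"
    then have "0 < H j" using Hb(1)[of j] B_bounds(2)[OF k] by (auto simp: D_def)
    then show "0 \<le> measure wM (E j) * (13 * B k / H j)" using B_bounds(2)[OF k] by simp
  qed (use fD in auto)
  also have "\<dots> \<le> (\<Sum>m\<le>n. 1664 * (V k * area (P k)))" by (intro sum_mono scale)
  also have "\<dots> = 1664 * L * (V k * area (P k))" by simp
  finally show ?thesis .
qed

end

lemma sum_symmetric_le: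
  fixes f :: "'i \<Rightarrow> 'i \<Rightarrow> real" and a :: "'i \<Rightarrow> real"
  assumes "finite J" and sym: "\<And>j k. f j k = f k j" and nn: "\<And>j k. j \<in> J \<Longrightarrow> k \<in> J \<Longrightarrow> 0 \<le> f j k"
  shows "(\<Sum>j\<in>J. \<Sum>k\<in>J. f j k) \<le> 2 * (\<Sum>k\<in>J. \<Sum>j\<in>{j \<in> J. a j \<le> a k}. f j k)"
proof -
  let ?g = "\<lambda>j k. if a j \<le> a k then f j k else 0"
  have "(\<Sum>j\<in>J. \<Sum>k\<in>J. f j k) \<le> (\<Sum>j\<in>J. \<Sum>k\<in>J. ?g j k + ?g k j)"
    using nn sym by (intro sum_mono) auto
  also have "\<dots> = (\<Sum>j\<in>J. \<Sum>k\<in>J. ?g j k) + (\<Sum>j\<in>J. \<Sum>k\<in>J. ?g k j)"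
    by (simp add: sum.distrib)
  also have "(\<Sum>j\<in>J. \<Sum>k\<in>J. ?g j k) = (\<Sum>k\<in>J. \<Sum>j\<in>J. ?g j k)" by (rule sum.swap)
  also have "(\<Sum>k\<in>J. \<Sum>j\<in>J. ?g j k) = (\<Sum>k\<in>J. \<Sum>j\<in>{j \<in> J. a j \<le> a k}. f j k)"
    using assms(1) by (intro sum.cong refl sum.inter_filter[symmetric])
  finally show ?thesis by simp
qed

context rectangle_family
begin

lemma fmeasurable_R: "i \<in> I \<Longrightarrow> R i \<in> fmeasurable lborel"
  and fmeasurable_P: "i \<in> I \<Longrightarrow> P i \<in> fmeasurable lborel"
  using emeasure_hrect_finite[OF on] by (auto simp: fmeasurable_def)

text \<open>Order each pair so that j is the shorter one and replace the minimum by V j. Since \<mu>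
  j V j is w(E j) / |P j|, the sum over j becomes the column of \<open>fat_column\<close>, and \<mu>
  k turns its bound V k |P k| back into w(E k).\<close>

lemma fat_quadratic:
  assumes J: "J \<subseteq> I" and E: "\<And>j. j \<in> J \<Longrightarrow> E j \<subseteq> R j \<and> E j \<in> sets borel" and disj: "disjoint_family_on E J"
    and \<mu>: "\<And>j. j \<in> J \<Longrightarrow> \<mu> j * (V j * area (P j)) = measure wM (E j)" and V_pos: "\<And>j. j \<in> J \<Longrightarrow> 0 < V j"
  shows "(\<Sum>j\<in>J. \<Sum>k\<in>J. \<mu> j * \<mu> k * (min (V j) (V k) * area (P j \<inter> P k)))
    \<le> 3328 * L * (\<Sum>j\<in>J. measure wM (E j))"
proof -
  have fJ: "finite J" using J fin finite_subset by auto
  have areaP: "0 < area (P j)" if "j \<in> J" for j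
    using that J area_P[of j] a_pos[of j] B_bounds[of j] by auto
  have \<mu>_eq: "\<mu> j * V j = measure wM (E j) / area (P j)" if "j \<in> J" for j
    using \<mu>[OF that] areaP[OF that] by (simp add: field_simps)
  have \<mu>_nn: "0 \<le> \<mu> j" if "j \<in> J" for j
  proof -
    have "0 \<le> \<mu> j * (V j * area (P j))" unfolding \<mu>[OF that] by simp
    then show ?thesis using mult_pos_pos[OF V_pos[OF that] areaP[OF that]] by (simp add: zero_le_mult_iff)
  qed
  have "(\<Sum>j\<in>J. \<Sum>k\<in>J. \<mu> j * \<mu> k * (min (V j) (V k) * area (P j \<inter> P k)))
     \<le> 2 * (\<Sum>k\<in>J. \<Sum>j\<in>{j \<in> J. a j \<le> a k}. \<mu> j * \<mu> k * (min (V j) (V k) * area (P j \<inter> P k)))"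
  proof (rule sum_symmetric_le[OF fJ])
    fix j k assume "j \<in> J" "k \<in> J"
    then show "0 \<le> \<mu> j * \<mu> k * (min (V j) (V k) * area (P j \<inter> P k))"
      using \<mu>_nn V_pos less_imp_le by (intro mult_nonneg_nonneg) auto
  qed (simp add: mult_ac min.commute Int_commute)
  also have "\<dots> \<le> 2 * (\<Sum>k\<in>J. 1664 * L * measure wM (E k))"
  proof (intro mult_left_mono sum_mono)
    fix k assume k: "k \<in> J"
    have "(\<Sum>j\<in>{j \<in> J. a j \<le> a k}. \<mu> j * \<mu> k * (min (V j) (V k) * area (P j \<inter> P k)))
       \<le> (\<Sum>j\<in>{j \<in> J. a j \<le> a k}. \<mu> k * (measure wM (E j) * (area (P j \<inter> P k) / area (P j))))"
    proof (intro sum_mono)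
      fix j assume "j \<in> {j \<in> J. a j \<le> a k}"
      then have j: "j \<in> J" by simp
      have "\<mu> j * \<mu> k * (min (V j) (V k) * area (P j \<inter> P k)) \<le> \<mu> j * \<mu> k * (V j * area (P j \<inter> P k))"
        using \<mu>_nn[OF j] \<mu>_nn[OF k] by (intro mult_left_mono mult_right_mono) auto
      also have "\<dots> = \<mu> k * ((\<mu> j * V j) * area (P j \<inter> P k))" by (simp add: mult_ac)
      also have "\<dots> = \<mu> k * (measure wM (E j) * (area (P j \<inter> P k) / area (P j)))"
        unfolding \<mu>_eq[OF j] by simp
      finally show "\<mu> j * \<mu> k * (min (V j) (V k) * area (P j \<inter> P k))
        \<le> \<mu> k * (measure wM (E j) * (area (P j \<inter> P k) / area (P j)))" .
    qed
    also have "\<dots> = \<mu> k * (\<Sum>j\<in>{j \<in> J. a j \<le> a k}. measure wM (E j) * (area (P j \<inter> P k) / area (P j)))"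
      by (rule sum_distrib_left[symmetric])
    also have "\<dots> \<le> \<mu> k * (1664 * L * (V k * area (P k)))"
      using k J by (intro mult_left_mono fat_column[OF J E disj] \<mu>_nn) auto
    also have "\<dots> = 1664 * L * (\<mu> k * (V k * area (P k)))" by (simp only: mult_ac)
    also have "\<dots> = 1664 * L * measure wM (E k)" using \<mu>[OF k] by simp
    finally show "(\<Sum>j\<in>{j \<in> J. a j \<le> a k}. \<mu> j * \<mu> k * (min (V j) (V k) * area (P j \<inter> P k))) \<le> 1664 * L * measure wM (E k)" .
  qed simp
  also have "\<dots> = 3328 * L * (\<Sum>j\<in>J. measure wM (E j))"
    by (simp add: sum_distrib_left[symmetric])
  finally show ?thesis .
qed

section \<open>Selection rule and rejected rectangles\<close>

abbreviation "kap j k \<equiv> min (V j) (V k) * area (R j \<inter> R k)"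

lemma kap_le: "0 \<le> V j \<Longrightarrow> kap j k \<le> V j * area (R j \<inter> R k)"
  by (intro mult_right_mono) auto

text \<open>The threshold contains L, the form on the selected family is O(L X) and the form on the
  fattened rejected family is O(L Y), with Y the measure to be bounded. The three factors L balance,
  so no logarithm appears in the conclusion.\<close>

lemma rejected_transversal:
  assumes S: "S \<subseteq> I" and J: "J \<subseteq> I"
    and X: "(\<Sum>j\<in>S. \<Sum>k\<in>S. kap j k) \<le> 5 * L * X" and X0: "0 \<le> X"
    and rej: "\<And>j. j \<in> J \<Longrightarrow> L * (V j * area (R j)) < (\<Sum>k\<in>{k \<in> S. a j \<le> a k \<and> d \<le> \<bar>u k \<bullet> v j\<bar>}. kap j k)"
  shows "emeasure wM (\<Union>j\<in>J. R j) \<le> ennreal (4259840 * X)"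
proof -
  have fJ: "finite J" and fS: "finite S" using J S fin finite_subset by auto
  obtain E where E: "\<forall>j\<in>J. E j \<subseteq> R j \<and> E j \<in> sets borel" and disj: "disjoint_family_on E J"
    and UE: "(\<Union>j\<in>J. E j) = (\<Union>j\<in>J. R j)"
    using disjoint_refinement[OF fJ, of R borel] by auto
  define Y where "Y = (\<Sum>j\<in>J. measure wM (E j))"
  have Vp: "0 < V j" if "j \<in> J" for j
  proof (rule ccontr)
    assume "\<not> 0 < V j"
    then have V0: "V j = 0" using V_nonneg[of j] J that by force
    have "(\<Sum>k\<in>{k \<in> S. a j \<le> a k \<and> d \<le> \<bar>u k \<bullet> v j\<bar>}. kap j k) = 0"
      using V_nonneg S unfolding V0 by (intro sum.neutral) (auto simp: min_def)
    then show False using rej[OF that] V0 by simp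
  qed
  have areaP: "0 < area (P j)" if "j \<in> J" for j
    using that J area_P[of j] a_pos[of j] B_bounds[of j] by auto
  \<comment> \<open>With these coefficients the rejection inequalities, summed over j, give exactly
    L Y on the left, where each point of the union is counted in one piece E j only.\<close>
  define \<mu> where "\<mu> j = measure wM (E j) / (V j * area (P j))" for j
  have \<mu>: "\<mu> j * (V j * area (P j)) = measure wM (E j)" if "j \<in> J" for j
    using Vp[OF that] areaP[OF that] by (simp add: \<mu>_def)
  have \<mu>_nn: "0 \<le> \<mu> j" if "j \<in> J" for j
    using Vp[OF that] by (simp add: \<mu>_def)
  \<comment> \<open>The rejection inequality is moved from R j to P j: since |P j| b j = 2 B j |R
    j|, multiplying by 2 B j and applying \<open>area_inter_fat\<close> termwise costs only a factor
    16.\<close>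
  have single: "L * (V j * area (P j)) \<le> 16 * (\<Sum>k\<in>S. min (V j) (V k) * area (P j \<inter> R k))" if j: "j \<in> J" for j
  proof -
    have jI: "j \<in> I" using j J by auto
    let ?K = "{k \<in> S. a j \<le> a k \<and> d \<le> \<bar>u k \<bullet> v j\<bar>}"
    have "L * (V j * area (P j)) * b j = L * (V j * area (R j)) * (2 * B j)"
      by (simp add: area_P[OF jI] area_R[OF jI])
    also have "\<dots> \<le> (\<Sum>k\<in>?K. kap j k) * (2 * B j)"
      using rej[OF j] B_bounds(2)[OF jI] by (intro mult_right_mono) auto
    also have "\<dots> = (\<Sum>k\<in>?K. kap j k * (2 * B j))" by (rule sum_distrib_right)
    also have "\<dots> \<le> (\<Sum>k\<in>?K. 16 * b j * (min (V j) (V k) * area (P j \<inter> R k)))"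
    proof (intro sum_mono)
      fix k assume k: "k \<in> ?K"
      then have kI: "k \<in> I" using S by auto
      have "area (R j \<inter> R k) * (2 * (b j + d * a j)) \<le> 16 * b j * area (R k \<inter> hrect (c j) (u j) (v j) (2 * a j) (b j + d * a j))"
        using k by (intro area_inter_fat on b_pos b_le_a d_pos jI kI) auto
      then have "area (R j \<inter> R k) * (2 * B j) \<le> 16 * b j * area (P j \<inter> R k)"
        by (simp add: B_def Int_commute)
      then have "min (V j) (V k) * (area (R j \<inter> R k) * (2 * B j)) \<le> min (V j) (V k) * (16 * b j * area (P j \<inter> R k))"
        using V_nonneg[OF jI] V_nonneg[OF kI] by (intro mult_left_mono) auto
      then show "kap j k * (2 * B j) \<le> 16 * b j * (min (V j) (V k) * area (P j \<inter> R k))"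
        by (simp only: mult_ac)
    qed
    also have "\<dots> \<le> (\<Sum>k\<in>S. 16 * b j * (min (V j) (V k) * area (P j \<inter> R k)))"
      using fS S V_nonneg b_pos[OF jI] jI by (intro sum_mono2) (auto intro!: mult_nonneg_nonneg)
    also have "\<dots> = (16 * (\<Sum>k\<in>S. min (V j) (V k) * area (P j \<inter> R k))) * b j"
      by (simp add: sum_distrib_left mult_ac)
    finally show ?thesis using b_pos[OF jI] by (simp only: mult_le_cancel_right_pos)
  qed
  let ?Q = "\<Sum>j\<in>J. \<Sum>k\<in>S. \<mu> j * 1 * (min (V j) (V k) * area (P j \<inter> R k))"
  have "L * Y = (\<Sum>j\<in>J. \<mu> j * (L * (V j * area (P j))))"
    unfolding Y_def sum_distrib_left
  proof (intro sum.cong refl)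
    fix j assume "j \<in> J"
    then show "L * measure wM (E j) = \<mu> j * (L * (V j * area (P j)))" 
      unfolding \<mu>[symmetric, OF \<open>j \<in> J\<close>] by (simp only: mult_ac)
  qed
  also have "\<dots> \<le> (\<Sum>j\<in>J. \<mu> j * (16 * (\<Sum>k\<in>S. min (V j) (V k) * area (P j \<inter> R k))))"
    by (intro sum_mono mult_left_mono single \<mu>_nn)
  also have "\<dots> = 16 * ?Q"
    by (simp add: sum_distrib_left mult_ac)
  finally have LY: "L * Y \<le> 8 * (2 * ?Q)" by simp
  \<comment> \<open>53248 is 16 * 3328: after multiplication by 8 the second form contributes L Y /
    2, which is absorbed into the left-hand side.\<close>
  have "2 * ?Q \<le> 53248 * (\<Sum>j\<in>S. \<Sum>k\<in>S. 1 * 1 * (min (V j) (V k) * area (R j \<inter> R k)))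
      + (\<Sum>j\<in>J. \<Sum>k\<in>J. \<mu> j * \<mu> k * (min (V j) (V k) * area (P j \<inter> P k))) / 53248"
    by (rule min_kernel_amgm[OF fJ fS]) (use J S V_nonneg in \<open>auto intro!: fmeasurable_P fmeasurable_R\<close>)
  also have "\<dots> \<le> 53248 * (5 * L * X) + (3328 * L * Y) / 53248"
  proof (intro add_mono mult_left_mono divide_right_mono)
    show "(\<Sum>j\<in>J. \<Sum>k\<in>J. \<mu> j * \<mu> k * (min (V j) (V k) * area (P j \<inter> P k))) \<le> 3328 * L * Y"
      unfolding Y_def using E by (intro fat_quadratic J disj \<mu> Vp) auto
  qed (use X in auto)
  finally have "2 * ?Q \<le> 266240 * (L * X) + (L * Y) / 16" by (simp add: mult.commute del: of_nat_Suc)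
  then have "8 * (2 * ?Q) \<le> 2129920 * (L * X) + (L * Y) / 2" by argo
  with LY have "L * Y \<le> 2129920 * (L * X) + (L * Y) / 2" by (rule order_trans)
  then have "L * Y \<le> 4259840 * (L * X)" by argo
  then have "L * Y \<le> L * (4259840 * X)" by (simp only: mult_ac)
  then have Y: "Y \<le> 4259840 * X" by (simp only: mult_le_cancel_left_pos of_nat_0_less_iff zero_less_Suc)
  have "emeasure wM (\<Union>j\<in>J. R j) = (\<Sum>j\<in>J. emeasure wM (E j))"
    unfolding UE[symmetric] using E disj fJ by (intro sum_emeasure[symmetric]) auto
  also have "\<dots> = (\<Sum>j\<in>J. ennreal (measure wM (E j)))"
  proof (intro sum.cong refl emeasure_eq_ennreal_measure)
    fix j assume "j \<in> J"
    then show "emeasure wM (E j) \<noteq> top" using emeasure_R_finite[of j "E j"] E J by (auto simp: less_top)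
  qed
  also have "\<dots> = ennreal Y" by (simp add: Y_def)
  also have "\<dots> \<le> ennreal (4259840 * X)" using Y by (rule ennreal_leI)
  finally show ?thesis .
qed

text \<open>Let \<nu> have the density G summed over the lengthened selected rectangles. For x in R
  j the parts of these rectangles inside the ball of radius 3 b j have total area at least 4 (b
  j)^2, and at each point of the ball G dominates the w-average over the fivefold ball. Hence \<nu>
  of the small ball controls w of the dilated one, and Vitali applies; the total mass of \<nu> is 8
  times the sum of V k |R k|.\<close>

lemma rejected_parallel:
  assumes S: "S \<subseteq> I" and J: "J \<subseteq> I"
    and rej: "\<And>j. j \<in> J \<Longrightarrow> V j * area (R j) \<le> (\<Sum>k\<in>{k \<in> S. a j \<le> a k \<and> (u k = u j \<or> u k = - u j)}. kap j k)"
    and Vp: "\<And>j. j \<in> J \<Longrightarrow> 0 < V j"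
  shows "emeasure wM (\<Union>j\<in>J. R j) \<le> ennreal (1800 * (\<Sum>k\<in>S. V k * area (R k)))"
proof -
  have fJ: "finite J" and fS: "finite S" using J S fin finite_subset by auto
  let ?F = "\<lambda>k. hrect (c k) (u k) (v k) (8 * a k) (b k)"
  define \<nu> where "\<nu> = density lborel (\<lambda>x. \<Sum>k\<in>S. G x * indicator (?F k) x)"
  have \<nu>: "emeasure \<nu> A = (\<Sum>k\<in>S. (\<integral>\<^sup>+x\<in>A. G x * indicator (?F k) x \<partial>lborel))" if [measurable]: "A \<in> sets borel" for A
    unfolding \<nu>_def by (subst emeasure_density) (simp_all add: sum_distrib_right nn_integral_sum)
  have key: "emeasure wM (cball x (5 * (3 * b j))) \<le> ennreal 225 * emeasure \<nu> (cball x (3 * b j))"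
    if j: "j \<in> J" and x: "x \<in> R j" for x j
  proof -
    have jI: "j \<in> I" using j J by auto
    have bj: "0 < b j" by (rule b_pos[OF jI])
    have [measurable]: "cball x (3 * b j) \<in> sets borel" by simp
    let ?W = "emeasure wM (cball x (5 * (3 * b j)))"
    let ?K = "{k \<in> S. a j \<le> a k \<and> (u k = u j \<or> u k = - u j)}"
    have fK: "finite ?K" using fS by simp
    \<comment> \<open>The ball of radius 15 b j is enclosed in a square of the same half side, which
      contains y; so 900 is 4 * 15^2. Division by 4 (b j)^2 leads to 225.\<close>
    have W: "?W \<le> ennreal (900 * (b j)\<^sup>2) * G y" if "y \<in> cball x (3 * b j)" for y
    proof -
      have "?W \<le> emeasure wM (hrect x (u j) (v j) (15 * b j) (15 * b j))"
        using cball_subset_hrect[OF on[OF jI], of x "15 * b j"] by (intro emeasure_mono) auto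
      also have "\<dots> \<le> ennreal (4 * (15 * b j)\<^sup>2) * G y"
      proof -
        have "y \<in> cball x (15 * b j)" using that bj by auto
        then have "y \<in> hrect x (u j) (v j) (15 * b j) (15 * b j)" using cball_subset_hrect[OF on[OF jI]] by blast
        then show ?thesis using cube[OF on[OF jI], of "15 * b j" y x] bj by (simp add: emeasure_wM)
      qed
      also have "4 * (15 * b j)\<^sup>2 = 900 * (b j)\<^sup>2" by (simp add: power2_eq_square)
      finally show ?thesis .
    qed
    have "V j * area (R j) \<le> V j * (\<Sum>k\<in>?K. area (R j \<inter> R k))"
      unfolding sum_distrib_left using rej[OF j] V_nonneg[OF jI]
      by (elim order_trans) (intro sum_mono kap_le)
    then have "area (R j) \<le> (\<Sum>k\<in>?K. area (R j \<inter> R k))" using Vp[OF j] by simp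
    then have "b j * (4 * a j * b j) \<le> b j * (\<Sum>k\<in>?K. area (R j \<inter> R k))"
      using bj area_R[OF jI] by (intro mult_left_mono) auto
    also have "\<dots> = (\<Sum>k\<in>?K. b j * area (R j \<inter> R k))" by (rule sum_distrib_left)
    also have "\<dots> \<le> (\<Sum>k\<in>?K. a j * area (?F k \<inter> cball x (3 * b j)))"
    proof (intro sum_mono)
      fix k assume k: "k \<in> ?K"
      then have kI: "k \<in> I" using S by auto
      have hk: "hrect (c k) (u k) (v k) p q = hrect (c k) (u j) (v j) p q" for p q
        using k by (intro hrect_parallel on jI kI) auto
      show "b j * area (R j \<inter> R k) \<le> a j * area (?F k \<inter> cball x (3 * b j))"
        unfolding hk using k x b_pos[OF kI] by (intro area_inter_parallel on jI b_pos b_le_a) auto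
    qed
    also have "\<dots> = a j * (\<Sum>k\<in>?K. area (?F k \<inter> cball x (3 * b j)))" by (rule sum_distrib_left[symmetric])
    finally have "a j * (4 * (b j)\<^sup>2) \<le> a j * (\<Sum>k\<in>?K. area (?F k \<inter> cball x (3 * b j)))"
      by (simp add: power2_eq_square mult_ac)
    then have ar: "4 * (b j)\<^sup>2 \<le> (\<Sum>k\<in>?K. area (?F k \<inter> cball x (3 * b j)))"
      using a_pos[OF jI] by simp
    have "ennreal (4 * (b j)\<^sup>2) * ?W \<le> ennreal (\<Sum>k\<in>?K. area (?F k \<inter> cball x (3 * b j))) * ?W"
      by (intro mult_right_mono ennreal_leI ar) auto
    also have "\<dots> = (\<Sum>k\<in>?K. ennreal (area (?F k \<inter> cball x (3 * b j))) * ?W)"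
    proof -
      have "ennreal (\<Sum>k\<in>?K. area (?F k \<inter> cball x (3 * b j))) = (\<Sum>k\<in>?K. ennreal (area (?F k \<inter> cball x (3 * b j))))"
        by (rule sum_ennreal[symmetric]) simp
      then show ?thesis by (simp only: sum_distrib_right)
    qed
    also have "\<dots> \<le> (\<Sum>k\<in>?K. ennreal (900 * (b j)\<^sup>2) * (\<integral>\<^sup>+y\<in>cball x (3 * b j). G y * indicator (?F k) y \<partial>lborel))"
    proof (intro sum_mono)
      fix k assume "k \<in> ?K"
      then have kI: "k \<in> I" using S by auto
      have fm: "?F k \<inter> cball x (3 * b j) \<in> fmeasurable lborel"
      proof (rule fmeasurableI2)
        show "cball x (3 * b j) \<in> fmeasurable lborel" using emeasure_bounded_finite[OF bounded_cball] by (auto simp: fmeasurable_def)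
      qed auto
      have "ennreal (area (?F k \<inter> cball x (3 * b j))) * ?W = (\<integral>\<^sup>+y\<in>?F k \<inter> cball x (3 * b j). ?W \<partial>lborel)"
        using fm by (simp add: nn_integral_cmult emeasure_eq_measure2 mult.commute)
      also have "\<dots> \<le> (\<integral>\<^sup>+y. ennreal (900 * (b j)\<^sup>2) * (G y * indicator (?F k) y * indicator (cball x (3 * b j)) y) \<partial>lborel)"
        using W by (intro nn_integral_mono) (auto simp: indicator_def)
      also have "\<dots> = ennreal (900 * (b j)\<^sup>2) * (\<integral>\<^sup>+y\<in>cball x (3 * b j). G y * indicator (?F k) y \<partial>lborel)"
        by (rule nn_integral_cmult) measurable
      finally show "ennreal (area (?F k \<inter> cball x (3 * b j))) * ?W
         \<le> ennreal (900 * (b j)\<^sup>2) * (\<integral>\<^sup>+y\<in>cball x (3 * b j). G y * indicator (?F k) y \<partial>lborel)" .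
    qed
    also have "\<dots> = ennreal (900 * (b j)\<^sup>2) * (\<Sum>k\<in>?K. (\<integral>\<^sup>+y\<in>cball x (3 * b j). G y * indicator (?F k) y \<partial>lborel))"
      by (rule sum_distrib_left[symmetric])
    also have "\<dots> \<le> ennreal (900 * (b j)\<^sup>2) * emeasure \<nu> (cball x (3 * b j))"
      using fS by (subst \<nu>) (auto intro!: mult_left_mono sum_mono2)
    also have "\<dots> = ennreal (4 * (b j)\<^sup>2) * (ennreal 225 * emeasure \<nu> (cball x (3 * b j)))"
    proof -
      have "ennreal (900 * (b j)\<^sup>2) = ennreal (4 * (b j)\<^sup>2) * ennreal 225"
        by (subst ennreal_mult[symmetric]) auto
      then show ?thesis by (simp only: mult.assoc)
    qed
    finally show ?thesis by (rule ennreal_cancel_left[rotated]) (use bj in simp)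
  qed
  define jx where "jx x = (SOME j. j \<in> J \<and> x \<in> R j)" for x
  have jx: "jx x \<in> J" "x \<in> R (jx x)" if "x \<in> (\<Union>j\<in>J. R j)" for x
    using that someI_ex[of "\<lambda>j. j \<in> J \<and> x \<in> R j"] unfolding jx_def by blast+
  have "emeasure wM (\<Union>j\<in>J. R j) \<le> ennreal 225 * emeasure \<nu> UNIV"
  proof (rule vitali_measure_bound[where r="\<lambda>x. 3 * b (jx x)" and B="\<Sum>j\<in>J. 3 * b j"])
    fix x assume x: "x \<in> (\<Union>j\<in>J. R j)"
    have "3 * b (jx x) \<le> (\<Sum>j\<in>J. 3 * b j)"
      using fJ jx(1)[OF x] J b_pos by (intro member_le_sum) (auto simp: less_imp_le)
    then show "0 < 3 * b (jx x) \<and> 3 * b (jx x) \<le> (\<Sum>j\<in>J. 3 * b j)" using b_pos[of "jx x"] jx(1)[OF x] J by auto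
    show "emeasure wM (cball x (5 * (3 * b (jx x)))) \<le> ennreal 225 * emeasure \<nu> (cball x (3 * b (jx x)))"
      by (rule key[OF jx[OF x]])
  qed (use fJ in \<open>auto simp: \<nu>_def\<close>)
  also have "emeasure \<nu> UNIV = (\<Sum>k\<in>S. ennreal (8 * (V k * area (R k))))"
  proof (subst \<nu>)
    show "(\<Sum>k\<in>S. \<integral>\<^sup>+x\<in>UNIV. G x * indicator (?F k) x \<partial>lborel) = (\<Sum>k\<in>S. ennreal (8 * (V k * area (R k))))"
    proof (intro sum.cong refl)
      fix k assume "k \<in> S"
      then have "k \<in> I" using S by auto
      then show "(\<integral>\<^sup>+x\<in>UNIV. G x * indicator (?F k) x \<partial>lborel) = ennreal (8 * (V k * area (R k)))"
      proof -
        have "32 * a k * b k * V k = 8 * (V k * (4 * a k * b k))" by simp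
        then show ?thesis using V[OF \<open>k \<in> I\<close>] by (simp only: area_R[OF \<open>k \<in> I\<close>]) simp
      qed
    qed
  qed simp
  also have "\<dots> = ennreal (\<Sum>k\<in>S. 8 * (V k * area (R k)))"
    using S V_nonneg by (intro sum_ennreal) auto
  also have "ennreal 225 * \<dots> = ennreal (225 * (\<Sum>k\<in>S. 8 * (V k * area (R k))))"
    by (rule ennreal_mult'[symmetric]) simp
  also have "225 * (\<Sum>k\<in>S. 8 * (V k * area (R k))) = 1800 * (\<Sum>k\<in>S. V k * area (R k))"
    by (simp add: sum_distrib_left)
  finally show ?thesis .
qed

text \<open>The threshold is 2 L V j |R j|, so that a rejected j either has transversal overlap
  above L V j |R j| or parallel overlap of at least that amount, hence at least V j |R j|. A
  rejected j has V j > 0, because otherwise its whole row vanishes.\<close>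

lemma selection:
  obtains S where "S \<subseteq> I" "(\<Sum>j\<in>S. \<Sum>k\<in>S. kap j k) \<le> 5 * L * (\<Sum>k\<in>S. V k * area (R k))"
    "emeasure wM (\<Union>j\<in>I. R j) \<le> ennreal (4300000 * (\<Sum>k\<in>S. V k * area (R k)))"
proof -
  define T where "T j = 2 * (L * (V j * area (R j)))" for j
  \<comment> \<open>\<open>greedy_selection\<close> asks for nonnegativity at all indices, but V is
    known to be nonnegative on I only.\<close>
  define kap' where kap': "kap' = (\<lambda>j k. max 0 (kap j k))"
  obtain S where S: "S \<subseteq> I" and Ssum: "(\<Sum>j\<in>S. \<Sum>k\<in>S. kap' j k) \<le> (\<Sum>j\<in>S. 2 * T j + kap' j j)"
    and rej: "\<And>j. j \<in> I - S \<Longrightarrow> T j < (\<Sum>k\<in>{k \<in> S. a j \<le> a k}. kap' j k)"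
  proof -
    have s: "kap' j k = kap' k j" for j k by (simp add: kap' min.commute Int_commute)
    have p: "0 \<le> kap' j k" for j k by (simp add: kap')
    show thesis using greedy_selection[where kap=kap' and T=T and a=a, OF fin s p] that by blast
  qed
  have k: "kap' j k = kap j k" if "j \<in> I" "k \<in> I" for j k
    using V_nonneg that by (simp add: kap')
  define X where "X = (\<Sum>k\<in>S. V k * area (R k))"
  have X0: "0 \<le> X" unfolding X_def using S V_nonneg by (intro sum_nonneg) auto
  have fS: "finite S" using S fin finite_subset by auto
  have "(\<Sum>j\<in>S. \<Sum>k\<in>S. kap j k) = (\<Sum>j\<in>S. \<Sum>k\<in>S. kap' j k)"
    using S by (intro sum.cong refl k[symmetric]) auto
  also have "\<dots> \<le> (\<Sum>j\<in>S. 5 * L * (V j * area (R j)))"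
    using Ssum
  proof (rule order_trans)
    show "(\<Sum>j\<in>S. 2 * T j + kap' j j) \<le> (\<Sum>j\<in>S. 5 * L * (V j * area (R j)))"
    proof (intro sum_mono)
      fix j assume "j \<in> S"
      then have j: "j \<in> I" using S by auto
      have "1 * (V j * area (R j)) \<le> L * (V j * area (R j))"
        using V_nonneg[OF j] by (intro mult_right_mono) auto
      then show "2 * T j + kap' j j \<le> 5 * L * (V j * area (R j))"
        unfolding T_def k[OF j j] by (simp add: mult_ac del: of_nat_Suc)
    qed
  qed
  also have "\<dots> = 5 * L * X" unfolding X_def by (rule sum_distrib_left[symmetric])
  finally have SX: "(\<Sum>j\<in>S. \<Sum>k\<in>S. kap j k) \<le> 5 * L * X" .
  let ?Kt = "\<lambda>j. {k \<in> S. a j \<le> a k \<and> d \<le> \<bar>u k \<bullet> v j\<bar>}"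
  let ?Kp = "\<lambda>j. {k \<in> S. a j \<le> a k \<and> (u k = u j \<or> u k = - u j)}"
  define J1 where "J1 = {j \<in> I. L * (V j * area (R j)) < (\<Sum>k\<in>?Kt j. kap j k)}"
  define J2 where "J2 = {j \<in> I. 0 < V j \<and> V j * area (R j) \<le> (\<Sum>k\<in>?Kp j. kap j k)}"
  have "I - S \<subseteq> J1 \<union> J2"
  proof
    fix j assume j: "j \<in> I - S"
    have nn: "0 \<le> kap j k" if "k \<in> S" for k using V_nonneg j S that by auto
    have "{k \<in> S. a j \<le> a k} \<subseteq> ?Kt j \<union> ?Kp j" using separated j S by auto
    then have "(\<Sum>k\<in>{k \<in> S. a j \<le> a k}. kap j k) \<le> (\<Sum>k\<in>?Kt j \<union> ?Kp j. kap j k)"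
      using fS nn by (intro sum_mono2) auto
    also have "\<dots> \<le> (\<Sum>k\<in>?Kt j. kap j k) + (\<Sum>k\<in>?Kp j. kap j k)"
      using fS nn by (subst sum_Un) (auto intro!: sum_nonneg)
    finally have s: "(\<Sum>k\<in>{k \<in> S. a j \<le> a k}. kap j k) \<le> (\<Sum>k\<in>?Kt j. kap j k) + (\<Sum>k\<in>?Kp j. kap j k)" .
    have T: "T j < (\<Sum>k\<in>{k \<in> S. a j \<le> a k}. kap j k)"
    proof -
      have "(\<Sum>k\<in>{k \<in> S. a j \<le> a k}. kap' j k) = (\<Sum>k\<in>{k \<in> S. a j \<le> a k}. kap j k)"
        using j S by (intro sum.cong refl k) auto
      then show ?thesis using rej[OF j] by simp
    qed
    show "j \<in> J1 \<union> J2"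
    proof (cases "j \<in> J1")
      case False
      then have 1: "(\<Sum>k\<in>?Kt j. kap j k) \<le> L * (V j * area (R j))" using j by (simp add: J1_def)
      then have 2: "L * (V j * area (R j)) \<le> (\<Sum>k\<in>?Kp j. kap j k)" using T s unfolding T_def by linarith
      have "1 * (V j * area (R j)) \<le> L * (V j * area (R j))"
        using V_nonneg[of j] j by (intro mult_right_mono) auto
      then have "V j * area (R j) \<le> (\<Sum>k\<in>?Kp j. kap j k)" using 2 by linarith
      moreover have "0 < V j"
      proof (rule ccontr)
        assume "\<not> 0 < V j"
        then have V0: "V j = 0" using V_nonneg[of j] j by force
        have "(\<Sum>k\<in>{k \<in> S. a j \<le> a k}. kap j k) = 0"
          using V_nonneg S unfolding V0 by (intro sum.neutral) (auto simp: min_def)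
        then show False using T by (simp add: T_def V0)
      qed
      ultimately show ?thesis using j by (simp add: J2_def)
    qed simp
  qed
  then have "(\<Union>j\<in>I. R j) \<subseteq> (\<Union>j\<in>S. R j) \<union> ((\<Union>j\<in>J1. R j) \<union> (\<Union>j\<in>J2. R j))" by blast
  moreover have sets: "(\<Union>j\<in>A. R j) \<in> sets wM" if "A \<subseteq> I" for A
    using that fin finite_subset[of A I] by (auto intro!: sets.finite_UN)
  have JI: "J1 \<subseteq> I" "J2 \<subseteq> I" by (auto simp: J1_def J2_def)
  ultimately have "emeasure wM (\<Union>j\<in>I. R j) \<le> emeasure wM ((\<Union>j\<in>S. R j) \<union> ((\<Union>j\<in>J1. R j) \<union> (\<Union>j\<in>J2. R j)))"
    using sets[OF S] sets[OF JI(1)] sets[OF JI(2)] by (intro emeasure_mono) auto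
  also have "\<dots> \<le> emeasure wM (\<Union>j\<in>S. R j) + (emeasure wM (\<Union>j\<in>J1. R j) + emeasure wM (\<Union>j\<in>J2. R j))"
    using sets[OF S] sets[OF JI(1)] sets[OF JI(2)]
    by (intro order_trans[OF emeasure_subadditive] add_left_mono emeasure_subadditive) auto
  also have "\<dots> \<le> ennreal (128 * X) + (ennreal (4259840 * X) + ennreal (1800 * X))"
  proof (intro add_mono)
    have "emeasure wM (\<Union>j\<in>S. R j) \<le> (\<Sum>j\<in>S. emeasure wM (R j))"
      using fS by (intro emeasure_subadditive_finite) auto
    also have "\<dots> \<le> (\<Sum>j\<in>S. ennreal (128 * (V j * area (R j))))"
      using S by (intro sum_mono emeasure_R) auto
    also have "\<dots> = ennreal (\<Sum>j\<in>S. 128 * (V j * area (R j)))"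
      using S V_nonneg by (intro sum_ennreal) auto
    also have "\<dots> = ennreal (128 * X)" by (simp add: X_def sum_distrib_left)
    finally show "emeasure wM (\<Union>j\<in>S. R j) \<le> ennreal (128 * X)" .
    show "emeasure wM (\<Union>j\<in>J1. R j) \<le> ennreal (4259840 * X)"
      by (rule rejected_transversal[OF S JI(1) SX X0]) (simp add: J1_def)
    show "emeasure wM (\<Union>j\<in>J2. R j) \<le> ennreal (1800 * X)"
      unfolding X_def by (rule rejected_parallel[OF S JI(2)]) (simp_all add: J2_def)
  qed
  \<comment> \<open>The constants 128, 4259840 and 1800 add up to 4261768.\<close>
  also have "\<dots> \<le> ennreal (4300000 * X)" using X0 by (simp add: ennreal_plus[symmetric] del: ennreal_plus)
  finally show thesis using that[OF S] SX unfolding X_def by blast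
qed

end

section \<open>Duality for a finite family\<close>

context rectangle_family
begin

text \<open>
  \<open>t X\<close> is at most the integral of \<open>g G\<close> with \<open>G\<close> the sum of \<open>V k\<close> over the selected \<open>R k\<close>. On
  \<open>R j \<inter> R k\<close> one has \<open>V j V k = max (V j) (V k) min (V j) (V k) \<le> W min (V j) (V k)\<close>, so
  \<open>G\<^sup>2 / W\<close> is controlled by the quadratic form of the selection.
\<close>
lemma weak_type_finite:
  fixes g :: "real^2 \<Rightarrow> real" and W :: "real^2 \<Rightarrow> ennreal"
  assumes [measurable]: "g \<in> borel_measurable borel" "W \<in> borel_measurable borel"
    and g0: "\<And>x. 0 \<le> g x" and t: "0 < t"
    and avg: "\<And>i. i \<in> I \<Longrightarrow> ennreal (t * area (R i)) \<le> (\<integral>\<^sup>+y\<in>R i. ennreal (g y) \<partial>lborel)"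
    and VW: "\<And>i x. i \<in> I \<Longrightarrow> x \<in> R i \<Longrightarrow> ennreal (V i) \<le> W x"
  shows "ennreal (t\<^sup>2) * emeasure wM (\<Union>i\<in>I. R i) \<le> ennreal (21500000 * L) * (\<integral>\<^sup>+x. (ennreal (g x))\<^sup>2 * W x \<partial>lborel)"
proof (cases "(\<integral>\<^sup>+x. (ennreal (g x))\<^sup>2 * W x \<partial>lborel) = \<infinity>")
  case True
  have "ennreal (21500000 * L) * \<infinity> = \<infinity>" by (auto simp: ennreal_mult_eq_top_iff ennreal_eq_0_iff)
  then show ?thesis unfolding True by simp
next
  case False
  then obtain F where F: "0 \<le> F" "(\<integral>\<^sup>+x. (ennreal (g x))\<^sup>2 * W x \<partial>lborel) = ennreal F"
    by (cases "\<integral>\<^sup>+x. (ennreal (g x))\<^sup>2 * W x \<partial>lborel" rule: ennreal_cases) auto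
  obtain S where S: "S \<subseteq> I" and SX: "(\<Sum>j\<in>S. \<Sum>k\<in>S. kap j k) \<le> 5 * L * (\<Sum>k\<in>S. V k * area (R k))"
    and bound: "emeasure wM (\<Union>j\<in>I. R j) \<le> ennreal (4300000 * (\<Sum>k\<in>S. V k * area (R k)))"
    by (rule selection)
  define X where "X = (\<Sum>k\<in>S. V k * area (R k))"
  have fS: "finite S" using S fin finite_subset by auto
  have V0: "0 \<le> V k" if "k \<in> S" for k using that S V_nonneg by auto
  have X0: "0 \<le> X" unfolding X_def using V0 by (intro sum_nonneg) auto
  \<comment> \<open>With this choice the quadratic form divided by \<open>lam\<close> is at most t
    X, that is, half of the left-hand side 2 t X, and can be absorbed.\<close>
  define lam where "lam = 5 * L / t"
  have lam: "0 < lam" using t by (simp add: lam_def)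
  define G' where "G' x = (\<Sum>k\<in>S. V k * indicator (R k) x)" for x
  define K where "K x = (\<Sum>j\<in>S. \<Sum>k\<in>S. min (V j) (V k) * indicator (R j \<inter> R k) x)" for x
  have G'0: "0 \<le> G' x" for x unfolding G'_def using V0 by (intro sum_nonneg) auto
  have K0: "0 \<le> K x" for x unfolding K_def using V0 by (intro sum_nonneg) auto
  have [measurable]: "G' \<in> borel_measurable borel" "K \<in> borel_measurable borel"
    unfolding G'_def K_def by measurable
  have pointwise: "ennreal (2 * (g x * G' x)) \<le> ennreal lam * ((ennreal (g x))\<^sup>2 * W x) + ennreal (K x / lam)" for x
  proof -
    define A where "A = {k \<in> S. x \<in> R k}"
    have fA: "finite A" using fS by (simp add: A_def)
    \<comment> \<open>The finite number M replaces W x, which may be infinite. Inserting 0 gives a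
      maximum also where no selected rectangle contains x.\<close>
    define M where "M = Max (insert 0 (V ` A))"
    have M: "V k \<le> M" if "k \<in> A" for k unfolding M_def using that fA by (intro Max_ge) auto
    have M0: "0 \<le> M" unfolding M_def using fA by (intro Max_ge) auto
    have "M \<in> insert 0 (V ` A)" unfolding M_def using fA by (intro Max_in) auto
    then have MW: "ennreal M \<le> W x"
      using VW S by (auto simp: A_def)
    have GA: "G' x = (\<Sum>k\<in>A. V k)"
      unfolding G'_def A_def sum.inter_filter[OF fS] by (intro sum.cong) (auto simp: indicator_def)
    have KA: "K x = (\<Sum>j\<in>A. \<Sum>k\<in>A. min (V j) (V k))"
      unfolding K_def A_def sum.inter_filter[OF fS] by (intro sum.cong) (auto simp: indicator_def intro!: sum.neutral sum.cong)
    have "(G' x)\<^sup>2 = (\<Sum>j\<in>A. \<Sum>k\<in>A. V j * V k)"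
      unfolding GA power2_eq_square by (rule sum_product)
    also have "\<dots> \<le> (\<Sum>j\<in>A. \<Sum>k\<in>A. M * min (V j) (V k))"
    proof (intro sum_mono)
      fix j k assume jk: "j \<in> A" "k \<in> A"
      have "V j * V k = max (V j) (V k) * min (V j) (V k)" by (simp add: max_def min_def)
      also have "\<dots> \<le> M * min (V j) (V k)"
        using M[OF jk(1)] M[OF jk(2)] V0 jk by (intro mult_right_mono) (auto simp: A_def)
      finally show "V j * V k \<le> M * min (V j) (V k)" .
    qed
    also have "\<dots> = M * K x" unfolding KA by (simp add: sum_distrib_left)
    finally have GK: "(G' x)\<^sup>2 \<le> M * K x" .
    have "2 * (g x * G' x) \<le> lam * ((g x)\<^sup>2 * M) + K x / lam"
    proof (cases "M = 0")
      case True
      then have "G' x = 0" using GK by simp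
      then show ?thesis using True K0 lam by simp
    next
      case False
      with M0 have Mp: "0 < M" by simp
      have "lam * ((g x)\<^sup>2 * M) + (G' x)\<^sup>2 / (lam * M) - 2 * (g x * G' x) = (lam * M * g x - G' x)\<^sup>2 / (lam * M)"
        using Mp lam by (simp add: power2_eq_square field_simps)
      also have "\<dots> \<ge> 0" using Mp lam by simp
      finally have "2 * (g x * G' x) \<le> lam * ((g x)\<^sup>2 * M) + (G' x)\<^sup>2 / (lam * M)" by simp
      also have "(G' x)\<^sup>2 / (lam * M) \<le> K x / lam"
        using GK Mp lam by (simp add: field_simps)
      finally show ?thesis by simp
    qed
    then have "ennreal (2 * (g x * G' x)) \<le> ennreal (lam * ((g x)\<^sup>2 * M) + K x / lam)" by (rule ennreal_leI)
    also have "\<dots> = ennreal (lam * ((g x)\<^sup>2 * M)) + ennreal (K x / lam)"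
      using lam K0 M0 by (intro ennreal_plus) auto
    also have "ennreal (lam * ((g x)\<^sup>2 * M)) = ennreal lam * ((ennreal (g x))\<^sup>2 * ennreal M)"
      using lam M0 g0 by (simp add: ennreal_mult ennreal_power)
    also have "\<dots> \<le> ennreal lam * ((ennreal (g x))\<^sup>2 * W x)"
      by (intro mult_left_mono MW) auto
    finally show ?thesis by (simp add: add_right_mono)
  qed
  have "ennreal (2 * t * X) \<le> (\<integral>\<^sup>+x. ennreal (2 * (g x * G' x)) \<partial>lborel)"
  proof -
    have "ennreal (2 * t * X) = (\<Sum>k\<in>S. ennreal (2 * V k) * ennreal (t * area (R k)))"
    proof -
      have "2 * t * X = (\<Sum>k\<in>S. (2 * V k) * (t * area (R k)))"
        by (simp add: X_def sum_distrib_left mult_ac)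
      then have "ennreal (2 * t * X) = (\<Sum>k\<in>S. ennreal ((2 * V k) * (t * area (R k))))"
        using V0 t by (subst sum_ennreal) auto
      also have "\<dots> = (\<Sum>k\<in>S. ennreal (2 * V k) * ennreal (t * area (R k)))"
        using V0 t by (intro sum.cong refl ennreal_mult) auto
      finally show ?thesis .
    qed
    also have "\<dots> \<le> (\<Sum>k\<in>S. ennreal (2 * V k) * (\<integral>\<^sup>+y\<in>R k. ennreal (g y) \<partial>lborel))"
      using S by (intro sum_mono mult_left_mono avg) auto
    also have "\<dots> = (\<Sum>k\<in>S. (\<integral>\<^sup>+y. ennreal (2 * V k) * (ennreal (g y) * indicator (R k) y) \<partial>lborel))"
      by (intro sum.cong refl nn_integral_cmult[symmetric]) measurable
    also have "\<dots> = (\<integral>\<^sup>+y. (\<Sum>k\<in>S. ennreal (2 * V k) * (ennreal (g y) * indicator (R k) y)) \<partial>lborel)"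
      by (rule nn_integral_sum[symmetric]) measurable
    also have "\<dots> = (\<integral>\<^sup>+x. ennreal (2 * (g x * G' x)) \<partial>lborel)"
    proof (intro nn_integral_cong)
      fix y
      have "(\<Sum>k\<in>S. ennreal (2 * V k) * (ennreal (g y) * indicator (R k) y)) = (\<Sum>k\<in>S. ennreal (2 * V k * (g y * indicator (R k) y)))"
        using V0 g0 by (intro sum.cong refl) (auto simp: indicator_def ennreal_mult)
      also have "\<dots> = ennreal (\<Sum>k\<in>S. 2 * V k * (g y * indicator (R k) y))"
        using V0 g0 by (intro sum_ennreal) auto
      also have "(\<Sum>k\<in>S. 2 * V k * (g y * indicator (R k) y)) = 2 * (g y * G' y)"
        unfolding G'_def sum_distrib_left by (simp add: mult_ac)
      finally show "(\<Sum>k\<in>S. ennreal (2 * V k) * (ennreal (g y) * indicator (R k) y)) = ennreal (2 * (g y * G' y))" .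
    qed
    finally show ?thesis .
  qed
  also have "\<dots> \<le> (\<integral>\<^sup>+x. ennreal lam * ((ennreal (g x))\<^sup>2 * W x) + ennreal (K x / lam) \<partial>lborel)"
    by (intro nn_integral_mono pointwise)
  also have "\<dots> = ennreal lam * ennreal F + (\<integral>\<^sup>+x. ennreal (K x / lam) \<partial>lborel)"
    by (subst nn_integral_add) (simp_all add: nn_integral_cmult F(2)[symmetric])
  also have "(\<integral>\<^sup>+x. ennreal (K x / lam) \<partial>lborel) = ennreal ((\<Sum>j\<in>S. \<Sum>k\<in>S. kap j k) / lam)"
  proof -
    have fm: "R j \<inter> R k \<in> fmeasurable lborel" if "j \<in> S" "k \<in> S" for j k
      using fmeasurable_R[of j] fmeasurable_R[of k] S that by (intro fmeasurable_Int_fmeasurable) (auto simp: fmeasurable_def)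
    have "has_bochner_integral lborel K (\<Sum>j\<in>S. \<Sum>k\<in>S. kap j k)"
      unfolding K_def
    proof (intro has_bochner_integral_sum has_bochner_integral_mult_right)
      fix j k assume "j \<in> S" "k \<in> S"
      then show "has_bochner_integral lborel (indicator (R j \<inter> R k)) (area (R j \<inter> R k))"
        using fm by (intro has_bochner_integral_real_indicator) (auto simp: fmeasurable_def)
    qed
    then have "has_bochner_integral lborel (\<lambda>x. K x / lam) ((\<Sum>j\<in>S. \<Sum>k\<in>S. kap j k) / lam)"
      by (rule has_bochner_integral_divide_zero)
    then have "integrable lborel (\<lambda>x. K x / lam)" "(\<integral>x. K x / lam \<partial>lborel) = (\<Sum>j\<in>S. \<Sum>k\<in>S. kap j k) / lam"
      by (auto simp: has_bochner_integral_iff)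
    then show ?thesis using K0 lam by (subst nn_integral_eq_integral) auto
  qed
  also have "ennreal lam * ennreal F + ennreal ((\<Sum>j\<in>S. \<Sum>k\<in>S. kap j k) / lam)
     \<le> ennreal lam * ennreal F + ennreal (5 * L * X / lam)"
    using SX lam by (intro add_left_mono ennreal_leI divide_right_mono) (auto simp: X_def)
  also have "\<dots> = ennreal (lam * F + 5 * L * X / lam)"
    using lam F(1) X0 by (simp add: ennreal_mult)
  finally have "2 * t * X \<le> lam * F + 5 * L * X / lam"
    using lam F(1) X0 by (subst (asm) ennreal_le_iff) auto
  also have "5 * L * X / lam = t * X" using t by (simp add: lam_def)
  finally have "t * X \<le> lam * F" by (simp add: mult.commute)
  then have "t * (t * X) \<le> t * (lam * F)" using t by (intro mult_left_mono) auto
  also have "t * (lam * F) = 5 * L * F" using t by (simp add: lam_def)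
  finally have tX: "t * (t * X) \<le> 5 * L * F" .
  have "ennreal (t\<^sup>2) * emeasure wM (\<Union>i\<in>I. R i) \<le> ennreal (t\<^sup>2) * ennreal (4300000 * X)"
    using bound unfolding X_def by (intro mult_left_mono) auto
  also have "\<dots> = ennreal (4300000 * (t * (t * X)))"
    using X0 t by (subst ennreal_mult[symmetric]) (auto simp: power2_eq_square mult_ac)
  also have "\<dots> \<le> ennreal (4300000 * (5 * L * F))" using tX by (intro ennreal_leI) simp
  also have "\<dots> = ennreal (21500000 * L) * ennreal F"
    using F(1) by (subst ennreal_mult[symmetric]) (auto simp: mult_ac)
  finally show ?thesis unfolding F(2) .
qed

end

section \<open>Uniformly spread directions\<close>

lemma sin_ge_half:
  assumes "0 \<le> y" "y \<le> pi / 3"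
  shows "y / 2 \<le> sin y"
proof (cases "y = 0")
  case False
  then obtain z where z: "0 < z" "z < y" "sin y - sin 0 = (y - 0) * cos z"
    using MVT2[of 0 y sin cos] assms by (auto intro: DERIV_sin)
  have "cos (pi / 3) \<le> cos z" using z assms by (intro cos_monotone_0_pi_le) auto
  then have "y * (1 / 2) \<le> y * cos z" using assms by (intro mult_left_mono) (auto simp: cos_60)
  then show ?thesis using z by simp
qed simp

lemma abs_sin_add_pi_int: "\<bar>sin (pi * of_int q + x)\<bar> = \<bar>sin x\<bar>"
proof -
  have s: "sin (pi * of_int q) = 0" by (metis mult.commute sin_npi_int)
  then have "\<bar>cos (pi * of_int q)\<bar> = 1"
    using sin_cos_squared_add[of "pi * of_int q"] by (simp add: abs_square_eq_1[symmetric] power2_eq_1_iff abs_if)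
  then show ?thesis by (simp add: sin_add s abs_mult)
qed

text \<open>|sin| has period pi, so m may be reduced modulo N. A nonzero remainder leaves an angle
  at distance at least pi / N from both 0 and pi, and sin (pi / N) is at least pi / (2 N), thus at
  least 1 / N.\<close>

lemma abs_sin_rational_angle:
  fixes m :: int
  assumes N: "3 \<le> N"
  shows "sin (pi * of_int m / real N) = 0 \<or> 1 / real N \<le> \<bar>sin (pi * of_int m / real N)\<bar>"
proof -
  define q r where "q = m div int N" and "r = m mod int N"
  have r: "0 \<le> r" "r < int N" using N by (auto simp: r_def)
  have "real_of_int m = of_int q * real N + of_int r"
    unfolding q_def r_def by (metis div_mult_mod_eq of_int_add of_int_mult of_int_of_nat_eq)
  then have "pi * of_int m / real N = pi * of_int q + pi * of_int r / real N"
    using N by (simp add: field_simps)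
  then have eq: "\<bar>sin (pi * of_int m / real N)\<bar> = \<bar>sin (pi * of_int r / real N)\<bar>"
    by (simp add: abs_sin_add_pi_int)
  show ?thesis
  proof (cases "r = 0")
    case True
    then show ?thesis using eq by simp
  next
    case False
    define y where "y = pi / real N"
    have y: "0 \<le> y" "y \<le> pi / 3" using N by (auto simp: y_def field_simps)
    have "1 / real N \<le> y / 2" using N pi_ge_two by (simp add: y_def field_simps)
    then have 1: "1 / real N \<le> sin y" using sin_ge_half[OF y] by linarith
    define x where "x = pi * of_int r / real N"
    have x: "y \<le> x" "x \<le> pi - y"
    proof -
      have "1 \<le> real_of_int r" "real_of_int r \<le> real N - 1" using r False by linarith+
      then have "pi * 1 \<le> pi * of_int r" "pi * of_int r \<le> pi * (real N - 1)"
        by (intro mult_left_mono; simp)+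
      then show "y \<le> x" "x \<le> pi - y" using N by (auto simp: x_def y_def field_simps)
    qed
    have "sin y \<le> sin x"
    proof (cases "x \<le> pi / 2")
      case True
      then show ?thesis using x y by (intro sin_monotone_2pi_le) auto
    next
      case False
      then have "sin y \<le> sin (pi - x)" using x y by (intro sin_monotone_2pi_le) auto
      then show ?thesis by simp
    qed
    then show ?thesis using 1 eq unfolding x_def by linarith
  qed
qed

text \<open>Up to signs, u and u' are the two unit vectors of the set, and |u' \<bullet> v| is |sin
  \<theta>| for the angle \<theta> between these. Since \<theta> is a multiple of pi / N, either the
  sine vanishes and the directions are parallel or it is at least 1 / N.\<close>

lemma uniform_directions_separated:
  assumes N: "3 \<le> N" and o: "orthonormal_pair u v" and o': "orthonormal_pair u' v'"
    and e: "e \<in> uniform_directions N" "u = x *\<^sub>R e" and e': "e' \<in> uniform_directions N" "u' = x' *\<^sub>R e'"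
  shows "u' = u \<or> u' = - u \<or> 1 / real N \<le> \<bar>u' \<bullet> v\<bar>"
proof -
  obtain j j' where j: "e = vector [cos (2 * pi * real j / real N), sin (2 * pi * real j / real N)]"
    "e' = vector [cos (2 * pi * real j' / real N), sin (2 * pi * real j' / real N)]"
    using e(1) e'(1) by (auto simp: uniform_directions_def)
  define \<theta> where "\<theta> = 2 * pi * real j' / real N - 2 * pi * real j / real N"
  have "e \<bullet> e = 1" "e' \<bullet> e' = 1"
    by (simp_all add: j inner_vec_def sum_2 power2_eq_square[symmetric] add.commute)
  then have n: "norm e = 1" "norm e' = 1" by (simp_all add: norm_eq_1)
  have xx: "x\<^sup>2 = 1" "x'\<^sup>2 = 1"
    using orthonormal_pairD(5)[OF o] orthonormal_pairD(5)[OF o'] n e(2) e'(2) by (auto simp: power2_eq_1_iff abs_if split: if_splits)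
  have ee: "e' \<bullet> e = cos \<theta>" by (simp add: j inner_vec_def sum_2 \<theta>_def cos_diff)
  have "(u' \<bullet> u)\<^sup>2 = x'\<^sup>2 * x\<^sup>2 * (cos \<theta>)\<^sup>2"
    by (simp add: e(2) e'(2) ee power_mult_distrib)
  then have uu: "(u' \<bullet> u)\<^sup>2 = (cos \<theta>)\<^sup>2" using xx by simp
  then have "(u' \<bullet> v)\<^sup>2 = (sin \<theta>)\<^sup>2"
    using orthonormal_norm[OF o, of u'] orthonormal_pairD(5)[OF o'] sin_squared_eq[of \<theta>] by simp
  then have uv: "\<bar>u' \<bullet> v\<bar> = \<bar>sin \<theta>\<bar>" by (simp add: power2_eq_iff abs_eq_iff)
  have "\<theta> = pi * of_int (2 * (int j' - int j)) / real N"
    by (simp add: \<theta>_def diff_divide_distrib[symmetric] algebra_simps)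
  then consider "sin \<theta> = 0" | "1 / real N \<le> \<bar>sin \<theta>\<bar>"
    using abs_sin_rational_angle[OF N] by metis
  then show ?thesis
  proof cases
    case 1
    then have "u' \<bullet> v = 0" "(u' \<bullet> u)\<^sup>2 = 1" using uv uu sin_cos_squared_add[of \<theta>] by auto
    then show ?thesis using orthonormal_expansion[OF o, of u'] by (auto simp: power2_eq_1_iff)
  next
    case 2
    then show ?thesis using uv by simp
  qed
qed

text \<open>The number of scales is at most 5 + log 2 N, and log 2 N is at most 3/2 ln N. As ln N
  \<ge> ln 8 \<ge> 2, the summand 5 is at most 5/2 ln N, which gives the factor 4.\<close>

lemma dyadic_exponent_log:
  assumes N: "10 < N"
  shows "\<exists>n. 8 * real N \<le> 2 ^ n \<and> real (Suc n) \<le> 4 * ln (real N)"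
proof -
  define n where "n = nat \<lceil>log 2 (8 * real N)\<rceil>"
  have l0: "0 \<le> log 2 (8 * real N)" using N by (subst zero_le_log_cancel_iff) auto
  have "log 2 (8 * real N) \<le> real n" unfolding n_def by linarith
  then have "8 * real N \<le> 2 powr real n" using N by (simp add: log_le_iff)
  then have 1: "8 * real N \<le> 2 ^ n" by (simp add: powr_realpow)
  have "real n \<le> log 2 (8 * real N) + 1" unfolding n_def using l0 by linarith
  also have "log 2 (8 * real N) = log 2 (2 ^ 3) + log 2 (real N)" 
    using N log_mult[of 2 "2 ^ 3" "real N"] by simp
  also have "log 2 (2 ^ 3) = (3::real)" by (subst log_nat_power) auto
  finally have n: "real (Suc n) \<le> 5 + log 2 (real N)" by simp
  have N0: "0 \<le> ln (real N)" using N by simp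
  have "log 2 (real N) \<le> 3 / 2 * ln (real N)"
  proof -
    have "ln (real N) * (2 / 3) \<le> ln (real N) * ln 2" using ln2_ge_two_thirds N0 by (intro mult_left_mono) auto
    then have "ln (real N) * (2 / 3) / ln 2 \<le> ln (real N)" by (simp add: divide_le_eq)
    then show ?thesis
      using mult_left_mono[of "ln (real N) * (2 / 3) / ln 2" "ln (real N)" "3 / 2"] by (simp add: log_def)
  qed
  moreover have "2 \<le> ln (real N)"
  proof -
    have "ln ((2::real) ^ 3) = 3 * ln 2" by (subst ln_realpow) auto
    then have "2 \<le> ln ((2::real) ^ 3)" using ln2_ge_two_thirds by simp
    also have "\<dots> \<le> ln (real N)" using N by (subst ln_le_cancel_iff) auto
    finally show ?thesis .
  qed
  ultimately have "real (Suc n) \<le> 4 * ln (real N)" using n by linarith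
  with 1 show ?thesis by blast
qed

section \<open>Maximal operators\<close>

lemma rectangle_eq_hrect:
  assumes o: "orthonormal_pair u v"
  shows "rectangle p u v a b = hrect (p + (a / 2) *\<^sub>R u + (b / 2) *\<^sub>R v) u v (a / 2) (b / 2)"
proof (intro set_eqI iffI)
  fix x assume "x \<in> rectangle p u v a b"
  then obtain s t where x: "x = p + s *\<^sub>R u + t *\<^sub>R v" "0 \<le> s" "s \<le> a" "0 \<le> t" "t \<le> b"
    by (auto simp: rectangle_def)
  have "(x - (p + (a / 2) *\<^sub>R u + (b / 2) *\<^sub>R v)) \<bullet> u = s - a / 2"
    "(x - (p + (a / 2) *\<^sub>R u + (b / 2) *\<^sub>R v)) \<bullet> v = t - b / 2"
    by (simp_all add: x(1) inner_diff_left inner_add_left orthonormal_pairD[OF o])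
  moreover have "\<bar>s - a / 2\<bar> \<le> a / 2" "\<bar>t - b / 2\<bar> \<le> b / 2" using x by arith+
  ultimately show "x \<in> hrect (p + (a / 2) *\<^sub>R u + (b / 2) *\<^sub>R v) u v (a / 2) (b / 2)"
    by (simp only: mem_hrect)
next
  fix x assume x: "x \<in> hrect (p + (a / 2) *\<^sub>R u + (b / 2) *\<^sub>R v) u v (a / 2) (b / 2)"
  let ?s = "(x - p) \<bullet> u" and ?t = "(x - p) \<bullet> v"
  have "x = p + ?s *\<^sub>R u + ?t *\<^sub>R v"
    using orthonormal_expansion[OF o, of "x - p"] by (simp add: algebra_simps)
  moreover have "(x - (p + (a / 2) *\<^sub>R u + (b / 2) *\<^sub>R v)) \<bullet> u = ?s - a / 2"
    "(x - (p + (a / 2) *\<^sub>R u + (b / 2) *\<^sub>R v)) \<bullet> v = ?t - b / 2"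
    by (simp_all add: inner_diff_left inner_add_left orthonormal_pairD[OF o])
  then have "\<bar>?s - a / 2\<bar> \<le> a / 2" "\<bar>?t - b / 2\<bar> \<le> b / 2"
    using x by (simp_all only: mem_hrect)
  then have "0 \<le> ?s" "?s \<le> a" "0 \<le> ?t" "?t \<le> b" by arith+
  ultimately show "x \<in> rectangle p u v a b"
    unfolding rectangle_def mem_Collect_eq by (intro exI[of _ ?s] exI[of _ ?t]) simp
qed

lemma hrect_eq_rectangle:
  assumes o: "orthonormal_pair u v"
  shows "hrect c u v a b = rectangle (c - a *\<^sub>R u - b *\<^sub>R v) u v (2 * a) (2 * b)"
  by (simp add: rectangle_eq_hrect[OF o])

lemma hrect_in_cubes:
  assumes "orthonormal_pair u v" "0 < r"
  shows "hrect c u v r r \<in> cubes"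
  unfolding cubes_def hrect_eq_rectangle[OF assms(1)] using assms
  by (intro CollectI exI[of _ "c - r *\<^sub>R u - r *\<^sub>R v"] exI[of _ u] exI[of _ v] exI[of _ "2 * r"]) auto

lemma cubesE:
  assumes "R \<in> cubes"
  obtains c u v r where "orthonormal_pair u v" "0 < r" "R = hrect c u v r r"
proof -
  obtain p u v a where "R = rectangle p u v a a" "orthonormal_pair u v" "0 < a"
    using assms by (auto simp: cubes_def)
  then show thesis using that[of u v "a / 2"] by (simp add: rectangle_eq_hrect)
qed

lemma hrect_in_directional_rectangles:
  assumes "orthonormal_pair u v" "0 < b" "b \<le> a" "e \<in> \<Sigma>" "u = k *\<^sub>R e"
  shows "hrect c u v a b \<in> directional_rectangles \<Sigma>"
  unfolding directional_rectangles_def hrect_eq_rectangle[OF assms(1)] using assms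
  by (intro CollectI exI[of _ "c - a *\<^sub>R u - b *\<^sub>R v"] exI[of _ u] exI[of _ v] exI[of _ "2 * a"] exI[of _ "2 * b"]) auto

lemma directional_rectanglesE:
  assumes "R \<in> directional_rectangles \<Sigma>"
  obtains c u v a b e k where "orthonormal_pair u v" "0 < b" "b \<le> a" "e \<in> \<Sigma>" "u = k *\<^sub>R e" "R = hrect c u v a b"
proof -
  obtain p u v a b e k where "R = rectangle p u v a b" "orthonormal_pair u v" "0 < b" "b \<le> a" "e \<in> \<Sigma>" "u = k *\<^sub>R e"
    using assms by (auto simp: directional_rectangles_def)
  then show thesis using that[of u v "b / 2" "a / 2" e k] by (simp add: rectangle_eq_hrect)
qed

section \<open>Level sets of maximal operators\<close>

lemma hrect_enlarge:
  assumes o: "orthonormal_pair u v" and ab: "0 < a" "0 < b" and s: "1 < s"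
  shows "hrect c u v a b \<subseteq> interior (hrect c u v (s * a) (s * b))"
proof (rule order_trans)
  show "hrect c u v a b \<subseteq> {x. \<bar>(x - c) \<bullet> u\<bar> < s * a \<and> \<bar>(x - c) \<bullet> v\<bar> < s * b}"
    using mult_strict_right_mono[OF s ab(1)] mult_strict_right_mono[OF s ab(2)] by (auto simp: mem_hrect)
  show "{x. \<bar>(x - c) \<bullet> u\<bar> < s * a \<and> \<bar>(x - c) \<bullet> v\<bar> < s * b} \<subseteq> interior (hrect c u v (s * a) (s * b))"
  proof (rule interior_maximal)
    show "open {x. \<bar>(x - c) \<bullet> u\<bar> < s * a \<and> \<bar>(x - c) \<bullet> v\<bar> < s * b}"
      by (intro open_Collect_conj open_Collect_less continuous_intros)
  qed (auto simp: mem_hrect)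
qed

text \<open>The rectangles are closed, so a point of a level set may lie on the boundary of its
  rectangle. Dilations close to 1 move it to the interior and change the average by an arbitrarily
  small factor only.\<close>

definition enlargeable :: "(real^2) set set \<Rightarrow> bool" where
  "enlargeable \<B> \<longleftrightarrow> (\<forall>R\<in>\<B>. \<exists>m>0. emeasure lebesgue R = ennreal m \<and>
     (\<forall>s>1. \<exists>R'\<in>\<B>. R \<subseteq> interior R' \<and> emeasure lebesgue R' = ennreal (s * s * m)))"

lemma enlargeable_cubes: "enlargeable cubes"
  unfolding enlargeable_def
proof
  fix R assume "R \<in> cubes"
  then obtain c u v r where R: "orthonormal_pair u v" "0 < r" "R = hrect c u v r r" by (rule cubesE)
  have "\<exists>R'\<in>cubes. R \<subseteq> interior R' \<and> emeasure lebesgue R' = ennreal (s * s * (4 * r * r))" if "1 < s" for s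
    using that R hrect_enlarge[OF R(1,2,2) that, of c]
    by (intro bexI[of _ "hrect c u v (s * r) (s * r)"] conjI hrect_in_cubes) (auto simp: emeasure_hrect mult_ac)
  then show "\<exists>m>0. emeasure lebesgue R = ennreal m \<and> (\<forall>s>1. \<exists>R'\<in>cubes. R \<subseteq> interior R' \<and> emeasure lebesgue R' = ennreal (s * s * m))"
    using R by (intro exI[of _ "4 * r * r"]) (auto simp: emeasure_hrect)
qed

lemma enlargeable_directional_rectangles: "enlargeable (directional_rectangles \<Sigma>)"
  unfolding enlargeable_def
proof
  fix R assume "R \<in> directional_rectangles \<Sigma>"
  then obtain c u v a b e k where R: "orthonormal_pair u v" "0 < b" "b \<le> a" "e \<in> \<Sigma>" "u = k *\<^sub>R e" "R = hrect c u v a b"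
    by (rule directional_rectanglesE)
  have a: "0 < a" using R by simp
  have "\<exists>R'\<in>directional_rectangles \<Sigma>. R \<subseteq> interior R' \<and> emeasure lebesgue R' = ennreal (s * s * (4 * a * b))" if "1 < s" for s
    using that a R(2,3) hrect_enlarge[OF R(1) a R(2) that, of c]
    by (intro bexI[of _ "hrect c u v (s * a) (s * b)"] conjI hrect_in_directional_rectangles[OF R(1) _ _ R(4,5)])
      (auto simp: emeasure_hrect[OF R(1)] R(6) mult_ac)
  then show "\<exists>m>0. emeasure lebesgue R = ennreal m \<and> (\<forall>s>1. \<exists>R'\<in>directional_rectangles \<Sigma>. R \<subseteq> interior R' \<and> emeasure lebesgue R' = ennreal (s * s * m))"
    using R a by (intro exI[of _ "4 * a * b"]) (auto simp: emeasure_hrect)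
qed

lemma ennreal_less_average_iff:
  assumes "0 < m" "0 \<le> t"
  shows "ennreal t < 1 / ennreal m * A \<longleftrightarrow> ennreal (t * m) < A"
proof -
  have inv: "1 / ennreal m = ennreal (1 / m)" using assms by (simp add: divide_ennreal[symmetric])
  show ?thesis
  proof (cases A rule: ennreal_cases)
    case (real x)
    have "1 / ennreal m * A = ennreal (x / m)"
      unfolding inv real using real assms by (subst ennreal_mult[symmetric]) auto
    then show ?thesis using real assms by (simp add: ennreal_less_iff field_simps)
  next
    case top
    then show ?thesis using assms by (simp add: inv ennreal_mult_top)
  qed
qed

lemma maximal_operator_less_iff:
  assumes "enlargeable \<B>" "0 \<le> t"
  shows "ennreal t < maximal_operator \<B> g x \<longleftrightarrow>
    (\<exists>R\<in>\<B>. \<exists>m>0. x \<in> R \<and> emeasure lebesgue R = ennreal m \<and> ennreal (t * m) < (\<integral>\<^sup>+y\<in>R. g y \<partial>lebesgue))"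
proof
  assume "ennreal t < maximal_operator \<B> g x"
  then obtain R where R: "R \<in> \<B>" "ennreal t < indicator R x * ((1 / emeasure lebesgue R) * (\<integral>\<^sup>+y\<in>R. g y \<partial>lebesgue))"
    unfolding maximal_operator_def less_SUP_iff by blast
  obtain m where m: "0 < m" "emeasure lebesgue R = ennreal m"
    using assms(1) R(1) unfolding enlargeable_def by blast
  have "x \<in> R" using R(2) by (rule_tac ccontr) simp
  then have "ennreal (t * m) < (\<integral>\<^sup>+y\<in>R. g y \<partial>lebesgue)"
    using R(2) ennreal_less_average_iff[OF m(1) assms(2)] by (simp add: m(2))
  then show "\<exists>R\<in>\<B>. \<exists>m>0. x \<in> R \<and> emeasure lebesgue R = ennreal m \<and> ennreal (t * m) < (\<integral>\<^sup>+y\<in>R. g y \<partial>lebesgue)"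
    using R(1) m \<open>x \<in> R\<close> by blast
next
  assume "\<exists>R\<in>\<B>. \<exists>m>0. x \<in> R \<and> emeasure lebesgue R = ennreal m \<and> ennreal (t * m) < (\<integral>\<^sup>+y\<in>R. g y \<partial>lebesgue)"
  then obtain R m where R: "R \<in> \<B>" "0 < m" "x \<in> R" "emeasure lebesgue R = ennreal m" "ennreal (t * m) < (\<integral>\<^sup>+y\<in>R. g y \<partial>lebesgue)"
    by blast
  have "ennreal t < indicator R x * ((1 / emeasure lebesgue R) * (\<integral>\<^sup>+y\<in>R. g y \<partial>lebesgue))"
    using R ennreal_less_average_iff[OF R(2) assms(2)] by simp
  then show "ennreal t < maximal_operator \<B> g x"
    unfolding maximal_operator_def less_SUP_iff using R(1) by blast
qed

lemma slightly_larger_square: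
  fixes y A :: real
  assumes "0 \<le> y" "y < A"
  shows "\<exists>s>1. s * s * y < A"
proof -
  \<comment> \<open>Since e \<le> 1, (1 + e)^2 y exceeds y by at most 3 e y, which is less than e *
    4 (y + 1). The added 1 makes the inequality strict also for y = 0.\<close>
  define e where "e = min 1 ((A - y) / (4 * (y + 1)))"
  have e: "0 < e" "e \<le> 1" "e * (4 * (y + 1)) \<le> A - y"
  proof -
    show "0 < e" "e \<le> 1" using assms by (auto simp: e_def)
    have "e \<le> (A - y) / (4 * (y + 1))" by (simp add: e_def)
    then show "e * (4 * (y + 1)) \<le> A - y" using assms by (subst (asm) pos_le_divide_eq) auto
  qed
  have ey: "0 \<le> e * y" using e assms by simp
  have "e * (e * y) \<le> 1 * (e * y)" using e ey by (intro mult_right_mono) auto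
  then have "(1 + e) * (1 + e) * y \<le> y + 3 * (e * y)" by (simp add: algebra_simps)
  also have "\<dots> < y + e * (4 * (y + 1))" using e ey by (simp add: algebra_simps)
  also have "\<dots> \<le> A" using e by simp
  finally show ?thesis using e by (intro exI[of _ "1 + e"]) auto
qed

lemma maximal_operator_less_interior:
  assumes B: "enlargeable \<B>" and t: "0 \<le> t" and x: "ennreal t < maximal_operator \<B> g x"
  obtains R m where "R \<in> \<B>" "0 < m" "x \<in> interior R" "emeasure lebesgue R = ennreal m"
    "ennreal (t * m) < (\<integral>\<^sup>+y\<in>R. g y \<partial>lebesgue)"
proof -
  obtain R m where R: "R \<in> \<B>" "0 < m" "x \<in> R" "emeasure lebesgue R = ennreal m" "ennreal (t * m) < (\<integral>\<^sup>+y\<in>R. g y \<partial>lebesgue)"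
    using x unfolding maximal_operator_less_iff[OF B t] by blast
  have "\<exists>s>1. ennreal (s * s * (t * m)) < (\<integral>\<^sup>+y\<in>R. g y \<partial>lebesgue)"
  proof (cases "\<integral>\<^sup>+y\<in>R. g y \<partial>lebesgue" rule: ennreal_cases)
    case (real A)
    then have "t * m < A" using R(5) t R(2) by (simp add: ennreal_less_iff)
    then obtain s where "1 < s" "s * s * (t * m) < A"
      using slightly_larger_square[of "t * m" A] t R(2) by auto
    then show ?thesis using real t R(2) by (intro exI[of _ s]) (auto simp: ennreal_less_iff)
  next
    case top
    then show ?thesis by (intro exI[of _ 2]) auto
  qed
  then obtain s where s: "1 < s" "ennreal (s * s * (t * m)) < (\<integral>\<^sup>+y\<in>R. g y \<partial>lebesgue)" by blast
  obtain m' where m': "0 < m'" "emeasure lebesgue R = ennreal m'"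
    "\<forall>s>1. \<exists>R'\<in>\<B>. R \<subseteq> interior R' \<and> emeasure lebesgue R' = ennreal (s * s * m')"
    using B R(1) unfolding enlargeable_def by blast
  have "m' = m" using m'(1,2) R(2,4) by simp
  then obtain R' where R': "R' \<in> \<B>" "R \<subseteq> interior R'" "emeasure lebesgue R' = ennreal (s * s * m)"
    using m'(3) s(1) by blast
  have "R \<subseteq> R'" using R'(2) interior_subset by blast
  then have "(\<integral>\<^sup>+y\<in>R. g y \<partial>lebesgue) \<le> (\<integral>\<^sup>+y\<in>R'. g y \<partial>lebesgue)"
    by (intro nn_integral_mono) (auto simp: indicator_def)
  then have "ennreal (t * (s * s * m)) < (\<integral>\<^sup>+y\<in>R'. g y \<partial>lebesgue)"
    using s(2) by (simp add: mult_ac)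
  then show thesis using that[OF R'(1) _ _ R'(3)] R(2,3) R'(2) s(1) by auto
qed

text \<open>A slightly dilated rectangle contains x in its interior and still has average above the
  level, so its interior lies in the level set. This works for arbitrary g, and makes the iterated
  function W Borel measurable.\<close>

lemma open_maximal_operator_less:
  assumes B: "enlargeable \<B>"
  shows "open {x. t < maximal_operator \<B> g x}"
proof (cases t rule: ennreal_cases)
  case (real r)
  show ?thesis
  proof (subst open_subopen, safe)
    fix x assume "t < maximal_operator \<B> g x"
    then obtain R m where R: "R \<in> \<B>" "0 < m" "x \<in> interior R" "emeasure lebesgue R = ennreal m"
      "ennreal (r * m) < (\<integral>\<^sup>+y\<in>R. g y \<partial>lebesgue)"
      using maximal_operator_less_interior[OF B real(1)] unfolding real(2) by blast
    have "interior R \<subseteq> {x. t < maximal_operator \<B> g x}"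
      unfolding real(2) maximal_operator_less_iff[OF B real(1)] using R interior_subset by blast
    then show "\<exists>T. open T \<and> x \<in> T \<and> T \<subseteq> {x. t < maximal_operator \<B> g x}"
      using R(3) by (intro exI[of _ "interior R"]) auto
  qed
next
  case top
  then show ?thesis by simp
qed

lemma borel_measurable_maximal_operator:
  assumes "enlargeable \<B>"
  shows "maximal_operator \<B> g \<in> borel_measurable borel"
  using open_maximal_operator_less[OF assms] by (intro borel_measurableI_greater) (auto intro: borel_open)

lemma integral_le_maximal_operator:
  assumes "R \<in> \<B>" "x \<in> R" "emeasure lebesgue R = ennreal m" "0 < m"
  shows "(\<integral>\<^sup>+y\<in>R. g y \<partial>lebesgue) \<le> ennreal m * maximal_operator \<B> g x"
proof -
  have "1 / ennreal m * (\<integral>\<^sup>+y\<in>R. g y \<partial>lebesgue) \<le> maximal_operator \<B> g x"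
    unfolding maximal_operator_def using assms by (intro SUP_upper2[OF assms(1)]) simp
  then have "ennreal m * (1 / ennreal m * (\<integral>\<^sup>+y\<in>R. g y \<partial>lebesgue)) \<le> ennreal m * maximal_operator \<B> g x"
    by (intro mult_left_mono) auto
  moreover have "ennreal m * (1 / ennreal m) = 1"
  proof -
    have "1 / ennreal m = ennreal (1 / m)" using assms by (simp add: divide_ennreal[symmetric])
    then show ?thesis using assms(4) by (simp add: ennreal_mult[symmetric])
  qed
  ultimately show ?thesis by (simp add: mult.assoc[symmetric])
qed

section \<open>From finite families to level sets\<close>

lemma weak_type_directional_finite:
  fixes c u v :: "'i \<Rightarrow> real^2" and a b :: "'i \<Rightarrow> real" and g :: "real^2 \<Rightarrow> real" and w G W :: "real^2 \<Rightarrow> ennreal"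
  assumes N: "10 < N" and I: "finite I"
    and meas [measurable]: "w \<in> borel_measurable borel" "G \<in> borel_measurable borel"
      "g \<in> borel_measurable borel" "W \<in> borel_measurable borel"
    and on: "\<And>i. i \<in> I \<Longrightarrow> orthonormal_pair (u i) (v i)"
    and ab: "\<And>i. i \<in> I \<Longrightarrow> 0 < b i" "\<And>i. i \<in> I \<Longrightarrow> b i \<le> a i"
    and dir: "\<And>i. i \<in> I \<Longrightarrow> \<exists>e\<in>uniform_directions N. \<exists>k. u i = k *\<^sub>R e"
    and cube: "\<And>x y p q r. orthonormal_pair p q \<Longrightarrow> 0 < r \<Longrightarrow> y \<in> hrect x p q r r \<Longrightarrow>
      (\<integral>\<^sup>+z\<in>hrect x p q r r. w z \<partial>lborel) \<le> ennreal (4 * r\<^sup>2) * G y"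
    and WG: "\<And>i x. i \<in> I \<Longrightarrow> x \<in> hrect (c i) (u i) (v i) (8 * a i) (b i) \<Longrightarrow>
      (\<integral>\<^sup>+y\<in>hrect (c i) (u i) (v i) (8 * a i) (b i). G y \<partial>lborel) \<le> ennreal (32 * a i * b i) * W x"
    and g0: "\<And>x. 0 \<le> g x" and t: "0 < t"
    and avg: "\<And>i. i \<in> I \<Longrightarrow> ennreal (t * (4 * a i * b i)) < (\<integral>\<^sup>+y\<in>hrect (c i) (u i) (v i) (a i) (b i). ennreal (g y) \<partial>lborel)"
    and F: "(\<integral>\<^sup>+x. (ennreal (g x))\<^sup>2 * W x \<partial>lborel) < \<infinity>"
  shows "ennreal (t\<^sup>2) * (\<integral>\<^sup>+x\<in>(\<Union>i\<in>I. hrect (c i) (u i) (v i) (a i) (b i)). w x \<partial>lborel)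
    \<le> ennreal (86000000 * ln (real N)) * (\<integral>\<^sup>+x. (ennreal (g x))\<^sup>2 * W x \<partial>lborel)"
proof -
  obtain n where n_ge: "8 * real N \<le> 2 ^ n" and n_le: "real (Suc n) \<le> 4 * ln (real N)"
    using dyadic_exponent_log[OF N] by blast
  let ?R = "\<lambda>i. hrect (c i) (u i) (v i) (a i) (b i)" and ?R' = "\<lambda>i. hrect (c i) (u i) (v i) (8 * a i) (b i)"
  have a0: "0 < a i" if "i \<in> I" for i using ab[OF that] by linarith
  \<comment> \<open>An infinite average of G would force W to be infinite on the rectangle. As the
    integral of g^2 W is finite, g would then vanish almost everywhere on it, against
    \<open>avg\<close>.\<close>
  have fin: "(\<integral>\<^sup>+y\<in>?R' i. G y \<partial>lborel) \<noteq> \<infinity>" if i: "i \<in> I" for i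
  proof
    assume inf: "(\<integral>\<^sup>+y\<in>?R' i. G y \<partial>lborel) = \<infinity>"
    have W: "W x = \<infinity>" if "x \<in> ?R i" for x
    proof -
      have "x \<in> ?R' i" using that hrect_mono[of "a i" "8 * a i" "b i" "b i"] a0[OF i] by auto
      then have "ennreal (32 * a i * b i) * W x = \<infinity>" using WG[OF i] inf by (simp add: top_unique)
      then show ?thesis by (auto simp: ennreal_mult_eq_top_iff)
    qed
    have "AE x in lborel. (ennreal (g x))\<^sup>2 * W x \<noteq> \<infinity>"
      by (rule nn_integral_PInf_AE) (use F in auto)
    then have "AE x in lborel. ennreal (g x) * indicator (?R i) x = 0"
      by eventually_elim (use W in \<open>auto simp: indicator_def ennreal_mult_eq_top_iff\<close>)
    then have "(\<integral>\<^sup>+y\<in>?R i. ennreal (g y) \<partial>lborel) = 0"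
      by (subst nn_integral_0_iff_AE) auto
    then show False using avg[OF i] by simp
  qed
  define V where "V i = enn2real (\<integral>\<^sup>+y\<in>?R' i. G y \<partial>lborel) / (32 * a i * b i)" for i
  have V0: "0 \<le> V i" if "i \<in> I" for i using ab[OF that] a0[OF that] by (simp add: V_def)
  have V: "(\<integral>\<^sup>+y\<in>?R' i. G y \<partial>lborel) = ennreal (32 * a i * b i * V i)" if "i \<in> I" for i
    using fin[OF that] ab[OF that] a0[OF that] by (simp add: V_def less_top)
  interpret rectangle_family I c u v a b V w G "1 / real N" n
  proof
    fix i k assume "i \<in> I" "k \<in> I"
    then show "u k = u i \<or> u k = - u i \<or> 1 / real N \<le> \<bar>u k \<bullet> v i\<bar>"
    proof -
      obtain e x e' x' where e: "e \<in> uniform_directions N" "u i = x *\<^sub>R e"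
        "e' \<in> uniform_directions N" "u k = x' *\<^sub>R e'"
        using dir \<open>i \<in> I\<close> \<open>k \<in> I\<close> by meson
      have "3 \<le> N" using N by simp
      from uniform_directions_separated[OF this on[OF \<open>i \<in> I\<close>] on[OF \<open>k \<in> I\<close>] e] show ?thesis .
    qed
  qed (use I meas on ab V0 V cube N n_ge in auto)
  have "ennreal (t\<^sup>2) * emeasure wM (\<Union>i\<in>I. ?R i) \<le> ennreal (21500000 * real (Suc n)) * (\<integral>\<^sup>+x. (ennreal (g x))\<^sup>2 * W x \<partial>lborel)"
  proof (rule weak_type_finite)
    show "ennreal (t * area (?R i)) \<le> (\<integral>\<^sup>+y\<in>?R i. ennreal (g y) \<partial>lborel)" if "i \<in> I" for i
      using avg[OF that] area_R[OF that] by simp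
    show "ennreal (V i) \<le> W x" if "i \<in> I" "x \<in> ?R i" for i x
    proof -
      have "x \<in> ?R' i" using that(2) hrect_mono[of "a i" "8 * a i" "b i" "b i"] a0[OF that(1)] by auto
      then have "ennreal (32 * a i * b i * V i) \<le> ennreal (32 * a i * b i) * W x"
        using WG[OF that(1)] V[OF that(1)] by simp
      then have "ennreal (32 * a i * b i) * ennreal (V i) \<le> ennreal (32 * a i * b i) * W x"
        using V0[OF that(1)] a0[OF that(1)] ab[OF that(1)] by (subst ennreal_mult[symmetric]) auto
      then show ?thesis by (rule ennreal_cancel_left[rotated]) (use a0[OF that(1)] ab[OF that(1)] in simp)
    qed
  qed (use g0 t in auto)
  also have "\<dots> \<le> ennreal (86000000 * ln (real N)) * (\<integral>\<^sup>+x. (ennreal (g x))\<^sup>2 * W x \<partial>lborel)"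
    using n_le by (intro mult_right_mono ennreal_leI) auto
  finally show ?thesis using I by (subst (asm) emeasure_wM) auto
qed

text \<open>Measurability on the whole plane has to be recovered from integrability on compact sets:
  w is the pointwise limit of its truncations to balls.\<close>

lemma weight_borel_version:
  assumes "weight w"
  obtains w' :: "real^2 \<Rightarrow> ennreal" where "w' \<in> borel_measurable borel" "AE x in lborel. ennreal (w x) = w' x"
proof -
  have "w \<in> borel_measurable lebesgue"
  proof (rule borel_measurable_LIMSEQ_real)
    fix i :: nat
    have "set_integrable lebesgue (cball 0 (real i)) w" using assms by (auto simp: weight_def)
    then show "(\<lambda>x. indicator (cball 0 (real i)) x *\<^sub>R w x) \<in> borel_measurable lebesgue"
      unfolding set_integrable_def by (rule borel_measurable_integrable)
  next
    fix x :: "real^2"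
    obtain k :: nat where k: "norm x \<le> real k" using real_arch_simple by blast
    have "\<forall>\<^sub>F i in sequentially. indicator (cball 0 (real i)) x *\<^sub>R w x = w x"
      using k by (intro eventually_sequentiallyI[of k]) (auto simp: indicator_def)
    then show "(\<lambda>i. indicator (cball 0 (real i)) x *\<^sub>R w x) \<longlonglongrightarrow> w x"
      by (rule tendsto_eventually)
  qed
  then have "(\<lambda>x. ennreal (w x)) \<in> borel_measurable (completion lborel)" by simp
  from completion_ex_borel_measurable[OF this] show thesis using that by auto
qed

lemma nn_integral_lebesgue_AE:
  assumes "AE x in lborel. p x = q x"
  shows "(\<integral>\<^sup>+x. p x \<partial>lebesgue) = (\<integral>\<^sup>+x. q x \<partial>lborel)"
  unfolding nn_integral_completion using assms by (rule nn_integral_cong_AE)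

lemma set_nn_integral_lebesgue_AE:
  assumes "AE x in lborel. p x = q x"
  shows "(\<integral>\<^sup>+x\<in>A. p x \<partial>lebesgue) = (\<integral>\<^sup>+x\<in>A. q x \<partial>lborel)"
  by (rule nn_integral_lebesgue_AE) (use assms in auto)

text \<open>The bound for finite families does not depend on their size. Lindelof reduces the
  covering of the level set to countably many rectangles, and continuity from below along finite
  subfamilies gives the full estimate.\<close>

lemma weak_type_level:
  fixes w :: "real^2 \<Rightarrow> real" and f :: "real^2 \<Rightarrow> complex"
  assumes N: "10 < N" and w: "weight w"
    and W_def: "W = directional_maximal (uniform_directions N) (hl_maximal (\<lambda>x. ennreal (w x)))"
    and f: "f \<in> borel_measurable lebesgue" and F: "(\<integral>\<^sup>+x. (ennreal (norm (f x)))\<^sup>2 * W x \<partial>lebesgue) < \<infinity>"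
    and t: "0 < t"
  shows "ennreal (t\<^sup>2) * weight_measure w {x. directional_maximal (uniform_directions N) (\<lambda>y. ennreal (norm (f y))) x > ennreal t}
    \<le> ennreal (86000000 * ln (real N)) * (\<integral>\<^sup>+x. (ennreal (norm (f x)))\<^sup>2 * W x \<partial>lebesgue)"
proof -
  let ?\<Sigma> = "uniform_directions N"
  let ?U = "{x. directional_maximal ?\<Sigma> (\<lambda>y. ennreal (norm (f y))) x > ennreal t}"
  let ?F = "\<integral>\<^sup>+x. (ennreal (norm (f x)))\<^sup>2 * W x \<partial>lebesgue"
  obtain w' where w' [measurable]: "w' \<in> borel_measurable borel" and ww': "AE x in lborel. ennreal (w x) = w' x"
    using weight_borel_version[OF w] by blast
  have "(\<lambda>x. norm (f x)) \<in> borel_measurable (completion lborel)" using f by measurable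
  then obtain g0 where g0: "g0 \<in> borel_measurable lborel" "AE x in lborel. norm (f x) = g0 x"
    using completion_ex_borel_measurable_real by blast
  define g where "g x = \<bar>g0 x\<bar>" for x
  have g_borel [measurable]: "g \<in> borel_measurable borel" using g0(1) unfolding g_def by simp
  have g_nonneg: "0 \<le> g x" for x by (simp add: g_def)
  have fg: "AE x in lborel. norm (f x) = g x"
    using g0(2) by eventually_elim (metis abs_norm_cancel g_def)
  define G where "G = hl_maximal (\<lambda>x. ennreal (w x))"
  have G [measurable]: "G \<in> borel_measurable borel"
    unfolding G_def hl_maximal_def by (rule borel_measurable_maximal_operator[OF enlargeable_cubes])
  have W [measurable]: "W \<in> borel_measurable borel"
    unfolding W_def directional_maximal_def
    by (rule borel_measurable_maximal_operator[OF enlargeable_directional_rectangles])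
  have F': "?F = (\<integral>\<^sup>+x. (ennreal (g x))\<^sup>2 * W x \<partial>lborel)"
    by (rule nn_integral_lebesgue_AE) (use fg in auto)
  have cube: "(\<integral>\<^sup>+z\<in>hrect x p q r r. w' z \<partial>lborel) \<le> ennreal (4 * r\<^sup>2) * G y"
    if "orthonormal_pair p q" "0 < r" "y \<in> hrect x p q r r" for x y p q and r :: real
  proof -
    have "(\<integral>\<^sup>+z\<in>hrect x p q r r. ennreal (w z) \<partial>lebesgue) \<le> ennreal (4 * r\<^sup>2) * G y"
      unfolding G_def hl_maximal_def
      using that by (intro integral_le_maximal_operator hrect_in_cubes) (auto simp: emeasure_hrect power2_eq_square mult_ac)
    then show ?thesis by (simp only: set_nn_integral_lebesgue_AE[OF ww'])
  qed
  \<comment> \<open>Lengthening by 8 keeps the side along u the longest one, so the new rectangle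
    belongs to the family that defines W.\<close>
  have WG: "(\<integral>\<^sup>+y\<in>hrect c u v (8 * a) b. G y \<partial>lborel) \<le> ennreal (32 * a * b) * W x"
    if "orthonormal_pair u v" "0 < b" "b \<le> a" "e \<in> ?\<Sigma>" "u = k *\<^sub>R e" "x \<in> hrect c u v (8 * a) b" for c u v a b e k x
  proof -
    have "(\<integral>\<^sup>+y\<in>hrect c u v (8 * a) b. G y \<partial>lebesgue) \<le> ennreal (32 * a * b) * W x"
      unfolding W_def directional_maximal_def G_def
      using that by (intro integral_le_maximal_operator hrect_in_directional_rectangles[OF that(1) _ _ that(4,5)])
        (auto simp: emeasure_hrect)
    then show ?thesis by (simp only: nn_integral_completion)
  qed
  define T where "T = {(c, u, v, a, b). orthonormal_pair u v \<and> 0 < b \<and> b \<le> a \<and> (\<exists>e\<in>?\<Sigma>. \<exists>k. u = k *\<^sub>R e)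
    \<and> ennreal (t * (4 * a * b)) < (\<integral>\<^sup>+y\<in>hrect c u v a b. ennreal (g y) \<partial>lborel)}"
  define rect where "rect = (\<lambda>(c, u, v, a, b). hrect c u v a b)"
  have cover: "?U \<subseteq> (\<Union>p\<in>T. interior (rect p))"
  proof
    fix x assume "x \<in> ?U"
    then have "ennreal t < maximal_operator (directional_rectangles ?\<Sigma>) (\<lambda>y. ennreal (norm (f y))) x"
      by (simp add: directional_maximal_def)
    then obtain R m where R: "R \<in> directional_rectangles ?\<Sigma>" "0 < m" "x \<in> interior R" "emeasure lebesgue R = ennreal m"
      "ennreal (t * m) < (\<integral>\<^sup>+y\<in>R. ennreal (norm (f y)) \<partial>lebesgue)"
      using maximal_operator_less_interior[OF enlargeable_directional_rectangles less_imp_le[OF t]] by blast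
    obtain c u v a b e k where h: "orthonormal_pair u v" "0 < b" "b \<le> a" "e \<in> ?\<Sigma>" "u = k *\<^sub>R e" "R = hrect c u v a b"
      using R(1) by (rule directional_rectanglesE)
    have "ennreal m = ennreal (4 * a * b)" using R(4) h by (simp add: emeasure_hrect)
    then have m: "m = 4 * a * b" using R(2) h by (subst (asm) ennreal_inj) auto
    have "(\<integral>\<^sup>+y\<in>R. ennreal (norm (f y)) \<partial>lebesgue) = (\<integral>\<^sup>+y\<in>R. ennreal (g y) \<partial>lborel)"
      by (rule set_nn_integral_lebesgue_AE) (use fg in auto)
    then have "(c, u, v, a, b) \<in> T" unfolding T_def using h R(5) m by auto
    then show "x \<in> (\<Union>p\<in>T. interior (rect p))"
      using R(3) h(6) by (intro UN_I[of "(c, u, v, a, b)"]) (auto simp: rect_def)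
  qed
  \<comment> \<open>The interiors still cover the level set, because the rectangles in
    \<open>cover\<close> were chosen with x in the interior.\<close>
  obtain \<F> where \<F>: "\<F> \<subseteq> (\<lambda>p. interior (rect p)) ` T" "countable \<F>" "\<Union>\<F> = (\<Union>p\<in>T. interior (rect p))"
    using Lindelof[of "(\<lambda>p. interior (rect p)) ` T"] by auto
  have "\<exists>T'. countable T' \<and> T' \<subseteq> T \<and> \<F> = (\<lambda>p. interior (rect p)) ` T'"
    using \<F>(1,2) by (intro countable_subset_image[THEN iffD1] conjI)
  then obtain T' where T': "T' \<subseteq> T" "countable T'" "\<F> = (\<lambda>p. interior (rect p)) ` T'"
    by (elim exE conjE)
  have UT': "?U \<subseteq> (\<Union>p\<in>T'. rect p)"
  proof -
    have "(\<Union>p\<in>T. interior (rect p)) = (\<Union>p\<in>T'. interior (rect p))" using \<F>(3) T'(3) by simp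
    also have "\<dots> \<subseteq> (\<Union>p\<in>T'. rect p)" by (intro UN_mono interior_subset order_refl)
    finally show ?thesis using cover by blast
  qed
  have rect_borel: "rect p \<in> sets borel" for p by (cases p) (simp add: rect_def)
  let ?\<mu> = "density lborel w'"
  have \<mu>: "emeasure ?\<mu> A = (\<integral>\<^sup>+x\<in>A. w' x \<partial>lborel)" if "A \<in> sets borel" for A
    using that by (simp add: emeasure_density)
  have fin_bound: "ennreal (t\<^sup>2) * emeasure ?\<mu> (\<Union>p\<in>I. rect p) \<le> ennreal (86000000 * ln (real N)) * ?F"
    if "finite I" "I \<subseteq> T" for I
  proof -
    define c u v a b where "c p = fst p" and "u p = fst (snd p)" and "v p = fst (snd (snd p))"
      and "a p = fst (snd (snd (snd p)))" and "b p = snd (snd (snd (snd p)))"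
      for p :: "(real^2) \<times> (real^2) \<times> (real^2) \<times> real \<times> real"
    note defs = c_def u_def v_def a_def b_def
    have TD: "orthonormal_pair (u p) (v p)" "0 < b p" "b p \<le> a p" "\<exists>e\<in>?\<Sigma>. \<exists>k. u p = k *\<^sub>R e"
      "ennreal (t * (4 * a p * b p)) < (\<integral>\<^sup>+y\<in>hrect (c p) (u p) (v p) (a p) (b p). ennreal (g y) \<partial>lborel)" if "p \<in> I" for p
    proof -
      have "p \<in> T" using that \<open>I \<subseteq> T\<close> by blast
      then have "orthonormal_pair (u p) (v p) \<and> 0 < b p \<and> b p \<le> a p \<and> (\<exists>e\<in>?\<Sigma>. \<exists>k. u p = k *\<^sub>R e)
        \<and> ennreal (t * (4 * a p * b p)) < (\<integral>\<^sup>+y\<in>hrect (c p) (u p) (v p) (a p) (b p). ennreal (g y) \<partial>lborel)"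
        unfolding T_def defs mem_Collect_eq case_prod_beta .
      then show "orthonormal_pair (u p) (v p)" "0 < b p" "b p \<le> a p" "\<exists>e\<in>?\<Sigma>. \<exists>k. u p = k *\<^sub>R e"
        "ennreal (t * (4 * a p * b p)) < (\<integral>\<^sup>+y\<in>hrect (c p) (u p) (v p) (a p) (b p). ennreal (g y) \<partial>lborel)"
        by blast+
    qed
    have rect: "rect p = hrect (c p) (u p) (v p) (a p) (b p)" for p by (cases p) (simp add: rect_def defs)
    have "ennreal (t\<^sup>2) * (\<integral>\<^sup>+x\<in>(\<Union>i\<in>I. hrect (c i) (u i) (v i) (a i) (b i)). w' x \<partial>lborel)
      \<le> ennreal (86000000 * ln (real N)) * (\<integral>\<^sup>+x. (ennreal (g x))\<^sup>2 * W x \<partial>lborel)"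
    proof (rule weak_type_directional_finite[where G=G, OF N \<open>finite I\<close>])
      show "(\<integral>\<^sup>+y\<in>hrect (c i) (u i) (v i) (8 * a i) (b i). G y \<partial>lborel) \<le> ennreal (32 * a i * b i) * W x"
        if "i \<in> I" "x \<in> hrect (c i) (u i) (v i) (8 * a i) (b i)" for i x
        using TD(4)[OF that(1)] WG[OF TD(1-3)[OF that(1)] _ _ that(2)] by blast
    qed (use TD cube F F' t w' G W g_borel g_nonneg in auto)
    then show ?thesis
      unfolding F'[symmetric] rect using \<open>finite I\<close> by (subst \<mu>) auto
  qed
  have "ennreal (t\<^sup>2) * emeasure ?\<mu> (\<Union>p\<in>T'. rect p) \<le> ennreal (86000000 * ln (real N)) * ?F"
  proof (cases "T' = {}")
    case False
    define A where "A n = (\<Union>p\<in>from_nat_into T' ` {..n}. rect p)" for n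
    have "incseq A" unfolding A_def incseq_def by (intro allI impI UN_mono image_mono) auto
    moreover have "A n \<in> sets ?\<mu>" for n
      unfolding A_def using rect_borel by (intro sets.finite_UN) (auto simp del: UN_simps)
    then have "range A \<subseteq> sets ?\<mu>" by (rule image_subsetI)
    ultimately have S: "(SUP n. emeasure ?\<mu> (A n)) = emeasure ?\<mu> (\<Union>n. A n)"
      by (intro SUP_emeasure_incseq)
    have "(\<Union>n. A n) = (\<Union>p\<in>range (from_nat_into T'). rect p)" unfolding A_def by auto
    then have eq: "(\<Union>n. A n) = (\<Union>p\<in>T'. rect p)" using False T'(2) by (simp add: range_from_nat_into)
    have "from_nat_into T' ` {..n} \<subseteq> T" for n using T'(1) from_nat_into[OF False] by auto
    then have "(SUP n. ennreal (t\<^sup>2) * emeasure ?\<mu> (A n)) \<le> ennreal (86000000 * ln (real N)) * ?F"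
      unfolding A_def by (intro SUP_least fin_bound) auto
    then show ?thesis
      unfolding eq[symmetric] S[symmetric] by (simp add: SUP_mult_left_ennreal)
  qed simp
  moreover have "weight_measure w ?U \<le> emeasure ?\<mu> (\<Union>p\<in>T'. rect p)"
  proof -
    have "weight_measure w ?U = (\<integral>\<^sup>+x\<in>?U. w' x \<partial>lborel)"
      unfolding weight_measure_def by (rule set_nn_integral_lebesgue_AE[OF ww'])
    also have "\<dots> \<le> (\<integral>\<^sup>+x\<in>(\<Union>p\<in>T'. rect p). w' x \<partial>lborel)"
      using UT' by (intro nn_integral_mono mult_left_mono) (auto simp: indicator_def)
    also have "\<dots> = emeasure ?\<mu> (\<Union>p\<in>T'. rect p)"
      using T'(2) rect_borel by (intro \<mu>[symmetric] sets.countable_UN'') auto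
    finally show ?thesis .
  qed
  ultimately show ?thesis by (meson mult_left_mono order_trans zero_le)
qed

theorem theorem1p4:
  shows "\<exists>C::real. C > 0 \<and>
    (\<forall>(N::nat) (w::real^2 \<Rightarrow> real) (W::real^2 \<Rightarrow> ennreal) (f::real^2 \<Rightarrow> complex).
       N > 10 \<longrightarrow> weight w \<longrightarrow>
       W = directional_maximal (uniform_directions N) (hl_maximal (\<lambda>x. ennreal (w x))) \<longrightarrow>
       f \<in> weighted_L2 W \<longrightarrow>
       (SUP t\<in>{0::real<..}. ennreal t * ennreal_sqrt (weight_measure w
          {x. directional_maximal (uniform_directions N) (\<lambda>y. ennreal (norm (f y))) x > ennreal t}))
       \<le> ennreal (C * sqrt (ln (real N))) * weighted_L2_norm W f)"
proof (intro exI[of _ "10000 :: real"] conjI allI impI)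
  fix N :: nat and w :: "real^2 \<Rightarrow> real" and W :: "real^2 \<Rightarrow> ennreal" and f :: "real^2 \<Rightarrow> complex"
  assume N: "N > 10" and w: "weight w"
    and W: "W = directional_maximal (uniform_directions N) (hl_maximal (\<lambda>x. ennreal (w x)))"
    and f: "f \<in> weighted_L2 W"
  let ?m = "\<lambda>t. weight_measure w {x. directional_maximal (uniform_directions N) (\<lambda>y. ennreal (norm (f y))) x > ennreal t}"
  let ?F = "\<integral>\<^sup>+x. (ennreal (norm (f x)))\<^sup>2 * W x \<partial>lebesgue"
  have fm: "f \<in> borel_measurable lebesgue" and "weighted_L2_norm W f < \<infinity>"
    using f by (auto simp: weighted_L2_def)
  then have "?F \<noteq> \<infinity>" by (auto simp: weighted_L2_norm_def ennreal_sqrt_def)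
  then obtain F where F: "0 \<le> F" "?F = ennreal F"
    by (cases ?F rule: ennreal_cases) auto
  have norm_f: "weighted_L2_norm W f = ennreal (sqrt F)"
    using F by (simp add: weighted_L2_norm_def ennreal_sqrt_def)
  have lnN: "0 \<le> ln (real N)" using N by simp
  show "(SUP t\<in>{0::real<..}. ennreal t * ennreal_sqrt (?m t)) \<le> ennreal (10000 * sqrt (ln (real N))) * weighted_L2_norm W f"
  proof (rule SUP_least)
    fix t :: real assume "t \<in> {0<..}"
    then have t: "0 < t" by simp
    have le: "ennreal (t\<^sup>2) * ?m t \<le> ennreal (86000000 * ln (real N) * F)"
      using weak_type_level[OF N w W fm _ t] F lnN by (simp add: ennreal_mult)
    obtain r where r: "0 \<le> r" "?m t = ennreal r"
    proof (cases "?m t" rule: ennreal_cases)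
      case top
      then have "ennreal (t\<^sup>2) * ?m t = \<infinity>" using t by (simp add: ennreal_mult_eq_top_iff)
      then show thesis using le by (simp add: top_unique)
    qed (use that in blast)
    have "ennreal (t\<^sup>2 * r) \<le> ennreal (86000000 * ln (real N) * F)"
      using le r by (simp add: ennreal_mult)
    then have "t\<^sup>2 * r \<le> 86000000 * ln (real N) * F"
      using lnN F(1) by (subst (asm) ennreal_le_iff) auto
    \<comment> \<open>86000000 is rounded up to a perfect square.\<close>
    also have "\<dots> \<le> 10000\<^sup>2 * ln (real N) * F"
      using lnN F(1) by (intro mult_right_mono) auto
    finally have "sqrt (t\<^sup>2 * r) \<le> sqrt (10000\<^sup>2 * ln (real N) * F)" by (rule real_sqrt_le_mono)
    then have "t * sqrt r \<le> 10000 * sqrt (ln (real N)) * sqrt F"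
      using t by (simp add: real_sqrt_mult)
    then have "ennreal (t * sqrt r) \<le> ennreal (10000 * sqrt (ln (real N)) * sqrt F)"
      by (rule ennreal_leI)
    moreover have "ennreal t * ennreal_sqrt (?m t) = ennreal (t * sqrt r)"
      using r t by (simp add: ennreal_sqrt_def ennreal_mult)
    moreover have "ennreal (10000 * sqrt (ln (real N)) * sqrt F) = ennreal (10000 * sqrt (ln (real N))) * weighted_L2_norm W f"
      unfolding norm_f using lnN F(1) by (intro ennreal_mult) auto
    ultimately show "ennreal t * ennreal_sqrt (?m t) \<le> ennreal (10000 * sqrt (ln (real N))) * weighted_L2_norm W f"
      by simp
  qed
qed simp

end
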